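(* Let $A$ be a countable abelian group. Then $\mathrm{Aut}(A)$ is (isomorphic to) a subgroup of the $K$-outer automorphism group of the $C^*$-algebra $C^*(\Gamma(A))$; that is, there is an injective group homomorphism $\mathrm{Aut}(A)\to\mathrm{Kout}\big(C^*(\Gamma(A))\big)$.
   Context: **Graphs.** A directed graph $G=(V,E,r,s)$ consists of countable sets $V$ (vertices), $E$ (edges) and maps $r,s:E\to V$ (range, source). It is row-finite if $r^{-1}(v)$ is finite for all $v\in V$. **Graph $C^*$-algebra.** For a row-finite directed graph $G$, $C^*(G)$ is the universal $C^*$-algebra generated by mutually orthogonal projections $\{p_v\}_{v\in V}$ and partial isometries $\{S_e\}_{e\in E}$ subject to $S_e^*S_e=p_{s(e)}$ for $e\in E$ and $\sum_{r(e)=v}S_eS_e^*=p_v$ for every $v\in V$ with $r^{-1}(v)\neq\emptyset$. Let $V_E=\{v\in V: r^{-1}(v)\ne\emptyset\}$ and let $B:\mathbb{Z}V_E\to\mathbb{Z}V$ be the homomorphism of free abelian groups with $B(v)=v-\sum_{r(e)=v}s(e)$. It is a known fact that $K_0(C^*(G))\cong\mathrm{coker}(B)$ via $[p_v]\mapsto v$. **$K$-outer automorphisms.** For a $C^*$-algebra $\mathcal{C}$, $\mathrm{Inn}(\mathcal{C})$ is the group of automorphisms $c\mapsto ucu^*$ with $u$ a unitary in the unitization of $\mathcal{C}$. $\overline{\mathrm{Inn}}(\mathcal{C})$ is the normal subgroup of $\mathrm{Aut}(\mathcal{C})$ of approximately inner automorphisms: those $\theta$ such that for every finite $F\subset\mathcal{C}$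 and $\varepsilon>0$ there is $\psi\in\mathrm{Inn}(\mathcal{C})$ with $\|\theta(x)-\psi(x)\|<\varepsilon$ for all $x\in F$. It is a known fact that every approximately inner automorphism induces the identity on $K_0(\mathcal{C})$. The $K$-outer automorphism group is $\mathrm{Kout}(\mathcal{C})=\mathrm{Aut}(\mathcal{C})/\overline{\mathrm{Inn}}(\mathcal{C})$. **The graph $\Gamma(A)$.** Let $A$ be a countable abelian group. Vertices of $\Gamma(A)$: - $v_a$ and $u_a$ for each $a\in A$; - for each ordered pair $(a,b)\in A\times A$: two distinct vertices $w^{(1)}_{ab},w^{(2)}_{ab}$ (also when $a=b$), a vertex $u_{ab}$, and vertices $u^n_{ab}$ for $n\ge1$. All these vertices are distinct. Edges of $\Gamma(A)$ (written source $\to$ range): - for each $c\in A$: one edge $v_c\to u_c$ and two loops at $u_c$; - for each $(a,b)\in A\times A$, with $c=a+b$: one edge each $v_a\to w^{(1)}_{ab}$, $v_b\to w^{(2)}_{ab}$, $w^{(1)}_{ab}\to u_{ab}$, $w^{(2)}_{ab}\to u_{ab}$, $u_c\to u_{ab}$; - for each $(a,b)$: one edge $u_{ab}\to u^1_{ab}$, one edge $u^{n-1}_{ab}\to u^n_{ab}$ for each $n\ge2$, and one loop at $u^n_{ab}$ for each $n\geq1$. $\Gamma(A)$ is row-finite, and $[p_{v_a}]\mapsto a$ defines a group isomorphism $K_0(C^*(\Gamma(A)))\cong A$. *)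

theory Defs
  imports
    Complex_Main
    "HOL-Library.Countable_Set"
    "HOL-Algebra.Module"
    "HOL-Algebra.Bij"
    "HOL-Algebra.Coset"
    "Graph_Theory.Digraph"
begin

section \<open>C*-algebras\<close>

definition complex_ring :: "complex ring" where
  "complex_ring = \<lparr>carrier = UNIV, mult = (*), one = 1, zero = 0, add = (+)\<rparr>"

text \<open>C*-algebras are not assumed unital: the field \<open>one\<close>, inherited from the record of rings, is
  subject to no condition and plays no role anywhere below.\<close>

record 'c cstar = "(complex, 'c) module" +
  adj :: "'c \<Rightarrow> 'c"
  cnorm :: "'c \<Rightarrow> real"

locale cstar_algebra = Module.module complex_ring C for C :: "'c cstar" (structure) +
  assumes mult_closed: "\<lbrakk>x \<in> carrier C; y \<in> carrier C\<rbrakk> \<Longrightarrow> x \<otimes> y \<in> carrier C"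
    and mult_assoc: "\<lbrakk>x \<in> carrier C; y \<in> carrier C; z \<in> carrier C\<rbrakk>
          \<Longrightarrow> (x \<otimes> y) \<otimes> z = x \<otimes> (y \<otimes> z)"
    and mult_distl: "\<lbrakk>x \<in> carrier C; y \<in> carrier C; z \<in> carrier C\<rbrakk>
          \<Longrightarrow> (x \<oplus> y) \<otimes> z = x \<otimes> z \<oplus> y \<otimes> z"
    and mult_distr: "\<lbrakk>x \<in> carrier C; y \<in> carrier C; z \<in> carrier C\<rbrakk>
          \<Longrightarrow> z \<otimes> (x \<oplus> y) = z \<otimes> x \<oplus> z \<otimes> y"
    and smult_mult: "\<lbrakk>x \<in> carrier C; y \<in> carrier C\<rbrakk> \<Longrightarrow> (a \<odot> x) \<otimes> y = a \<odot> (x \<otimes> y)"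
    and mult_smult: "\<lbrakk>x \<in> carrier C; y \<in> carrier C\<rbrakk> \<Longrightarrow> x \<otimes> (a \<odot> y) = a \<odot> (x \<otimes> y)"
    and adj_closed: "x \<in> carrier C \<Longrightarrow> adj C x \<in> carrier C"
    and adj_adj: "x \<in> carrier C \<Longrightarrow> adj C (adj C x) = x"
    and adj_add: "\<lbrakk>x \<in> carrier C; y \<in> carrier C\<rbrakk> \<Longrightarrow> adj C (x \<oplus> y) = adj C x \<oplus> adj C y"
    and adj_smult: "x \<in> carrier C \<Longrightarrow> adj C (a \<odot> x) = cnj a \<odot> adj C x"
    and adj_mult: "\<lbrakk>x \<in> carrier C; y \<in> carrier C\<rbrakk> \<Longrightarrow> adj C (x \<otimes> y) = adj C y \<otimes> adj C x"
    and cnorm_eq_0_iff: "x \<in> carrier C \<Longrightarrow> cnorm C x = 0 \<longleftrightarrow> x = \<zero>"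
    and cnorm_triangle: "\<lbrakk>x \<in> carrier C; y \<in> carrier C\<rbrakk> \<Longrightarrow> cnorm C (x \<oplus> y) \<le> cnorm C x + cnorm C y"
    and cnorm_smult: "x \<in> carrier C \<Longrightarrow> cnorm C (a \<odot> x) = cmod a * cnorm C x"
    and cnorm_mult: "\<lbrakk>x \<in> carrier C; y \<in> carrier C\<rbrakk> \<Longrightarrow> cnorm C (x \<otimes> y) \<le> cnorm C x * cnorm C y"
    and cnorm_cstar: "x \<in> carrier C \<Longrightarrow> cnorm C (adj C x \<otimes> x) = (cnorm C x)\<^sup>2"
    and complete: "\<lbrakk>\<And>n. f n \<in> carrier C;
            \<And>\<epsilon>. \<epsilon> > 0 \<Longrightarrow> \<exists>N. \<forall>m\<ge>N. \<forall>n\<ge>N. cnorm C (f m \<ominus> f n) < \<epsilon>\<rbrakk>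
          \<Longrightarrow> \<exists>x\<in>carrier C. (\<lambda>n. cnorm C (f n \<ominus> x)) \<longlonglongrightarrow> 0"

definition star_hom :: "'c cstar \<Rightarrow> 'd cstar \<Rightarrow> ('c \<Rightarrow> 'd) set" where
  "star_hom C D = {f. (\<forall>x\<in>carrier C. f x \<in> carrier D)
     \<and> (\<forall>x\<in>carrier C. \<forall>y\<in>carrier C. f (x \<oplus>\<^bsub>C\<^esub> y) = f x \<oplus>\<^bsub>D\<^esub> f y)
     \<and> (\<forall>x\<in>carrier C. \<forall>y\<in>carrier C. f (x \<otimes>\<^bsub>C\<^esub> y) = f x \<otimes>\<^bsub>D\<^esub> f y)
     \<and> (\<forall>a. \<forall>x\<in>carrier C. f (a \<odot>\<^bsub>C\<^esub> x) = a \<odot>\<^bsub>D\<^esub> f x)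
     \<and> (\<forall>x\<in>carrier C. f (adj C x) = adj D (f x))}"

definition closed_star_subalgebra :: "'c set \<Rightarrow> 'c cstar \<Rightarrow> bool" where
  "closed_star_subalgebra B C \<longleftrightarrow> B \<subseteq> carrier C \<and> \<zero>\<^bsub>C\<^esub> \<in> B
     \<and> (\<forall>x\<in>B. \<forall>y\<in>B. x \<oplus>\<^bsub>C\<^esub> y \<in> B \<and> x \<otimes>\<^bsub>C\<^esub> y \<in> B)
     \<and> (\<forall>x\<in>B. adj C x \<in> B \<and> (\<forall>a. a \<odot>\<^bsub>C\<^esub> x \<in> B))
     \<and> (\<forall>f. \<forall>x\<in>carrier C.
          (\<forall>n. f n \<in> B) \<and> (\<lambda>n. cnorm C (f n \<ominus>\<^bsub>C\<^esub> x)) \<longlonglongrightarrow> (0::real) \<longrightarrow> x \<in> B)"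

definition cstar_generated :: "'c cstar \<Rightarrow> 'c set \<Rightarrow> 'c set" where
  "cstar_generated C X = \<Inter>{B. closed_star_subalgebra B C \<and> X \<subseteq> B}"

text \<open>The product of a family of C*-algebras, consisting of the families bounded in norm.\<close>

definition cstar_prod :: "'i set \<Rightarrow> ('i \<Rightarrow> 'c cstar) \<Rightarrow> ('i \<Rightarrow> 'c) cstar" where
  "cstar_prod I D = \<lparr>
     carrier = {f \<in> (\<Pi>\<^sub>E i\<in>I. carrier (D i)). bdd_above ((\<lambda>i. cnorm (D i) (f i)) ` I)},
     mult = (\<lambda>f g. \<lambda>i\<in>I. f i \<otimes>\<^bsub>D i\<^esub> g i),
     one = undefined,
     zero = (\<lambda>i\<in>I. \<zero>\<^bsub>D i\<^esub>),
     add = (\<lambda>f g. \<lambda>i\<in>I. f i \<oplus>\<^bsub>D i\<^esub> g i),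
     smult = (\<lambda>a f. \<lambda>i\<in>I. a \<odot>\<^bsub>D i\<^esub> f i),
     adj = (\<lambda>f. \<lambda>i\<in>I. adj (D i) (f i)),
     cnorm = (\<lambda>f. SUP i\<in>I. cnorm (D i) (f i))\<rparr>"


section \<open>The K-outer automorphism group\<close>

definition star_auto :: "'c cstar \<Rightarrow> ('c \<Rightarrow> 'c) set" where
  "star_auto C = star_hom C C \<inter> Bij (carrier C)"

definition StarAutoGroup :: "'c cstar \<Rightarrow> ('c \<Rightarrow> 'c) monoid" where
  "StarAutoGroup C = BijGroup (carrier C) \<lparr>carrier := star_auto C\<rparr>"

text \<open>The unitization \<open>C \<oplus> \<complex>\<close>, as a monoid with involution. A unit is adjoined even if \<open>C\<close>
  already has one, which does not change the inner automorphisms of \<open>C\<close>: conjugation by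
  \<open>(x, l)\<close> is then conjugation by \<open>x + l1\<close>.\<close>

definition unitization :: "'c cstar \<Rightarrow> ('c \<times> complex) monoid" where
  "unitization C = \<lparr>
     carrier = carrier C \<times> UNIV,
     mult = (\<lambda>(x, l) (y, m). (x \<otimes>\<^bsub>C\<^esub> y \<oplus>\<^bsub>C\<^esub> l \<odot>\<^bsub>C\<^esub> y \<oplus>\<^bsub>C\<^esub> m \<odot>\<^bsub>C\<^esub> x, l * m)),
     one = (\<zero>\<^bsub>C\<^esub>, 1)\<rparr>"

definition uadj :: "'c cstar \<Rightarrow> 'c \<times> complex \<Rightarrow> 'c \<times> complex" where
  "uadj C = (\<lambda>(x, l). (adj C x, cnj l))"

definition unitaries :: "'c cstar \<Rightarrow> ('c \<times> complex) set" where
  "unitaries C = {u \<in> carrier (unitization C).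
     uadj C u \<otimes>\<^bsub>unitization C\<^esub> u = \<one>\<^bsub>unitization C\<^esub> \<and>
     u \<otimes>\<^bsub>unitization C\<^esub> uadj C u = \<one>\<^bsub>unitization C\<^esub>}"

definition inner_auto :: "'c cstar \<Rightarrow> 'c \<times> complex \<Rightarrow> 'c \<Rightarrow> 'c" where
  "inner_auto C u = (\<lambda>c\<in>carrier C.
     fst (u \<otimes>\<^bsub>unitization C\<^esub> (c, 0) \<otimes>\<^bsub>unitization C\<^esub> uadj C u))"

definition Inn :: "'c cstar \<Rightarrow> ('c \<Rightarrow> 'c) set" where
  "Inn C = inner_auto C ` unitaries C"

definition approx_Inn :: "'c cstar \<Rightarrow> ('c \<Rightarrow> 'c) set" where
  "approx_Inn C = {\<theta> \<in> star_auto C. \<forall>F \<epsilon>. finite F \<and> F \<subseteq> carrier C \<and> \<epsilon> > 0 \<longrightarrow>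
     (\<exists>\<psi>\<in>Inn C. \<forall>x\<in>F. cnorm C (\<theta> x \<ominus>\<^bsub>C\<^esub> \<psi> x) < \<epsilon>)}"

definition Kout :: "'c cstar \<Rightarrow> ('c \<Rightarrow> 'c) set monoid" where
  "Kout C = StarAutoGroup C Mod approx_Inn C"


section \<open>Graph C*-algebras\<close>

text \<open>The source of an edge is its \<open>tail\<close>, the range is its \<open>head\<close>.\<close>

definition row_finite :: "('v, 'e) pre_digraph \<Rightarrow> bool" where
  "row_finite G \<longleftrightarrow> (\<forall>v\<in>verts G. finite {e \<in> arcs G. head G e = v})"

definition ck_family ::
    "('v, 'e) pre_digraph \<Rightarrow> 'c cstar \<Rightarrow> ('v \<Rightarrow> 'c) \<Rightarrow> ('e \<Rightarrow> 'c) \<Rightarrow> bool" where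
  "ck_family G C p S \<longleftrightarrow>
     (\<forall>v\<in>verts G. p v \<in> carrier C \<and> p v \<otimes>\<^bsub>C\<^esub> p v = p v \<and> adj C (p v) = p v) \<and>
     (\<forall>v\<in>verts G. \<forall>w\<in>verts G. v \<noteq> w \<longrightarrow> p v \<otimes>\<^bsub>C\<^esub> p w = \<zero>\<^bsub>C\<^esub>) \<and>
     (\<forall>e\<in>arcs G. S e \<in> carrier C \<and> S e \<otimes>\<^bsub>C\<^esub> adj C (S e) \<otimes>\<^bsub>C\<^esub> S e = S e) \<and>
     (\<forall>e\<in>arcs G. adj C (S e) \<otimes>\<^bsub>C\<^esub> S e = p (tail G e)) \<and>
     (\<forall>v\<in>verts G. {e \<in> arcs G. head G e = v} \<noteq> {} \<longrightarrow>
        (\<Oplus>\<^bsub>C\<^esub>e\<in>{e \<in> arcs G. head G e = v}. S e \<otimes>\<^bsub>C\<^esub> adj C (S e)) = p v)"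

text \<open>The universal C*-algebra of a row-finite graph \<open>G\<close> is constructed in the usual way, as the
  C*-algebra generated by the tuple of all Cuntz--Krieger \<open>G\<close>-families, inside the product of all
  the C*-algebras in which these families live. As \<open>G\<close> is countable, a family generates a separable
  C*-algebra, so that it suffices to take C*-algebras whose elements are labelled by the type
  \<open>nat \<Rightarrow> nat\<close> of the cardinality of the continuum. The theorems \<open>ck_family_graph_cstar\<close>,
  \<open>graph_cstar_generated\<close> and \<open>graph_cstar_universal\<close> below show that the result is generated by a
  Cuntz--Krieger family that is universal among the families in C*-algebras over arbitrary types.\<close>

type_synonym label = "nat \<Rightarrow> nat"
type_synonym ('v, 'e) ck_index = "label cstar \<times> ('v \<Rightarrow> label) \<times> ('e \<Rightarrow> label)"

definition ck_indices :: "('v, 'e) pre_digraph \<Rightarrow> ('v, 'e) ck_index set" where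
  "ck_indices G = {(D, q, T). cstar_algebra D \<and> ck_family G D q T}"

definition graph_proj :: "('v, 'e) pre_digraph \<Rightarrow> 'v \<Rightarrow> ('v, 'e) ck_index \<Rightarrow> label" where
  "graph_proj G v = (\<lambda>(D, q, T)\<in>ck_indices G. q v)"

definition graph_isom :: "('v, 'e) pre_digraph \<Rightarrow> 'e \<Rightarrow> ('v, 'e) ck_index \<Rightarrow> label" where
  "graph_isom G e = (\<lambda>(D, q, T)\<in>ck_indices G. T e)"

definition graph_cstar :: "('v, 'e) pre_digraph \<Rightarrow> (('v, 'e) ck_index \<Rightarrow> label) cstar" where
  "graph_cstar G = (let P = cstar_prod (ck_indices G) fst in
     P \<lparr>carrier := cstar_generated P (graph_proj G ` verts G \<union> graph_isom G ` arcs G)\<rparr>)"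


section \<open>The graph of an abelian group\<close>

text \<open>\<open>Vtx_uu a b\<close> and \<open>Vtx_un a b n\<close> are the vertices \<open>u\<^sub>a\<^sub>b\<close> and \<open>u\<^sup>n\<^sub>a\<^sub>b\<close>, the latter for
  \<open>n \<ge> 1\<close> only. The group is written multiplicatively, so that \<open>c = a + b\<close> reads \<open>a \<otimes> b\<close>.\<close>

datatype 'a gvert =
  Vtx_v 'a | Vtx_u 'a | Vtx_w1 'a 'a | Vtx_w2 'a 'a | Vtx_uu 'a 'a | Vtx_un 'a 'a nat

datatype 'a gedge =
    VtoU 'a
  | LoopU bool 'a
  | VtoW1 'a 'a
  | VtoW2 'a 'a
  | W1toUU 'a 'a
  | W2toUU 'a 'a
  | UtoUU 'a 'a
  | UUtoUN 'a 'a
  | UNtoUN 'a 'a nat  \<comment> \<open>indexed by the superscript \<open>n \<ge> 2\<close> of the range\<close>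
  | LoopUN 'a 'a nat

fun gsource :: "('a, 'm) monoid_scheme \<Rightarrow> 'a gedge \<Rightarrow> 'a gvert" where
  "gsource A (VtoU c) = Vtx_v c"
| "gsource A (LoopU i c) = Vtx_u c"
| "gsource A (VtoW1 a b) = Vtx_v a"
| "gsource A (VtoW2 a b) = Vtx_v b"
| "gsource A (W1toUU a b) = Vtx_w1 a b"
| "gsource A (W2toUU a b) = Vtx_w2 a b"
| "gsource A (UtoUU a b) = Vtx_u (a \<otimes>\<^bsub>A\<^esub> b)"
| "gsource A (UUtoUN a b) = Vtx_uu a b"
| "gsource A (UNtoUN a b n) = Vtx_un a b (n - 1)"
| "gsource A (LoopUN a b n) = Vtx_un a b n"

fun grange :: "'a gedge \<Rightarrow> 'a gvert" where
  "grange (VtoU c) = Vtx_u c"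
| "grange (LoopU i c) = Vtx_u c"
| "grange (VtoW1 a b) = Vtx_w1 a b"
| "grange (VtoW2 a b) = Vtx_w2 a b"
| "grange (W1toUU a b) = Vtx_uu a b"
| "grange (W2toUU a b) = Vtx_uu a b"
| "grange (UtoUU a b) = Vtx_uu a b"
| "grange (UUtoUN a b) = Vtx_un a b 1"
| "grange (UNtoUN a b n) = Vtx_un a b n"
| "grange (LoopUN a b n) = Vtx_un a b n"

definition Gamma :: "('a, 'm) monoid_scheme \<Rightarrow> ('a gvert, 'a gedge) pre_digraph" where
  "Gamma A = \<lparr>
     verts = {Vtx_v a | a. a \<in> carrier A} \<union> {Vtx_u a | a. a \<in> carrier A}
       \<union> (\<Union>a\<in>carrier A. \<Union>b\<in>carrier A. {Vtx_w1 a b, Vtx_w2 a b, Vtx_uu a b} \<union> {Vtx_un a b n | n. n \<ge> 1}),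
     arcs = (\<Union>c\<in>carrier A. {VtoU c, LoopU False c, LoopU True c})
       \<union> (\<Union>a\<in>carrier A. \<Union>b\<in>carrier A.
            {VtoW1 a b, VtoW2 a b, W1toUU a b, W2toUU a b, UtoUU a b, UUtoUN a b}
            \<union> {UNtoUN a b n | n. n \<ge> 2} \<union> {LoopUN a b n | n. n \<ge> 1}),
     tail = gsource A,
     head = grange\<rparr>"


section \<open>Basic facts on C*-algebras\<close>

lemma complex_ring_simps [simp]:
  "carrier complex_ring = UNIV" "a \<otimes>\<^bsub>complex_ring\<^esub> b = a * b" "\<one>\<^bsub>complex_ring\<^esub> = 1"
  "\<zero>\<^bsub>complex_ring\<^esub> = 0" "a \<oplus>\<^bsub>complex_ring\<^esub> b = a + b"
  by (simp_all add: complex_ring_def)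

lemma cring_complex_ring: "cring complex_ring"
proof (rule cringI)
  show "abelian_group complex_ring"
  proof (rule abelian_groupI)
    show "\<exists>y\<in>carrier complex_ring. y \<oplus>\<^bsub>complex_ring\<^esub> x = \<zero>\<^bsub>complex_ring\<^esub>" for x
      by (rule bexI[of _ "- x"]) simp_all
  qed (simp_all add: algebra_simps)
  show "comm_monoid complex_ring"
    by (rule comm_monoidI) (simp_all add: algebra_simps)
qed (simp add: algebra_simps)

lemma cstar_algebraI:
  fixes C :: "'c cstar" (structure)
  assumes "\<zero> \<in> carrier C"
    and add: "\<And>x y. \<lbrakk>x \<in> carrier C; y \<in> carrier C\<rbrakk> \<Longrightarrow> x \<oplus> y \<in> carrier C"
    "\<And>x y z. \<lbrakk>x \<in> carrier C; y \<in> carrier C; z \<in> carrier C\<rbrakk> \<Longrightarrow> (x \<oplus> y) \<oplus> z = x \<oplus> (y \<oplus> z)"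
    "\<And>x y. \<lbrakk>x \<in> carrier C; y \<in> carrier C\<rbrakk> \<Longrightarrow> x \<oplus> y = y \<oplus> x"
    "\<And>x. x \<in> carrier C \<Longrightarrow> \<zero> \<oplus> x = x"
    and neg: "\<And>x. x \<in> carrier C \<Longrightarrow> (-1) \<odot> x \<oplus> x = \<zero>"
    and sm: "\<And>a x. x \<in> carrier C \<Longrightarrow> a \<odot> x \<in> carrier C"
    "\<And>a b x. x \<in> carrier C \<Longrightarrow> (a + b) \<odot> x = a \<odot> x \<oplus> b \<odot> x"
    "\<And>a x y. \<lbrakk>x \<in> carrier C; y \<in> carrier C\<rbrakk> \<Longrightarrow> a \<odot> (x \<oplus> y) = a \<odot> x \<oplus> a \<odot> y"
    "\<And>a b x. x \<in> carrier C \<Longrightarrow> (a * b) \<odot> x = a \<odot> (b \<odot> x)"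
    "\<And>x. x \<in> carrier C \<Longrightarrow> 1 \<odot> x = x"
    and ax: "\<And>x y. \<lbrakk>x \<in> carrier C; y \<in> carrier C\<rbrakk> \<Longrightarrow> x \<otimes> y \<in> carrier C"
    "\<And>x y z. \<lbrakk>x \<in> carrier C; y \<in> carrier C; z \<in> carrier C\<rbrakk> \<Longrightarrow> (x \<otimes> y) \<otimes> z = x \<otimes> (y \<otimes> z)"
    "\<And>x y z. \<lbrakk>x \<in> carrier C; y \<in> carrier C; z \<in> carrier C\<rbrakk> \<Longrightarrow> (x \<oplus> y) \<otimes> z = x \<otimes> z \<oplus> y \<otimes> z"
    "\<And>x y z. \<lbrakk>x \<in> carrier C; y \<in> carrier C; z \<in> carrier C\<rbrakk> \<Longrightarrow> z \<otimes> (x \<oplus> y) = z \<otimes> x \<oplus> z \<otimes> y"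
    "\<And>a x y. \<lbrakk>x \<in> carrier C; y \<in> carrier C\<rbrakk> \<Longrightarrow> (a \<odot> x) \<otimes> y = a \<odot> (x \<otimes> y)"
    "\<And>a x y. \<lbrakk>x \<in> carrier C; y \<in> carrier C\<rbrakk> \<Longrightarrow> x \<otimes> (a \<odot> y) = a \<odot> (x \<otimes> y)"
    "\<And>x. x \<in> carrier C \<Longrightarrow> adj C x \<in> carrier C"
    "\<And>x. x \<in> carrier C \<Longrightarrow> adj C (adj C x) = x"
    "\<And>x y. \<lbrakk>x \<in> carrier C; y \<in> carrier C\<rbrakk> \<Longrightarrow> adj C (x \<oplus> y) = adj C x \<oplus> adj C y"
    "\<And>a x. x \<in> carrier C \<Longrightarrow> adj C (a \<odot> x) = cnj a \<odot> adj C x"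
    "\<And>x y. \<lbrakk>x \<in> carrier C; y \<in> carrier C\<rbrakk> \<Longrightarrow> adj C (x \<otimes> y) = adj C y \<otimes> adj C x"
    "\<And>x. x \<in> carrier C \<Longrightarrow> cnorm C x = 0 \<longleftrightarrow> x = \<zero>"
    "\<And>x y. \<lbrakk>x \<in> carrier C; y \<in> carrier C\<rbrakk> \<Longrightarrow> cnorm C (x \<oplus> y) \<le> cnorm C x + cnorm C y"
    "\<And>a x. x \<in> carrier C \<Longrightarrow> cnorm C (a \<odot> x) = cmod a * cnorm C x"
    "\<And>x y. \<lbrakk>x \<in> carrier C; y \<in> carrier C\<rbrakk> \<Longrightarrow> cnorm C (x \<otimes> y) \<le> cnorm C x * cnorm C y"
    "\<And>x. x \<in> carrier C \<Longrightarrow> cnorm C (adj C x \<otimes> x) = (cnorm C x)\<^sup>2"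
    and complete: "\<And>f. \<lbrakk>\<And>n. f n \<in> carrier C;
            \<And>\<epsilon>. \<epsilon> > 0 \<Longrightarrow> \<exists>N. \<forall>m\<ge>N. \<forall>n\<ge>N. cnorm C (f m \<oplus> (-1) \<odot> f n) < \<epsilon>\<rbrakk>
          \<Longrightarrow> \<exists>x\<in>carrier C. (\<lambda>n. cnorm C (f n \<oplus> (-1) \<odot> x)) \<longlonglongrightarrow> 0"
  shows "cstar_algebra C"
proof -
  have ag: "abelian_group C"
  proof (rule abelian_groupI)
    show "\<exists>y\<in>carrier C. y \<oplus> x = \<zero>" if "x \<in> carrier C" for x
      using that sm(1) neg by blast
  qed (use assms in simp_all)
  interpret Module.module complex_ring C
    by (rule moduleI) (auto simp: ag cring_complex_ring sm)
  have minus: "x \<ominus> y = x \<oplus> (-1) \<odot> y" if "x \<in> carrier C" "y \<in> carrier C" for x y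
    using that neg[of y] sm(1)[of y "-1"] by (metis M.minus_equality a_minus_def)
  show ?thesis
  proof (intro cstar_algebra.intro cstar_algebra_axioms.intro)
    show "Module.module complex_ring C" ..
    fix f :: "nat \<Rightarrow> 'c"
    assume f: "\<And>n. f n \<in> carrier C"
      and "\<And>\<epsilon>. \<epsilon> > 0 \<Longrightarrow> \<exists>N. \<forall>m\<ge>N. \<forall>n\<ge>N. cnorm C (f m \<ominus> f n) < \<epsilon>"
    then show "\<exists>x\<in>carrier C. (\<lambda>n. cnorm C (f n \<ominus> x)) \<longlonglongrightarrow> 0"
      using complete[of f] by (simp add: minus cong: bex_cong)
  qed (rule ax; assumption)+
qed


context cstar_algebra
begin

lemma a_smult_closed: "x \<in> carrier C \<Longrightarrow> a \<odot> x \<in> carrier C"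
  using smult_closed by simp

lemma smult_0: "x \<in> carrier C \<Longrightarrow> 0 \<odot> x = \<zero>"
  using smult_l_null by simp

lemma smult_add_l: "x \<in> carrier C \<Longrightarrow> (a + b) \<odot> x = a \<odot> x \<oplus> b \<odot> x"
  using smult_l_distr by simp

lemma smult_add_r: "\<lbrakk>x \<in> carrier C; y \<in> carrier C\<rbrakk> \<Longrightarrow> a \<odot> (x \<oplus> y) = a \<odot> x \<oplus> a \<odot> y"
  using smult_r_distr by simp

lemma smult_1: "x \<in> carrier C \<Longrightarrow> 1 \<odot> x = x"
  using smult_one by simp

lemma smult_smult: "x \<in> carrier C \<Longrightarrow> (a * b) \<odot> x = a \<odot> (b \<odot> x)"
  using smult_assoc1 by simp

lemma neg_smult: "x \<in> carrier C \<Longrightarrow> (-1) \<odot> x \<oplus> x = \<zero>"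
  using smult_add_l[of x "-1" 1] by (simp add: smult_1 smult_0)

lemma minus_smult: "\<lbrakk>x \<in> carrier C; y \<in> carrier C\<rbrakk> \<Longrightarrow> x \<ominus> y = x \<oplus> (-1) \<odot> y"
  using neg_smult[of y] a_smult_closed[of y "-1"] by (metis M.minus_equality a_minus_def)

lemma cnorm_0: "cnorm C \<zero> = 0"
  by (simp add: cnorm_eq_0_iff)

lemma cnorm_nonneg: "x \<in> carrier C \<Longrightarrow> 0 \<le> cnorm C x"
  using cnorm_triangle[of x "(-1) \<odot> x"] neg_smult[of x] cnorm_smult[of x "-1"]
  by (simp add: a_smult_closed a_comm cnorm_0)

lemma minus_closed': "\<lbrakk>x \<in> carrier C; y \<in> carrier C\<rbrakk> \<Longrightarrow> x \<ominus> y \<in> carrier C"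
  by (simp add: minus_smult a_smult_closed)

lemma cnorm_minus_commute:
  assumes "x \<in> carrier C" "y \<in> carrier C" shows "cnorm C (x \<ominus> y) = cnorm C (y \<ominus> x)"
proof -
  have "y \<ominus> x = (-1) \<odot> (x \<ominus> y)"
    using assms smult_r_distr[of "-1" x "(-1) \<odot> y"] smult_smult[of y "-1" "-1"]
    by (simp add: minus_smult a_smult_closed smult_1 a_comm)
  then show ?thesis using assms by (simp add: cnorm_smult minus_closed')
qed

lemma minus_add_minus:
  assumes "x \<in> carrier C" "y \<in> carrier C" "z \<in> carrier C"
  shows "(x \<ominus> y) \<oplus> (y \<ominus> z) = x \<ominus> z"
proof -
  have "(x \<ominus> y) \<oplus> (y \<ominus> z) = x \<oplus> (((-1) \<odot> y \<oplus> y) \<oplus> (-1) \<odot> z)"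
    using assms by (simp add: minus_smult a_smult_closed a_assoc)
  then show ?thesis using assms by (simp add: neg_smult minus_smult a_smult_closed)
qed

lemma cnorm_dist_triangle:
  assumes "x \<in> carrier C" "y \<in> carrier C" "z \<in> carrier C"
  shows "cnorm C (x \<ominus> z) \<le> cnorm C (x \<ominus> y) + cnorm C (y \<ominus> z)"
  using cnorm_triangle[of "x \<ominus> y" "y \<ominus> z"] assms minus_add_minus[OF assms]
  by (simp add: minus_closed')

lemma minus_eq_0_iff:
  assumes "x \<in> carrier C" "y \<in> carrier C" shows "x \<ominus> y = \<zero> \<longleftrightarrow> x = y"
proof -
  have "w \<ominus> \<zero> = w" if "w \<in> carrier C" for w
    using that by (simp add: minus_smult a_smult_closed)
  then show ?thesis
    using minus_add_minus[of x y \<zero>] neg_smult[of y] assms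
    by (auto simp: minus_smult a_smult_closed a_comm)
qed

lemma cnorm_diff_bound:
  assumes "x \<in> carrier C" "y \<in> carrier C" shows "cnorm C x \<le> cnorm C (x \<ominus> y) + cnorm C y"
  using cnorm_dist_triangle[of x y \<zero>] assms by (simp add: minus_smult a_smult_closed smult_r_null)

lemma adj_0: "adj C \<zero> = \<zero>"
  using adj_smult[of \<zero> 0] by (simp add: smult_0 adj_closed)

lemma cnorm_adj: assumes x: "x \<in> carrier C" shows "cnorm C (adj C x) = cnorm C x"
proof -
  have le: "cnorm C y \<le> cnorm C (adj C y)" if y: "y \<in> carrier C" for y
  proof (cases "cnorm C y = 0")
    case False
    then have "cnorm C y * cnorm C y \<le> cnorm C (adj C y) * cnorm C y"
      using cnorm_cstar[OF y] cnorm_mult[of "adj C y" y] y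
      by (simp add: adj_closed power2_eq_square)
    with False cnorm_nonneg[OF y] show ?thesis by simp
  qed (use y in \<open>simp add: cnorm_nonneg adj_closed\<close>)
  show ?thesis using le[OF x] le[of "adj C x"] x by (simp add: adj_closed adj_adj)
qed

lemma cnorm_projection_le_1:
  assumes "p \<in> carrier C" "p \<otimes> p = p" "adj C p = p" shows "cnorm C p \<le> 1"
proof -
  have "cnorm C p * cnorm C p = cnorm C p"
    using cnorm_cstar[of p] assms by (simp add: power2_eq_square)
  then show ?thesis by (metis mult_cancel_right1 order_refl zero_le_one)
qed

lemma cnorm_isom_le_1:
  assumes "s \<in> carrier C" "cnorm C (adj C s \<otimes> s) \<le> 1" shows "cnorm C s \<le> 1"
  using assms cnorm_cstar[of s] by (simp add: cnorm_nonneg power_le_one_iff)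

text \<open>Continuity of the operations, for closures.\<close>

lemma minus_add_swap:
  assumes "x \<in> carrier C" "y \<in> carrier C" "x' \<in> carrier C" "y' \<in> carrier C"
  shows "(x \<oplus> y) \<ominus> (x' \<oplus> y') = (x \<ominus> x') \<oplus> (y \<ominus> y')"
  using assms smult_r_distr[of "-1" x' y']
  by (simp add: minus_smult a_smult_closed a_ac)

lemma minus_smult_distr:
  assumes "x \<in> carrier C" "y \<in> carrier C" shows "a \<odot> x \<ominus> a \<odot> y = a \<odot> (x \<ominus> y)"
  using assms smult_r_distr[of a x "(-1) \<odot> y"] smult_smult[of y a "-1"] smult_smult[of y "-1" a]
  by (simp add: minus_smult a_smult_closed)

lemma minus_mult_split:
  assumes "x \<in> carrier C" "y \<in> carrier C" "x' \<in> carrier C" "y' \<in> carrier C"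
  shows "x \<otimes> y \<ominus> x' \<otimes> y' = (x \<ominus> x') \<otimes> y \<oplus> x' \<otimes> (y \<ominus> y')"
proof -
  have "(x \<ominus> x') \<otimes> y = x \<otimes> y \<ominus> x' \<otimes> y" "x' \<otimes> (y \<ominus> y') = x' \<otimes> y \<ominus> x' \<otimes> y'"
    using assms by (simp_all add: minus_smult a_smult_closed mult_closed mult_distl mult_distr
        smult_mult mult_smult)
  then show ?thesis using minus_add_minus assms by (simp add: mult_closed)
qed

lemma adj_minus:
  assumes "x \<in> carrier C" "y \<in> carrier C" shows "adj C (x \<ominus> y) = adj C x \<ominus> adj C y"
  using assms by (simp add: minus_smult a_smult_closed adj_add adj_smult adj_closed)

end

lemma closed_star_subalgebraD:
  assumes "closed_star_subalgebra B C"
  shows "B \<subseteq> carrier C" "\<zero>\<^bsub>C\<^esub> \<in> B"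
    "\<lbrakk>x \<in> B; y \<in> B\<rbrakk> \<Longrightarrow> x \<oplus>\<^bsub>C\<^esub> y \<in> B" "\<lbrakk>x \<in> B; y \<in> B\<rbrakk> \<Longrightarrow> x \<otimes>\<^bsub>C\<^esub> y \<in> B"
    "x \<in> B \<Longrightarrow> a \<odot>\<^bsub>C\<^esub> x \<in> B" "x \<in> B \<Longrightarrow> adj C x \<in> B"
  using assms by (simp_all add: closed_star_subalgebra_def)

lemma closed_star_subalgebra_lim:
  assumes B: "closed_star_subalgebra B C" and x: "x \<in> carrier C" and f: "\<And>n. f n \<in> B"
    and lim: "(\<lambda>n. cnorm C (f n \<ominus>\<^bsub>C\<^esub> x)) \<longlonglongrightarrow> 0"
  shows "x \<in> B"
proof -
  have "\<forall>f. \<forall>x\<in>carrier C.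
      (\<forall>n. f n \<in> B) \<and> (\<lambda>n. cnorm C (f n \<ominus>\<^bsub>C\<^esub> x)) \<longlonglongrightarrow> (0::real) \<longrightarrow> x \<in> B"
    using B by (simp add: closed_star_subalgebra_def)
  from this[THEN spec[of _ f]] x f lim show ?thesis by simp
qed

lemma cstar_algebra_embed:
  fixes D :: "'d cstar" and E :: "'e cstar"
  assumes "cstar_algebra D"
    and inj: "inj_on \<phi> (carrier E)"
    and im: "closed_star_subalgebra (\<phi> ` carrier E) D"
    and cl: "\<zero>\<^bsub>E\<^esub> \<in> carrier E"
      "\<And>x y. \<lbrakk>x \<in> carrier E; y \<in> carrier E\<rbrakk> \<Longrightarrow> x \<oplus>\<^bsub>E\<^esub> y \<in> carrier E"
      "\<And>x y. \<lbrakk>x \<in> carrier E; y \<in> carrier E\<rbrakk> \<Longrightarrow> x \<otimes>\<^bsub>E\<^esub> y \<in> carrier E"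
      "\<And>a x. x \<in> carrier E \<Longrightarrow> a \<odot>\<^bsub>E\<^esub> x \<in> carrier E"
      "\<And>x. x \<in> carrier E \<Longrightarrow> adj E x \<in> carrier E"
    and ops: "\<phi> \<zero>\<^bsub>E\<^esub> = \<zero>\<^bsub>D\<^esub>"
      "\<And>x y. \<lbrakk>x \<in> carrier E; y \<in> carrier E\<rbrakk> \<Longrightarrow> \<phi> (x \<oplus>\<^bsub>E\<^esub> y) = \<phi> x \<oplus>\<^bsub>D\<^esub> \<phi> y"
      "\<And>x y. \<lbrakk>x \<in> carrier E; y \<in> carrier E\<rbrakk> \<Longrightarrow> \<phi> (x \<otimes>\<^bsub>E\<^esub> y) = \<phi> x \<otimes>\<^bsub>D\<^esub> \<phi> y"
      "\<And>a x. x \<in> carrier E \<Longrightarrow> \<phi> (a \<odot>\<^bsub>E\<^esub> x) = a \<odot>\<^bsub>D\<^esub> \<phi> x"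
      "\<And>x. x \<in> carrier E \<Longrightarrow> \<phi> (adj E x) = adj D (\<phi> x)"
      "\<And>x. x \<in> carrier E \<Longrightarrow> cnorm D (\<phi> x) = cnorm E x"
  shows "cstar_algebra E"
proof -
  interpret D: cstar_algebra D by fact
  have P: "\<phi> x \<in> carrier D" if "x \<in> carrier E" for x
    using closed_star_subalgebraD(1)[OF im] that by auto
  have I: "x = y \<longleftrightarrow> \<phi> x = \<phi> y" if "x \<in> carrier E" "y \<in> carrier E" for x y
    using inj that by (auto dest: inj_onD)
  note D_simps = D.mult_closed D.a_smult_closed D.adj_closed
  show ?thesis
  proof (rule cstar_algebraI)
    fix f :: "nat \<Rightarrow> 'e"
    assume f: "\<And>n. f n \<in> carrier E"
      and cau: "\<And>\<epsilon>. \<epsilon> > 0 \<Longrightarrow> \<exists>N. \<forall>m\<ge>N. \<forall>n\<ge>N. cnorm E (f m \<oplus>\<^bsub>E\<^esub> (-1) \<odot>\<^bsub>E\<^esub> f n) < \<epsilon>"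
    have eq: "cnorm D (\<phi> x \<ominus>\<^bsub>D\<^esub> \<phi> y) = cnorm E (x \<oplus>\<^bsub>E\<^esub> (-1) \<odot>\<^bsub>E\<^esub> y)"
      if "x \<in> carrier E" "y \<in> carrier E" for x y
      using that by (simp add: D.minus_smult P cl ops flip: ops(6))
    obtain z where z: "z \<in> carrier D" "(\<lambda>n. cnorm D (\<phi> (f n) \<ominus>\<^bsub>D\<^esub> z)) \<longlonglongrightarrow> 0"
      using D.complete[of "\<lambda>n. \<phi> (f n)"] f cau by (auto simp: P eq)
    then have "z \<in> \<phi> ` carrier E"
      using closed_star_subalgebra_lim[OF im z(1) _ z(2)] f by simp
    then show "\<exists>x\<in>carrier E. (\<lambda>n. cnorm E (f n \<oplus>\<^bsub>E\<^esub> (-1) \<odot>\<^bsub>E\<^esub> x)) \<longlonglongrightarrow> 0"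
      using z f by (auto simp: eq)
  next
    fix x y z a b
    assume [simp]: "x \<in> carrier E" "y \<in> carrier E" "z \<in> carrier E"
    note S = I cl P ops D_simps
    show "(x \<oplus>\<^bsub>E\<^esub> y) \<oplus>\<^bsub>E\<^esub> z = x \<oplus>\<^bsub>E\<^esub> (y \<oplus>\<^bsub>E\<^esub> z)" by (simp add: S D.a_assoc)
    show "(x \<otimes>\<^bsub>E\<^esub> y) \<otimes>\<^bsub>E\<^esub> z = x \<otimes>\<^bsub>E\<^esub> (y \<otimes>\<^bsub>E\<^esub> z)" by (simp add: S D.mult_assoc)
    show "(x \<oplus>\<^bsub>E\<^esub> y) \<otimes>\<^bsub>E\<^esub> z = x \<otimes>\<^bsub>E\<^esub> z \<oplus>\<^bsub>E\<^esub> y \<otimes>\<^bsub>E\<^esub> z" by (simp add: S D.mult_distl)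
    show "z \<otimes>\<^bsub>E\<^esub> (x \<oplus>\<^bsub>E\<^esub> y) = z \<otimes>\<^bsub>E\<^esub> x \<oplus>\<^bsub>E\<^esub> z \<otimes>\<^bsub>E\<^esub> y" by (simp add: S D.mult_distr)
  next
    fix x y a
    assume [simp]: "x \<in> carrier E" "y \<in> carrier E"
    note S = I cl P ops D_simps
    show "x \<oplus>\<^bsub>E\<^esub> y = y \<oplus>\<^bsub>E\<^esub> x" by (simp add: S D.a_comm)
    show "a \<odot>\<^bsub>E\<^esub> (x \<oplus>\<^bsub>E\<^esub> y) = a \<odot>\<^bsub>E\<^esub> x \<oplus>\<^bsub>E\<^esub> a \<odot>\<^bsub>E\<^esub> y"
      using D.smult_r_distr[of a "\<phi> x" "\<phi> y"] by (simp add: S)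
    show "(a \<odot>\<^bsub>E\<^esub> x) \<otimes>\<^bsub>E\<^esub> y = a \<odot>\<^bsub>E\<^esub> (x \<otimes>\<^bsub>E\<^esub> y)" by (simp add: S D.smult_mult)
    show "x \<otimes>\<^bsub>E\<^esub> (a \<odot>\<^bsub>E\<^esub> y) = a \<odot>\<^bsub>E\<^esub> (x \<otimes>\<^bsub>E\<^esub> y)" by (simp add: S D.mult_smult)
    show "adj E (x \<oplus>\<^bsub>E\<^esub> y) = adj E x \<oplus>\<^bsub>E\<^esub> adj E y" by (simp add: S D.adj_add)
    show "adj E (x \<otimes>\<^bsub>E\<^esub> y) = adj E y \<otimes>\<^bsub>E\<^esub> adj E x" by (simp add: S D.adj_mult)
    show "cnorm E (x \<oplus>\<^bsub>E\<^esub> y) \<le> cnorm E x + cnorm E y"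
      using D.cnorm_triangle[of "\<phi> x" "\<phi> y"] by (simp add: cl P ops flip: ops(6))
    show "cnorm E (x \<otimes>\<^bsub>E\<^esub> y) \<le> cnorm E x * cnorm E y"
      using D.cnorm_mult[of "\<phi> x" "\<phi> y"] by (simp add: cl P ops flip: ops(6))
  next
    fix x a b
    assume [simp]: "x \<in> carrier E"
    note S = I cl P ops D_simps
    show "\<zero>\<^bsub>E\<^esub> \<oplus>\<^bsub>E\<^esub> x = x" by (simp add: S)
    show "(-1) \<odot>\<^bsub>E\<^esub> x \<oplus>\<^bsub>E\<^esub> x = \<zero>\<^bsub>E\<^esub>" by (simp add: S D.neg_smult)
    show "(a + b) \<odot>\<^bsub>E\<^esub> x = a \<odot>\<^bsub>E\<^esub> x \<oplus>\<^bsub>E\<^esub> b \<odot>\<^bsub>E\<^esub> x" by (simp add: S D.smult_add_l)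
    show "(a * b) \<odot>\<^bsub>E\<^esub> x = a \<odot>\<^bsub>E\<^esub> (b \<odot>\<^bsub>E\<^esub> x)" by (simp add: S D.smult_smult)
    show "1 \<odot>\<^bsub>E\<^esub> x = x" by (simp add: S D.smult_1)
    show "adj E (adj E x) = x" by (simp add: S D.adj_adj)
    show "adj E (a \<odot>\<^bsub>E\<^esub> x) = cnj a \<odot>\<^bsub>E\<^esub> adj E x" by (simp add: S D.adj_smult)
    show "cnorm E x = 0 \<longleftrightarrow> x = \<zero>\<^bsub>E\<^esub>"
      using D.cnorm_eq_0_iff[of "\<phi> x"] I[of x "\<zero>\<^bsub>E\<^esub>"] by (simp add: cl P ops)
    show "cnorm E (a \<odot>\<^bsub>E\<^esub> x) = cmod a * cnorm E x"
      using D.cnorm_smult[of "\<phi> x" a] by (simp add: cl P ops flip: ops(6))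
    show "cnorm E (adj E x \<otimes>\<^bsub>E\<^esub> x) = (cnorm E x)\<^sup>2"
      using D.cnorm_cstar[of "\<phi> x"] by (simp add: cl P ops flip: ops(6))
  qed (rule cl; assumption)+
qed

lemma cstar_algebra_subalgebra:
  assumes "cstar_algebra D" "closed_star_subalgebra B D"
  shows "cstar_algebra (D\<lparr>carrier := B\<rparr>)"
  by (rule cstar_algebra_embed[of D id])
    (simp_all add: assms closed_star_subalgebraD[OF assms(2)])

lemma (in cstar_algebra) closed_star_subalgebra_carrier: "closed_star_subalgebra (carrier C) C"
  by (simp add: closed_star_subalgebra_def mult_closed adj_closed a_smult_closed)

lemma (in cstar_algebra) cstar_generated_closed:
  assumes "X \<subseteq> carrier C"
  shows "closed_star_subalgebra (cstar_generated C X) C"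
proof -
  let ?S = "{B. closed_star_subalgebra B C \<and> X \<subseteq> B}"
  have S: "carrier C \<in> ?S" using assms closed_star_subalgebra_carrier by simp
  have ops: "\<zero> \<in> B" "x \<in> B \<Longrightarrow> y \<in> B \<Longrightarrow> x \<oplus> y \<in> B" "x \<in> B \<Longrightarrow> y \<in> B \<Longrightarrow> x \<otimes> y \<in> B"
    "x \<in> B \<Longrightarrow> adj C x \<in> B" "x \<in> B \<Longrightarrow> a \<odot> x \<in> B" if "B \<in> ?S" for B x y a
    using that by (simp_all add: closed_star_subalgebraD)
  have lim: "x \<in> \<Inter>?S" if "x \<in> carrier C" "\<forall>n. f n \<in> \<Inter>?S" "(\<lambda>n. cnorm C (f n \<ominus> x)) \<longlonglongrightarrow> 0" for f x
  proof
    fix B assume "B \<in> ?S"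
    then show "x \<in> B" using closed_star_subalgebra_lim[of B C x f] that by simp
  qed
  show ?thesis
    unfolding cstar_generated_def closed_star_subalgebra_def[of "\<Inter>?S"]
  proof (intro conjI ballI allI impI)
    show "\<Inter>?S \<subseteq> carrier C" using S by (rule Inter_lower)
    show "\<zero> \<in> \<Inter>?S" by (rule InterI) (rule ops)
  next
    fix x y assume "x \<in> \<Inter>?S" "y \<in> \<Inter>?S"
    then show "x \<oplus> y \<in> \<Inter>?S" "x \<otimes> y \<in> \<Inter>?S"
      by (auto intro!: InterI ops(2,3) dest: InterD simp del: Inter_iff mem_Collect_eq)
  next
    fix x a assume "x \<in> \<Inter>?S"
    then show "adj C x \<in> \<Inter>?S" "a \<odot> x \<in> \<Inter>?S"
      by (auto intro!: InterI ops(4,5) dest: InterD simp del: Inter_iff mem_Collect_eq)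
  next
    fix f x assume "x \<in> carrier C"
      and "(\<forall>n. f n \<in> \<Inter>?S) \<and> (\<lambda>n. cnorm C (f n \<ominus> x)) \<longlonglongrightarrow> 0"
    then show "x \<in> \<Inter>?S" using lim by blast
  qed
qed

lemma cstar_generated_superset: "X \<subseteq> cstar_generated C X"
  by (auto simp: cstar_generated_def)

lemma cstar_generated_least:
  "\<lbrakk>closed_star_subalgebra B C; X \<subseteq> B\<rbrakk> \<Longrightarrow> cstar_generated C X \<subseteq> B"
  by (auto simp: cstar_generated_def)


section \<open>Products of C*-algebras\<close>

lemma cstar_prod_simps:
  "\<zero>\<^bsub>cstar_prod I D\<^esub> = (\<lambda>i\<in>I. \<zero>\<^bsub>D i\<^esub>)"
  "f \<oplus>\<^bsub>cstar_prod I D\<^esub> g = (\<lambda>i\<in>I. f i \<oplus>\<^bsub>D i\<^esub> g i)"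
  "f \<otimes>\<^bsub>cstar_prod I D\<^esub> g = (\<lambda>i\<in>I. f i \<otimes>\<^bsub>D i\<^esub> g i)"
  "a \<odot>\<^bsub>cstar_prod I D\<^esub> f = (\<lambda>i\<in>I. a \<odot>\<^bsub>D i\<^esub> f i)"
  "adj (cstar_prod I D) f = (\<lambda>i\<in>I. adj (D i) (f i))"
  "cnorm (cstar_prod I D) f = (SUP i\<in>I. cnorm (D i) (f i))"
  by (simp_all add: cstar_prod_def)

lemma cstar_prod_carrierD:
  assumes "f \<in> carrier (cstar_prod I D)"
  shows "f \<in> extensional I" "i \<in> I \<Longrightarrow> f i \<in> carrier (D i)"
    "i \<in> I \<Longrightarrow> cnorm (D i) (f i) \<le> cnorm (cstar_prod I D) f"
  using assms by (auto simp: cstar_prod_def PiE_def intro: cSUP_upper)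

lemma cstar_prod_carrierI:
  assumes "f \<in> extensional I" "\<And>i. i \<in> I \<Longrightarrow> f i \<in> carrier (D i)"
    "\<And>i. i \<in> I \<Longrightarrow> cnorm (D i) (f i) \<le> c"
  shows "f \<in> carrier (cstar_prod I D)"
  using assms by (auto simp: cstar_prod_def PiE_def intro!: bdd_aboveI2)

lemma cstar_prod_norm_least:
  assumes "I \<noteq> {}" "\<And>i. i \<in> I \<Longrightarrow> cnorm (D i) (f i) \<le> c"
  shows "cnorm (cstar_prod I D) f \<le> c"
  using assms by (auto simp: cstar_prod_simps intro: cSUP_least)

lemma cstar_prod_cong:
  assumes "f \<in> extensional I" "g \<in> extensional I" "\<And>i. i \<in> I \<Longrightarrow> f i = g i"
  shows "f = g"
  using assms by (rule extensionalityI)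

theorem cstar_algebra_prod:
  assumes ne: "I \<noteq> {}" and alg: "\<And>i. i \<in> I \<Longrightarrow> cstar_algebra (D i)"
  shows "cstar_algebra (cstar_prod I D)"
proof -
  let ?P = "cstar_prod I D"
  note [simp] = cstar_prod_simps(1-5)
  note D = cstar_prod_carrierD
  note least = cstar_prod_norm_least[OF ne]
  have nonneg: "0 \<le> cnorm ?P f" if "f \<in> carrier ?P" for f
    using ne D(2,3)[OF that] cstar_algebra.cnorm_nonneg[OF alg] by (meson ex_in_conv order_trans)
  have ab: "abelian_group (D i)" if "i \<in> I" for i
  proof -
    interpret cstar_algebra "D i" by (rule alg[OF that])
    show ?thesis by (rule M.abelian_group_axioms)
  qed
  have cl: "\<zero>\<^bsub>D i\<^esub> \<in> carrier (D i)"
      "\<lbrakk>x \<in> carrier (D i); y \<in> carrier (D i)\<rbrakk> \<Longrightarrow> x \<oplus>\<^bsub>D i\<^esub> y \<in> carrier (D i)"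
      "\<lbrakk>x \<in> carrier (D i); y \<in> carrier (D i)\<rbrakk> \<Longrightarrow> x \<otimes>\<^bsub>D i\<^esub> y \<in> carrier (D i)"
      "x \<in> carrier (D i) \<Longrightarrow> a \<odot>\<^bsub>D i\<^esub> x \<in> carrier (D i)"
      "x \<in> carrier (D i) \<Longrightarrow> adj (D i) x \<in> carrier (D i)" if "i \<in> I" for i x y a
  proof -
    interpret cstar_algebra "D i" by (rule alg[OF that])
    show "\<zero>\<^bsub>D i\<^esub> \<in> carrier (D i)"
      "\<lbrakk>x \<in> carrier (D i); y \<in> carrier (D i)\<rbrakk> \<Longrightarrow> x \<oplus>\<^bsub>D i\<^esub> y \<in> carrier (D i)"
      "\<lbrakk>x \<in> carrier (D i); y \<in> carrier (D i)\<rbrakk> \<Longrightarrow> x \<otimes>\<^bsub>D i\<^esub> y \<in> carrier (D i)"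
      "x \<in> carrier (D i) \<Longrightarrow> a \<odot>\<^bsub>D i\<^esub> x \<in> carrier (D i)"
      "x \<in> carrier (D i) \<Longrightarrow> adj (D i) x \<in> carrier (D i)"
      by (simp_all add: mult_closed a_smult_closed adj_closed)
  qed
  have zero: "\<zero>\<^bsub>?P\<^esub> \<in> carrier ?P"
    by (rule cstar_prod_carrierI[where c = 0]) (simp_all add: cl cstar_algebra.cnorm_0 alg)
  have add: "f \<oplus>\<^bsub>?P\<^esub> g \<in> carrier ?P" "cnorm ?P (f \<oplus>\<^bsub>?P\<^esub> g) \<le> cnorm ?P f + cnorm ?P g"
    if fg: "f \<in> carrier ?P" "g \<in> carrier ?P" for f g
  proof -
    have le: "cnorm (D i) ((f \<oplus>\<^bsub>?P\<^esub> g) i) \<le> cnorm ?P f + cnorm ?P g" if i: "i \<in> I" for i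
      using cstar_algebra.cnorm_triangle[OF alg, OF i, of "f i" "g i"] D(2,3)[OF fg(1) i] D(2,3)[OF fg(2) i] i
      by simp
    show "f \<oplus>\<^bsub>?P\<^esub> g \<in> carrier ?P"
      using fg le by (intro cstar_prod_carrierI) (simp_all add: cl D(2))
    show "cnorm ?P (f \<oplus>\<^bsub>?P\<^esub> g) \<le> cnorm ?P f + cnorm ?P g"
      using le by (rule least)
  qed
  have mult: "f \<otimes>\<^bsub>?P\<^esub> g \<in> carrier ?P" "cnorm ?P (f \<otimes>\<^bsub>?P\<^esub> g) \<le> cnorm ?P f * cnorm ?P g"
    if fg: "f \<in> carrier ?P" "g \<in> carrier ?P" for f g
  proof -
    have le: "cnorm (D i) ((f \<otimes>\<^bsub>?P\<^esub> g) i) \<le> cnorm ?P f * cnorm ?P g" if i: "i \<in> I" for i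
    proof -
      have "cnorm (D i) (f i \<otimes>\<^bsub>D i\<^esub> g i) \<le> cnorm (D i) (f i) * cnorm (D i) (g i)"
        using cstar_algebra.cnorm_mult[OF alg, OF i] D(2)[OF _ i] fg by blast
      also have "\<dots> \<le> cnorm ?P f * cnorm ?P g"
        using D(2,3)[OF _ i] fg nonneg cstar_algebra.cnorm_nonneg[OF alg, OF i]
        by (intro mult_mono) blast+
      finally show ?thesis using i by simp
    qed
    show "f \<otimes>\<^bsub>?P\<^esub> g \<in> carrier ?P"
      using fg le by (intro cstar_prod_carrierI) (simp_all add: cl D(2))
    show "cnorm ?P (f \<otimes>\<^bsub>?P\<^esub> g) \<le> cnorm ?P f * cnorm ?P g"
      using le by (rule least)
  qed
  have smult_eq: "cnorm (D i) ((a \<odot>\<^bsub>?P\<^esub> f) i) = cmod a * cnorm (D i) (f i)"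
    if "f \<in> carrier ?P" "i \<in> I" for f a i
    using that(2) by (simp add: cstar_algebra.cnorm_smult[OF alg] D(2)[OF that(1)])
  have smult_le: "cnorm (D i) ((a \<odot>\<^bsub>?P\<^esub> f) i) \<le> cmod a * cnorm ?P f"
    if f: "f \<in> carrier ?P" and i: "i \<in> I" for f a i
    unfolding smult_eq[OF f i] using D(3)[OF f i] by (simp add: mult_left_mono)
  have smult: "a \<odot>\<^bsub>?P\<^esub> f \<in> carrier ?P" if f: "f \<in> carrier ?P" for f a
    using f smult_le[OF f] by (intro cstar_prod_carrierI) (simp_all add: cl D(2))
  have smult_norm: "cnorm ?P (a \<odot>\<^bsub>?P\<^esub> f) = cmod a * cnorm ?P f" if f: "f \<in> carrier ?P" for f a
  proof (rule antisym)
    show "cnorm ?P (a \<odot>\<^bsub>?P\<^esub> f) \<le> cmod a * cnorm ?P f"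
      using smult_le[OF f] by (rule least)
    show "cmod a * cnorm ?P f \<le> cnorm ?P (a \<odot>\<^bsub>?P\<^esub> f)"
    proof (cases "a = 0")
      case True then show ?thesis using nonneg[OF smult[OF f]] by simp
    next
      case False
      have "cnorm ?P f \<le> cnorm ?P (a \<odot>\<^bsub>?P\<^esub> f) / cmod a"
      proof (rule least)
        fix i assume i: "i \<in> I"
        show "cnorm (D i) (f i) \<le> cnorm ?P (a \<odot>\<^bsub>?P\<^esub> f) / cmod a"
          using D(3)[OF smult[OF f] i, of a] False unfolding smult_eq[OF f i]
          by (simp add: field_simps)
      qed
      then show ?thesis using False by (simp add: field_simps)
    qed
  qed
  have adj: "adj ?P f \<in> carrier ?P" if f: "f \<in> carrier ?P" for f
    using f D(3)[OF f] cstar_algebra.cnorm_adj[OF alg]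
    by (intro cstar_prod_carrierI[where c = "cnorm ?P f"]) (simp_all add: cl D(2))
  have cstar: "cnorm ?P (adj ?P f \<otimes>\<^bsub>?P\<^esub> f) = (cnorm ?P f)\<^sup>2" if f: "f \<in> carrier ?P" for f
  proof -
    let ?g = "adj ?P f \<otimes>\<^bsub>?P\<^esub> f"
    have g: "?g \<in> carrier ?P" using mult(1)[OF adj[OF f] f] .
    have eq: "cnorm (D i) (?g i) = (cnorm (D i) (f i))\<^sup>2" if i: "i \<in> I" for i
      using cstar_algebra.cnorm_cstar[OF alg, OF i D(2)[OF f i]] i by simp
    show ?thesis
    proof (rule antisym)
      show "cnorm ?P ?g \<le> (cnorm ?P f)\<^sup>2"
      proof (rule least)
        fix i assume i: "i \<in> I"
        show "cnorm (D i) (?g i) \<le> (cnorm ?P f)\<^sup>2"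
          unfolding eq[OF i]
          using D(2,3)[OF f i] cstar_algebra.cnorm_nonneg[OF alg, OF i] by (intro power_mono)
      qed
      have "cnorm ?P f \<le> sqrt (cnorm ?P ?g)"
      proof (rule least)
        fix i assume i: "i \<in> I"
        show "cnorm (D i) (f i) \<le> sqrt (cnorm ?P ?g)"
          using D(3)[OF g i] unfolding eq[OF i] by (rule real_le_rsqrt)
      qed
      then show "(cnorm ?P f)\<^sup>2 \<le> cnorm ?P ?g"
        using nonneg[OF f] nonneg[OF g] by (metis power_mono real_sqrt_pow2)
    qed
  qed
  have norm0: "cnorm ?P f = 0 \<longleftrightarrow> f = \<zero>\<^bsub>?P\<^esub>" if f: "f \<in> carrier ?P" for f
  proof
    assume 0: "cnorm ?P f = 0"
    show "f = \<zero>\<^bsub>?P\<^esub>"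
    proof (rule cstar_prod_cong[OF D(1)[OF f] D(1)[OF zero]])
      fix i assume i: "i \<in> I"
      have "cnorm (D i) (f i) = 0"
        using D(3)[OF f i] 0 cstar_algebra.cnorm_nonneg[OF alg, OF i D(2)[OF f i]] by simp
      then show "f i = \<zero>\<^bsub>?P\<^esub> i"
        using cstar_algebra.cnorm_eq_0_iff[OF alg, OF i D(2)[OF f i]] i by simp
    qed
  next
    assume "f = \<zero>\<^bsub>?P\<^esub>"
    then have "cnorm ?P f \<le> 0" by (intro least) (simp add: cstar_algebra.cnorm_0 alg)
    then show "cnorm ?P f = 0" using nonneg[OF f] by simp
  qed
  show ?thesis
  proof (rule cstar_algebraI)
    fix f :: "nat \<Rightarrow> 'a \<Rightarrow> 'b"
    assume f: "\<And>n. f n \<in> carrier ?P"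
      and cau: "\<And>\<epsilon>. \<epsilon> > 0 \<Longrightarrow> \<exists>N. \<forall>m\<ge>N. \<forall>n\<ge>N. cnorm ?P (f m \<oplus>\<^bsub>?P\<^esub> (-1) \<odot>\<^bsub>?P\<^esub> f n) < \<epsilon>"
    have diff_i: "(g \<oplus>\<^bsub>?P\<^esub> (-1) \<odot>\<^bsub>?P\<^esub> h) i = g i \<ominus>\<^bsub>D i\<^esub> h i"
      if "g i \<in> carrier (D i)" "h i \<in> carrier (D i)" "i \<in> I" for g h i
      using that by (simp add: cstar_algebra.minus_smult alg)
    have le_i: "cnorm (D i) (f m i \<ominus>\<^bsub>D i\<^esub> f n i) \<le> cnorm ?P (f m \<oplus>\<^bsub>?P\<^esub> (-1) \<odot>\<^bsub>?P\<^esub> f n)"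
      if i: "i \<in> I" for i m n
      using D(3)[OF add(1)[OF f smult[OF f]] i, of m "-1" n] diff_i[of "f m" i "f n"] D(2)[OF f i] i
      by simp
    have "\<exists>x. x \<in> carrier (D i) \<and> (\<lambda>n. cnorm (D i) (f n i \<ominus>\<^bsub>D i\<^esub> x)) \<longlonglongrightarrow> 0" if i: "i \<in> I" for i
    proof -
      have "\<exists>N. \<forall>m\<ge>N. \<forall>n\<ge>N. cnorm (D i) (f m i \<ominus>\<^bsub>D i\<^esub> f n i) < \<epsilon>" if "\<epsilon> > 0" for \<epsilon>
        using cau[OF that] le_i[OF i] by (meson le_less_trans)
      then show ?thesis
        using cstar_algebra.complete[OF alg, OF i, of "\<lambda>n. f n i"] D(2)[OF f i] by blast
    qed
    then obtain x0 where x0: "\<And>i. i \<in> I \<Longrightarrow> x0 i \<in> carrier (D i)"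
        "\<And>i. i \<in> I \<Longrightarrow> (\<lambda>n. cnorm (D i) (f n i \<ominus>\<^bsub>D i\<^esub> x0 i)) \<longlonglongrightarrow> 0"
      by metis
    define x where "x = (\<lambda>i\<in>I. x0 i)"
    have x: "x i \<in> carrier (D i)" "(\<lambda>n. cnorm (D i) (f n i \<ominus>\<^bsub>D i\<^esub> x i)) \<longlonglongrightarrow> 0" if "i \<in> I" for i
      using that x0 by (simp_all add: x_def)
    have unif: "\<exists>N. \<forall>n\<ge>N. \<forall>i\<in>I. cnorm (D i) (f n i \<ominus>\<^bsub>D i\<^esub> x i) \<le> \<epsilon>" if e: "\<epsilon> > 0" for \<epsilon>
    proof -
      obtain N where N: "cnorm ?P (f m \<oplus>\<^bsub>?P\<^esub> (-1) \<odot>\<^bsub>?P\<^esub> f n) < \<epsilon>" if "m \<ge> N" "n \<ge> N" for m n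
        using cau[OF e] by blast
      have "cnorm (D i) (f n i \<ominus>\<^bsub>D i\<^esub> x i) \<le> \<epsilon>" if n: "n \<ge> N" and i: "i \<in> I" for n i
      proof (rule LIMSEQ_le_const)
        show "(\<lambda>m. \<epsilon> + cnorm (D i) (f m i \<ominus>\<^bsub>D i\<^esub> x i)) \<longlonglongrightarrow> \<epsilon>"
          using tendsto_add[OF tendsto_const x(2)[OF i]] by simp
        show "\<exists>M. \<forall>m\<ge>M. cnorm (D i) (f n i \<ominus>\<^bsub>D i\<^esub> x i) \<le> \<epsilon> + cnorm (D i) (f m i \<ominus>\<^bsub>D i\<^esub> x i)"
        proof (intro exI allI impI)
          fix m assume m: "N \<le> m"
          show "cnorm (D i) (f n i \<ominus>\<^bsub>D i\<^esub> x i) \<le> \<epsilon> + cnorm (D i) (f m i \<ominus>\<^bsub>D i\<^esub> x i)"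
            using cstar_algebra.cnorm_dist_triangle[OF alg, OF i D(2)[OF f[of n] i] D(2)[OF f[of m] i] x(1)[OF i]]
              le_i[OF i, of n m] N[OF n m] by linarith
        qed
      qed
      then show ?thesis by blast
    qed
    obtain N where N: "\<And>i. i \<in> I \<Longrightarrow> cnorm (D i) (f N i \<ominus>\<^bsub>D i\<^esub> x i) \<le> 1"
      using unif[of 1] by auto
    have xP: "x \<in> carrier ?P"
    proof (rule cstar_prod_carrierI)
      fix i assume i: "i \<in> I"
      interpret cstar_algebra "D i" by (rule alg[OF i])
      show "cnorm (D i) (x i) \<le> 1 + cnorm ?P (f N)"
        using cnorm_diff_bound[OF x(1)[OF i] D(2)[OF f[of N] i]] N[OF i] D(3)[OF f[of N] i]
          cnorm_minus_commute[OF x(1)[OF i] D(2)[OF f[of N] i]] by simp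
    qed (use x in \<open>simp_all add: x_def\<close>)
    have "(\<lambda>n. cnorm ?P (f n \<oplus>\<^bsub>?P\<^esub> (-1) \<odot>\<^bsub>?P\<^esub> x)) \<longlonglongrightarrow> 0"
    proof (rule LIMSEQ_I)
      fix \<epsilon> :: real assume "\<epsilon> > 0"
      then obtain N where N: "\<forall>n\<ge>N. \<forall>i\<in>I. cnorm (D i) (f n i \<ominus>\<^bsub>D i\<^esub> x i) \<le> \<epsilon> / 2"
        using unif[of "\<epsilon> / 2"] by auto
      have "norm (cnorm ?P (f n \<oplus>\<^bsub>?P\<^esub> (-1) \<odot>\<^bsub>?P\<^esub> x) - 0) < \<epsilon>" if n: "n \<ge> N" for n
      proof -
        have "cnorm ?P (f n \<oplus>\<^bsub>?P\<^esub> (-1) \<odot>\<^bsub>?P\<^esub> x) \<le> \<epsilon> / 2"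
        proof (rule least)
          fix i assume i: "i \<in> I"
          show "cnorm (D i) ((f n \<oplus>\<^bsub>?P\<^esub> (-1) \<odot>\<^bsub>?P\<^esub> x) i) \<le> \<epsilon> / 2"
            unfolding diff_i[of "f n" i x, OF D(2)[OF f i] x(1)[OF i] i] using N n i by blast
        qed
        then show ?thesis using nonneg[OF add(1)[OF f smult[OF xP]]] \<open>\<epsilon> > 0\<close>
          by (simp del: cstar_prod_simps)
      qed
      then show "\<exists>N. \<forall>n\<ge>N. norm (cnorm ?P (f n \<oplus>\<^bsub>?P\<^esub> (-1) \<odot>\<^bsub>?P\<^esub> x) - 0) < \<epsilon>" by blast
    qed
    then show "\<exists>x\<in>carrier ?P. (\<lambda>n. cnorm ?P (f n \<oplus>\<^bsub>?P\<^esub> (-1) \<odot>\<^bsub>?P\<^esub> x)) \<longlonglongrightarrow> 0"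
      using xP by blast
  next
    fix f g h a b
    assume f: "f \<in> carrier ?P" and g: "g \<in> carrier ?P" and h: "h \<in> carrier ?P"
    note m = D(2)[OF f] D(2)[OF g] D(2)[OF h]
    show "f \<oplus>\<^bsub>?P\<^esub> g \<oplus>\<^bsub>?P\<^esub> h = f \<oplus>\<^bsub>?P\<^esub> (g \<oplus>\<^bsub>?P\<^esub> h)"
      by (rule cstar_prod_cong[where I = I]) (simp_all add: m cl abelian_groupE(3)[OF ab])
    show "f \<otimes>\<^bsub>?P\<^esub> g \<otimes>\<^bsub>?P\<^esub> h = f \<otimes>\<^bsub>?P\<^esub> (g \<otimes>\<^bsub>?P\<^esub> h)"
      by (rule cstar_prod_cong[where I = I]) (simp_all add: m cl cstar_algebra.mult_assoc[OF alg])
    show "(f \<oplus>\<^bsub>?P\<^esub> g) \<otimes>\<^bsub>?P\<^esub> h = f \<otimes>\<^bsub>?P\<^esub> h \<oplus>\<^bsub>?P\<^esub> g \<otimes>\<^bsub>?P\<^esub> h"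
      by (rule cstar_prod_cong[where I = I]) (simp_all add: m cl cstar_algebra.mult_distl[OF alg])
    show "h \<otimes>\<^bsub>?P\<^esub> (f \<oplus>\<^bsub>?P\<^esub> g) = h \<otimes>\<^bsub>?P\<^esub> f \<oplus>\<^bsub>?P\<^esub> h \<otimes>\<^bsub>?P\<^esub> g"
      by (rule cstar_prod_cong[where I = I]) (simp_all add: m cl cstar_algebra.mult_distr[OF alg])
  next
    fix f g a
    assume f: "f \<in> carrier ?P" and g: "g \<in> carrier ?P"
    note m = D(2)[OF f] D(2)[OF g]
    show "f \<oplus>\<^bsub>?P\<^esub> g = g \<oplus>\<^bsub>?P\<^esub> f"
      by (rule cstar_prod_cong[where I = I]) (simp_all add: m cl abelian_groupE(4)[OF ab])
    show "a \<odot>\<^bsub>?P\<^esub> (f \<oplus>\<^bsub>?P\<^esub> g) = a \<odot>\<^bsub>?P\<^esub> f \<oplus>\<^bsub>?P\<^esub> a \<odot>\<^bsub>?P\<^esub> g"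
      by (rule cstar_prod_cong[where I = I]) (simp_all add: m cl cstar_algebra.smult_add_r[OF alg])
    show "(a \<odot>\<^bsub>?P\<^esub> f) \<otimes>\<^bsub>?P\<^esub> g = a \<odot>\<^bsub>?P\<^esub> (f \<otimes>\<^bsub>?P\<^esub> g)"
      by (rule cstar_prod_cong[where I = I]) (simp_all add: m cl cstar_algebra.smult_mult[OF alg])
    show "f \<otimes>\<^bsub>?P\<^esub> (a \<odot>\<^bsub>?P\<^esub> g) = a \<odot>\<^bsub>?P\<^esub> (f \<otimes>\<^bsub>?P\<^esub> g)"
      by (rule cstar_prod_cong[where I = I]) (simp_all add: m cl cstar_algebra.mult_smult[OF alg])
    show "adj ?P (f \<oplus>\<^bsub>?P\<^esub> g) = adj ?P f \<oplus>\<^bsub>?P\<^esub> adj ?P g"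
      by (rule cstar_prod_cong[where I = I]) (simp_all add: m cl cstar_algebra.adj_add[OF alg])
    show "adj ?P (f \<otimes>\<^bsub>?P\<^esub> g) = adj ?P g \<otimes>\<^bsub>?P\<^esub> adj ?P f"
      by (rule cstar_prod_cong[where I = I]) (simp_all add: m cl cstar_algebra.adj_mult[OF alg])
  next
    fix f a b
    assume f: "f \<in> carrier ?P"
    note m = D(2)[OF f] D(1)[OF f]
    show "\<zero>\<^bsub>?P\<^esub> \<oplus>\<^bsub>?P\<^esub> f = f"
      by (rule cstar_prod_cong[where I = I]) (simp_all add: m cl abelian_groupE(5)[OF ab])
    show "(-1) \<odot>\<^bsub>?P\<^esub> f \<oplus>\<^bsub>?P\<^esub> f = \<zero>\<^bsub>?P\<^esub>"
      by (rule cstar_prod_cong[where I = I]) (simp_all add: m cl cstar_algebra.neg_smult[OF alg])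
    show "(a + b) \<odot>\<^bsub>?P\<^esub> f = a \<odot>\<^bsub>?P\<^esub> f \<oplus>\<^bsub>?P\<^esub> b \<odot>\<^bsub>?P\<^esub> f"
      by (rule cstar_prod_cong[where I = I]) (simp_all add: m cl cstar_algebra.smult_add_l[OF alg])
    show "(a * b) \<odot>\<^bsub>?P\<^esub> f = a \<odot>\<^bsub>?P\<^esub> (b \<odot>\<^bsub>?P\<^esub> f)"
      by (rule cstar_prod_cong[where I = I]) (simp_all add: m cl cstar_algebra.smult_smult[OF alg])
    show "1 \<odot>\<^bsub>?P\<^esub> f = f"
      by (rule cstar_prod_cong[where I = I]) (simp_all add: m cl cstar_algebra.smult_1[OF alg])
    show "adj ?P (adj ?P f) = f"
      by (rule cstar_prod_cong[where I = I]) (simp_all add: m cl cstar_algebra.adj_adj[OF alg])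
    show "adj ?P (a \<odot>\<^bsub>?P\<^esub> f) = cnj a \<odot>\<^bsub>?P\<^esub> adj ?P f"
      by (rule cstar_prod_cong[where I = I]) (simp_all add: m cl cstar_algebra.adj_smult[OF alg])
  qed (rule zero add mult smult smult_norm adj cstar norm0; assumption)+
qed


section \<open>Universality of the graph C*-algebra\<close>

lemma star_homD:
  assumes "f \<in> star_hom C D"
  shows "x \<in> carrier C \<Longrightarrow> f x \<in> carrier D"
    "\<lbrakk>x \<in> carrier C; y \<in> carrier C\<rbrakk> \<Longrightarrow> f (x \<oplus>\<^bsub>C\<^esub> y) = f x \<oplus>\<^bsub>D\<^esub> f y"
    "\<lbrakk>x \<in> carrier C; y \<in> carrier C\<rbrakk> \<Longrightarrow> f (x \<otimes>\<^bsub>C\<^esub> y) = f x \<otimes>\<^bsub>D\<^esub> f y"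
    "x \<in> carrier C \<Longrightarrow> f (a \<odot>\<^bsub>C\<^esub> x) = a \<odot>\<^bsub>D\<^esub> f x"
    "x \<in> carrier C \<Longrightarrow> f (adj C x) = adj D (f x)"
  using assms by (simp_all add: star_hom_def)

lemma star_hom_zero:
  assumes "cstar_algebra C" "cstar_algebra D" "f \<in> star_hom C D"
  shows "f \<zero>\<^bsub>C\<^esub> = \<zero>\<^bsub>D\<^esub>"
proof -
  interpret C: cstar_algebra C by fact
  interpret D: cstar_algebra D by fact
  have "f (0 \<odot>\<^bsub>C\<^esub> \<zero>\<^bsub>C\<^esub>) = 0 \<odot>\<^bsub>D\<^esub> f \<zero>\<^bsub>C\<^esub>" using star_homD(4)[OF assms(3)] C.zero_closed by blast
  then show ?thesis using star_homD(1)[OF assms(3)] by (simp add: C.smult_0 D.smult_0)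
qed

lemma star_hom_finsum:
  assumes "cstar_algebra C" "cstar_algebra D" and f: "f \<in> star_hom C D"
    and "finite F" and g: "\<And>e. e \<in> F \<Longrightarrow> g e \<in> carrier C"
  shows "f (finsum C g F) = finsum D (\<lambda>e. f (g e)) F"
proof -
  interpret C: cstar_algebra C by fact
  interpret D: cstar_algebra D by fact
  show ?thesis using \<open>finite F\<close> g
  proof (induction F rule: finite_induct)
    case empty
    then show ?case using star_hom_zero[OF assms(1-3)] by simp
  next
    case (insert e F)
    have g: "g \<in> Pi F (\<lambda>_. carrier C)" "g e \<in> carrier C" using insert.prems by auto
    have "(\<lambda>e. f (g e)) \<in> Pi F (\<lambda>_. carrier D)" "f (g e) \<in> carrier D"
      using star_homD(1)[OF f] g by auto
    then show ?case
      using insert g star_homD(2)[OF f] by (simp add: C.finsum_closed)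
  qed
qed

text \<open>The relations of a graph can be checked in a family of quotients separating the points.\<close>

lemma ck_family_separating:
  assumes E: "cstar_algebra E" and G: "wf_digraph G" "row_finite G"
    and p: "\<And>v. v \<in> verts G \<Longrightarrow> p v \<in> carrier E" and S: "\<And>e. e \<in> arcs G \<Longrightarrow> S e \<in> carrier E"
    and D: "\<And>i. i \<in> I \<Longrightarrow> cstar_algebra (D i)"
    and f: "\<And>i. i \<in> I \<Longrightarrow> f i \<in> star_hom E (D i)"
    and fam: "\<And>i. i \<in> I \<Longrightarrow> ck_family G (D i) (q i) (T i)"
    and fp: "\<And>i v. i \<in> I \<Longrightarrow> v \<in> verts G \<Longrightarrow> f i (p v) = q i v"
    and fS: "\<And>i e. i \<in> I \<Longrightarrow> e \<in> arcs G \<Longrightarrow> f i (S e) = T i e"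
    and sep: "\<And>x y. \<lbrakk>x \<in> carrier E; y \<in> carrier E; \<And>i. i \<in> I \<Longrightarrow> f i x = f i y\<rbrakk> \<Longrightarrow> x = y"
  shows "ck_family G E p S"
proof -
  interpret E: cstar_algebra E by fact
  note cl = p S E.mult_closed E.adj_closed wf_digraph.tail_in_verts[OF G(1)]
  have h: "\<lbrakk>x \<in> carrier E; y \<in> carrier E\<rbrakk> \<Longrightarrow> f i (x \<otimes>\<^bsub>E\<^esub> y) = f i x \<otimes>\<^bsub>D i\<^esub> f i y"
      "x \<in> carrier E \<Longrightarrow> f i (adj E x) = adj (D i) (f i x)" "f i \<zero>\<^bsub>E\<^esub> = \<zero>\<^bsub>D i\<^esub>"
    if "i \<in> I" for i x y
    using that by (simp_all add: star_homD[OF f] star_hom_zero[OF E D f])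
  have fam': "v \<in> verts G \<Longrightarrow> q i v \<otimes>\<^bsub>D i\<^esub> q i v = q i v" "v \<in> verts G \<Longrightarrow> adj (D i) (q i v) = q i v"
      "\<lbrakk>v \<in> verts G; w \<in> verts G; v \<noteq> w\<rbrakk> \<Longrightarrow> q i v \<otimes>\<^bsub>D i\<^esub> q i w = \<zero>\<^bsub>D i\<^esub>"
      "e \<in> arcs G \<Longrightarrow> T i e \<otimes>\<^bsub>D i\<^esub> adj (D i) (T i e) \<otimes>\<^bsub>D i\<^esub> T i e = T i e"
      "e \<in> arcs G \<Longrightarrow> adj (D i) (T i e) \<otimes>\<^bsub>D i\<^esub> T i e = q i (tail G e)"
      "\<lbrakk>v \<in> verts G; {e \<in> arcs G. head G e = v} \<noteq> {}\<rbrakk> \<Longrightarrow>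
        (\<Oplus>\<^bsub>D i\<^esub>e\<in>{e \<in> arcs G. head G e = v}. T i e \<otimes>\<^bsub>D i\<^esub> adj (D i) (T i e)) = q i v"
    if "i \<in> I" for i v w e
    using fam[OF that] unfolding ck_family_def by blast+
  show ?thesis
    unfolding ck_family_def
  proof (intro conjI ballI impI)
    fix v w assume v: "v \<in> verts G"
    show "p v \<in> carrier E" using v by (rule p)
    show "p v \<otimes>\<^bsub>E\<^esub> p v = p v" by (rule sep) (simp_all add: v cl h fp fam')
    show "adj E (p v) = p v" by (rule sep) (simp_all add: v cl h fp fam')
    show "p v \<otimes>\<^bsub>E\<^esub> p w = \<zero>\<^bsub>E\<^esub>" if "w \<in> verts G" "v \<noteq> w"
      by (rule sep) (simp_all add: v that cl h fp fam')
  next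
    fix e assume e: "e \<in> arcs G"
    show "S e \<in> carrier E" using e by (rule S)
    show "S e \<otimes>\<^bsub>E\<^esub> adj E (S e) \<otimes>\<^bsub>E\<^esub> S e = S e" by (rule sep) (simp_all add: e cl h fS fam')
    show "adj E (S e) \<otimes>\<^bsub>E\<^esub> S e = p (tail G e)" by (rule sep) (simp_all add: e cl h fp fS fam')
  next
    fix v assume v: "v \<in> verts G" and ne: "{e \<in> arcs G. head G e = v} \<noteq> {}"
    let ?F = "{e \<in> arcs G. head G e = v}"
    have fin: "finite ?F" using G(2) v by (simp add: row_finite_def)
    show "(\<Oplus>\<^bsub>E\<^esub>e\<in>?F. S e \<otimes>\<^bsub>E\<^esub> adj E (S e)) = p v"
    proof (rule sep)
      show "(\<Oplus>\<^bsub>E\<^esub>e\<in>?F. S e \<otimes>\<^bsub>E\<^esub> adj E (S e)) \<in> carrier E"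
        by (rule E.finsum_closed) (simp add: cl Pi_iff)
      fix i assume i: "i \<in> I"
      interpret D: cstar_algebra "D i" using i by (rule D)
      have "f i (\<Oplus>\<^bsub>E\<^esub>e\<in>?F. S e \<otimes>\<^bsub>E\<^esub> adj E (S e)) = (\<Oplus>\<^bsub>D i\<^esub>e\<in>?F. f i (S e \<otimes>\<^bsub>E\<^esub> adj E (S e)))"
        using i by (intro star_hom_finsum[OF E D f] fin) (simp_all add: cl)
      also have "\<dots> = (\<Oplus>\<^bsub>D i\<^esub>e\<in>?F. T i e \<otimes>\<^bsub>D i\<^esub> adj (D i) (T i e))"
      proof (rule D.finsum_cong')
        show "(\<lambda>e. T i e \<otimes>\<^bsub>D i\<^esub> adj (D i) (T i e)) \<in> Pi ?F (\<lambda>_. carrier (D i))"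
          using fam[OF i] by (auto simp: ck_family_def intro!: D.mult_closed D.adj_closed)
      qed (simp_all add: i cl h fS)
      finally show "f i (\<Oplus>\<^bsub>E\<^esub>e\<in>?F. S e \<otimes>\<^bsub>E\<^esub> adj E (S e)) = f i (p v)"
        using fam'(6)[OF i v ne] fp[OF i v] by simp
    qed (use v in \<open>rule p\<close>)
  qed
qed

lemma ck_indices_nonempty: "ck_indices G \<noteq> {}"
proof -
  define z :: label where "z = (\<lambda>_. 0)"
  define D :: "label cstar" where "D = \<lparr>carrier = {z}, mult = (\<lambda>_ _. z), one = z, zero = z, add = (\<lambda>_ _. z),
    smult = (\<lambda>_ _. z), adj = (\<lambda>_. z), cnorm = (\<lambda>_. 0)\<rparr>"
  have [simp]: "carrier D = {z}" "x \<otimes>\<^bsub>D\<^esub> y = z" "\<zero>\<^bsub>D\<^esub> = z" "x \<oplus>\<^bsub>D\<^esub> y = z" "a \<odot>\<^bsub>D\<^esub> x = z"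
    "adj D x = z" "cnorm D x = 0" for x y a
    by (simp_all add: D_def)
  have D: "cstar_algebra D" by (rule cstar_algebraI) simp_all
  interpret D: cstar_algebra D by fact
  have "finsum D (\<lambda>_. z) F = z" for F :: "'b set"
    using D.finsum_closed[of "\<lambda>_. z" F] by simp
  then have "ck_family G D (\<lambda>_. z) (\<lambda>_. z)" by (simp add: ck_family_def)
  with D show ?thesis by (auto simp: ck_indices_def)
qed

abbreviation ck_prod :: "('v, 'e) pre_digraph \<Rightarrow> (('v, 'e) ck_index \<Rightarrow> label) cstar" where
  "ck_prod G \<equiv> cstar_prod (ck_indices G) fst"

abbreviation ck_generators :: "('v, 'e) pre_digraph \<Rightarrow> (('v, 'e) ck_index \<Rightarrow> label) set" where
  "ck_generators G \<equiv> graph_proj G ` verts G \<union> graph_isom G ` arcs G"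

lemma cstar_algebra_ck_prod: "cstar_algebra (ck_prod G)"
  by (rule cstar_algebra_prod[OF ck_indices_nonempty]) (auto simp: ck_indices_def)

lemma ck_generators_subset:
  assumes "wf_digraph G"
  shows "ck_generators G \<subseteq> carrier (ck_prod G)"
proof -
  have 1: "cnorm D (q v) \<le> 1" "q v \<in> carrier D"
    if i: "(D, q, T) = i" "i \<in> ck_indices G" and v: "v \<in> verts G" for D q T i v
  proof -
    interpret cstar_algebra D using i by (auto simp: ck_indices_def)
    have fam: "ck_family G D q T" using i by (auto simp: ck_indices_def)
    then show "cnorm D (q v) \<le> 1" "q v \<in> carrier D"
      using v cnorm_projection_le_1 by (simp_all add: ck_family_def)
  qed
  have 2: "cnorm D (T e) \<le> 1" "T e \<in> carrier D"
    if i: "(D, q, T) = i" "i \<in> ck_indices G" and e: "e \<in> arcs G" for D q T i e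
  proof -
    interpret cstar_algebra D using i by (auto simp: ck_indices_def)
    have fam: "ck_family G D q T" using i by (auto simp: ck_indices_def)
    then show "T e \<in> carrier D" using e by (simp add: ck_family_def)
    have "cnorm D (q (tail G e)) \<le> 1"
      using 1 i wf_digraph.tail_in_verts[OF assms e] by auto
    then have "cnorm D (adj D (T e) \<otimes>\<^bsub>D\<^esub> T e) \<le> 1"
      using fam e by (simp add: ck_family_def)
    with \<open>T e \<in> carrier D\<close> show "cnorm D (T e) \<le> 1" by (rule cnorm_isom_le_1)
  qed
  have "graph_proj G v \<in> carrier (ck_prod G)" if "v \<in> verts G" for v
    using 1 that by (intro cstar_prod_carrierI[where c = 1]) (auto simp: graph_proj_def split: prod.splits)
  moreover have "graph_isom G e \<in> carrier (ck_prod G)" if "e \<in> arcs G" for e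
    using 2 that by (intro cstar_prod_carrierI[where c = 1]) (auto simp: graph_isom_def split: prod.splits)
  ultimately show ?thesis by auto
qed

lemma graph_cstar_carrier:
  "carrier (graph_cstar G) = cstar_generated (ck_prod G) (ck_generators G)"
  by (simp add: graph_cstar_def Let_def)

lemma closed_star_subalgebra_graph_cstar:
  assumes "wf_digraph G"
  shows "closed_star_subalgebra (carrier (graph_cstar G)) (ck_prod G)"
  unfolding graph_cstar_carrier
  using cstar_algebra.cstar_generated_closed[OF cstar_algebra_ck_prod ck_generators_subset[OF assms]] .

lemma graph_cstar_ck_prod:
  "graph_cstar G = ck_prod G \<lparr>carrier := carrier (graph_cstar G)\<rparr>"
  by (simp add: graph_cstar_def Let_def)

lemma graph_cstar_simps:
  "\<zero>\<^bsub>graph_cstar G\<^esub> = \<zero>\<^bsub>ck_prod G\<^esub>"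
  "f \<oplus>\<^bsub>graph_cstar G\<^esub> g = f \<oplus>\<^bsub>ck_prod G\<^esub> g"
  "f \<otimes>\<^bsub>graph_cstar G\<^esub> g = f \<otimes>\<^bsub>ck_prod G\<^esub> g"
  "a \<odot>\<^bsub>graph_cstar G\<^esub> f = a \<odot>\<^bsub>ck_prod G\<^esub> f"
  "adj (graph_cstar G) f = adj (ck_prod G) f"
  "cnorm (graph_cstar G) f = cnorm (ck_prod G) f"
  by (simp_all add: graph_cstar_def Let_def)

theorem cstar_algebra_graph_cstar:
  assumes "wf_digraph G"
  shows "cstar_algebra (graph_cstar G)"
  using cstar_algebra_subalgebra[OF cstar_algebra_ck_prod closed_star_subalgebra_graph_cstar[OF assms]]
  unfolding graph_cstar_ck_prod[symmetric] .

lemma graph_cstar_in_carrier: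
  assumes "wf_digraph G"
  shows "f \<in> carrier (graph_cstar G) \<Longrightarrow> f \<in> carrier (ck_prod G)"
  using closed_star_subalgebraD(1)[OF closed_star_subalgebra_graph_cstar[OF assms]] by blast

lemma graph_cstar_eval:
  assumes G: "wf_digraph G" and i: "i \<in> ck_indices G"
  shows "(\<lambda>f. f i) \<in> star_hom (graph_cstar G) (fst i)"
    and "f \<in> carrier (graph_cstar G) \<Longrightarrow> cnorm (fst i) (f i) \<le> cnorm (graph_cstar G) f"
  using i cstar_prod_carrierD[OF graph_cstar_in_carrier[OF G]]
  by (simp_all add: star_hom_def graph_cstar_simps cstar_prod_simps(1-5))

theorem ck_family_graph_cstar:
  assumes "wf_digraph G" "row_finite G"
  shows "ck_family G (graph_cstar G) (graph_proj G) (graph_isom G)"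
proof (rule ck_family_separating[where I = "ck_indices G" and D = fst and f = "\<lambda>i f. f i"
      and q = "\<lambda>i. fst (snd i)" and T = "\<lambda>i. snd (snd i)"])
  fix x y assume "x \<in> carrier (graph_cstar G)" "y \<in> carrier (graph_cstar G)"
    and "\<And>i. i \<in> ck_indices G \<Longrightarrow> x i = y i"
  then show "x = y"
    using cstar_prod_carrierD(1)[OF graph_cstar_in_carrier[OF assms(1)]] by (metis extensionalityI)
next
  show "graph_proj G v \<in> carrier (graph_cstar G)" if "v \<in> verts G" for v
    using that cstar_generated_superset[of "ck_generators G" "ck_prod G"]
    unfolding graph_cstar_carrier by blast
  show "graph_isom G e \<in> carrier (graph_cstar G)" if "e \<in> arcs G" for e
    using that cstar_generated_superset[of "ck_generators G" "ck_prod G"]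
    unfolding graph_cstar_carrier by blast
qed (use assms in \<open>auto simp: cstar_algebra_graph_cstar graph_cstar_eval ck_indices_def
    graph_proj_def graph_isom_def\<close>)

theorem graph_cstar_generated:
  assumes "wf_digraph G"
  shows "cstar_generated (graph_cstar G) (ck_generators G) = carrier (graph_cstar G)"
proof
  interpret C: cstar_algebra "graph_cstar G" by (rule cstar_algebra_graph_cstar[OF assms])
  interpret P: cstar_algebra "ck_prod G" by (rule cstar_algebra_ck_prod)
  let ?B = "cstar_generated (graph_cstar G) (ck_generators G)"
  note sub = closed_star_subalgebra_graph_cstar[OF assms]
  have B: "closed_star_subalgebra ?B (graph_cstar G)"
    by (rule C.cstar_generated_closed)
      (simp add: graph_cstar_carrier cstar_generated_superset del: Un_subset_iff)
  note BD = closed_star_subalgebraD[OF B]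
  show "?B \<subseteq> carrier (graph_cstar G)" by (rule BD(1))
  have minus: "x \<ominus>\<^bsub>graph_cstar G\<^esub> y = x \<ominus>\<^bsub>ck_prod G\<^esub> y"
    if "x \<in> carrier (graph_cstar G)" "y \<in> carrier (graph_cstar G)" for x y
    using that graph_cstar_in_carrier[OF assms]
    by (simp add: C.minus_smult P.minus_smult graph_cstar_simps)
  have "closed_star_subalgebra ?B (ck_prod G)"
    unfolding closed_star_subalgebra_def[of _ "ck_prod G"]
  proof (intro conjI ballI allI impI)
    show "?B \<subseteq> carrier (ck_prod G)" using BD(1) graph_cstar_in_carrier[OF assms] by blast
  next
    fix f x assume x: "x \<in> carrier (ck_prod G)"
      and f: "(\<forall>n. f n \<in> ?B) \<and> (\<lambda>n. cnorm (ck_prod G) (f n \<ominus>\<^bsub>ck_prod G\<^esub> x)) \<longlonglongrightarrow> 0"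
    have fC: "f n \<in> carrier (graph_cstar G)" for n using f BD(1) by blast
    have xC: "x \<in> carrier (graph_cstar G)"
      using closed_star_subalgebra_lim[OF sub x, of f] fC f by blast
    show "x \<in> ?B"
      using closed_star_subalgebra_lim[OF B xC, of f] f by (simp add: minus fC xC graph_cstar_simps(6))
  qed (use BD(2-6) in \<open>simp_all add: graph_cstar_simps\<close>)
  then show "carrier (graph_cstar G) \<subseteq> ?B"
    unfolding graph_cstar_carrier[of G] by (rule cstar_generated_least) (rule cstar_generated_superset)
qed

datatype star_term =
  STGen nat | STZero | STAdd star_term star_term | STMult star_term star_term | STScale rat rat star_term
  | STAdj star_term

instance star_term :: countable by countable_datatype

primrec star_eval :: "'c cstar \<Rightarrow> (nat \<Rightarrow> 'c) \<Rightarrow> star_term \<Rightarrow> 'c" where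
  "star_eval C x (STGen n) = x n"
| "star_eval C x STZero = \<zero>\<^bsub>C\<^esub>"
| "star_eval C x (STAdd s t) = star_eval C x s \<oplus>\<^bsub>C\<^esub> star_eval C x t"
| "star_eval C x (STMult s t) = star_eval C x s \<otimes>\<^bsub>C\<^esub> star_eval C x t"
| "star_eval C x (STScale a b t) = Complex (of_rat a) (of_rat b) \<odot>\<^bsub>C\<^esub> star_eval C x t"
| "star_eval C x (STAdj t) = adj C (star_eval C x t)"

context cstar_algebra
begin

lemma star_eval_closed:
  assumes "\<And>n. x n \<in> carrier C" shows "star_eval C x t \<in> carrier C"
  by (induction t) (simp_all add: assms mult_closed a_smult_closed adj_closed)

definition converges :: "(nat \<Rightarrow> 'c) \<Rightarrow> 'c \<Rightarrow> bool" where
  "converges u x \<longleftrightarrow> x \<in> carrier C \<and> (\<forall>n. u n \<in> carrier C) \<and> (\<lambda>n. cnorm C (u n \<ominus> x)) \<longlonglongrightarrow> 0"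

lemma convergesI:
  assumes "x \<in> carrier C" "\<And>n. u n \<in> carrier C" "\<And>n. cnorm C (u n \<ominus> x) \<le> e n" "e \<longlonglongrightarrow> 0"
  shows "converges u x"
proof -
  have "(\<lambda>n. cnorm C (u n \<ominus> x)) \<longlonglongrightarrow> 0"
    by (rule tendsto_sandwich[OF _ _ tendsto_const assms(4)])
      (simp_all add: assms cnorm_nonneg minus_closed')
  then show ?thesis using assms by (simp add: converges_def)
qed

lemma convergesD:
  assumes "converges u x"
  shows "x \<in> carrier C" "u n \<in> carrier C" "(\<lambda>n. cnorm C (u n \<ominus> x)) \<longlonglongrightarrow> 0"
  using assms by (simp_all add: converges_def)

lemma converges_add:
  assumes u: "converges u x" and v: "converges v y" shows "converges (\<lambda>n. u n \<oplus> v n) (x \<oplus> y)"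
proof (rule convergesI)
  show "cnorm C ((u n \<oplus> v n) \<ominus> (x \<oplus> y)) \<le> cnorm C (u n \<ominus> x) + cnorm C (v n \<ominus> y)" for n
    using convergesD(1,2)[OF u] convergesD(1,2)[OF v]
    by (simp add: minus_add_swap cnorm_triangle minus_closed')
  show "(\<lambda>n. cnorm C (u n \<ominus> x) + cnorm C (v n \<ominus> y)) \<longlonglongrightarrow> 0"
    using tendsto_add[OF convergesD(3)[OF u] convergesD(3)[OF v]] by simp
qed (use convergesD(1,2)[OF u] convergesD(1,2)[OF v] in simp_all)

lemma converges_mult:
  assumes u: "converges u x" and v: "converges v y" shows "converges (\<lambda>n. u n \<otimes> v n) (x \<otimes> y)"
proof (rule convergesI)
  note c = convergesD(1,2)[OF u] convergesD(1,2)[OF v]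
  let ?a = "\<lambda>n. cnorm C (u n \<ominus> x)" and ?b = "\<lambda>n. cnorm C (v n \<ominus> y)"
  show "cnorm C (u n \<otimes> v n \<ominus> x \<otimes> y) \<le> ?a n * (?b n + cnorm C y) + cnorm C x * ?b n" for n
  proof -
    have "cnorm C (u n \<otimes> v n \<ominus> x \<otimes> y)
        \<le> cnorm C ((u n \<ominus> x) \<otimes> v n) + cnorm C (x \<otimes> (v n \<ominus> y))"
      using c by (simp add: minus_mult_split cnorm_triangle minus_closed' mult_closed)
    also have "\<dots> \<le> ?a n * cnorm C (v n) + cnorm C x * ?b n"
      using c by (intro add_mono cnorm_mult) (simp_all add: minus_closed')
    also have "?a n * cnorm C (v n) \<le> ?a n * (?b n + cnorm C y)"
      using c by (intro mult_left_mono cnorm_diff_bound cnorm_nonneg) (simp_all add: minus_closed')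
    finally show ?thesis by simp
  qed
  have "(\<lambda>n. ?a n * (?b n + cnorm C y) + cnorm C x * ?b n) \<longlonglongrightarrow> 0 * (0 + cnorm C y) + cnorm C x * 0"
    by (intro tendsto_intros convergesD(3)[OF u] convergesD(3)[OF v])
  then show "(\<lambda>n. ?a n * (?b n + cnorm C y) + cnorm C x * ?b n) \<longlonglongrightarrow> 0" by simp
qed (use convergesD(1,2)[OF u] convergesD(1,2)[OF v] in \<open>simp_all add: mult_closed\<close>)

lemma converges_smult:
  assumes u: "converges u x" and c: "c \<longlonglongrightarrow> a" shows "converges (\<lambda>n. c n \<odot> u n) (a \<odot> x)"
proof (rule convergesI)
  note cl = convergesD(1,2)[OF u]
  show "cnorm C (c n \<odot> u n \<ominus> a \<odot> x) \<le> cmod (c n) * cnorm C (u n \<ominus> x) + cmod (c n - a) * cnorm C x" for n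
  proof -
    have "c n \<odot> x \<ominus> a \<odot> x = (c n - a) \<odot> x"
      using cl smult_add_l[of x "c n" "- a"] smult_smult[of x "-1" a]
      by (simp add: minus_smult a_smult_closed)
    then show ?thesis
      using cnorm_dist_triangle[of "c n \<odot> u n" "c n \<odot> x" "a \<odot> x"] cl
      by (simp add: a_smult_closed minus_smult_distr cnorm_smult minus_closed')
  qed
  have "(\<lambda>n. cmod (c n) * cnorm C (u n \<ominus> x) + cmod (c n - a) * cnorm C x)
      \<longlonglongrightarrow> cmod a * 0 + cmod (a - a) * cnorm C x"
    by (intro tendsto_intros c convergesD(3)[OF u])
  then show "(\<lambda>n. cmod (c n) * cnorm C (u n \<ominus> x) + cmod (c n - a) * cnorm C x) \<longlonglongrightarrow> 0" by simp
qed (use convergesD(1,2)[OF u] in \<open>simp_all add: a_smult_closed\<close>)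

lemma converges_adj:
  assumes u: "converges u x" shows "converges (\<lambda>n. adj C (u n)) (adj C x)"
  by (rule convergesI[OF _ _ _ convergesD(3)[OF u]])
    (use convergesD(1,2)[OF u] in \<open>simp_all add: adj_closed cnorm_adj minus_closed' flip: adj_minus\<close>)

lemma converges_const: "x \<in> carrier C \<Longrightarrow> converges (\<lambda>_. x) x"
  using minus_eq_0_iff[of x x] by (simp add: converges_def cnorm_0)

lemma converges_ex_close:
  assumes u: "converges u x" and "e > 0" shows "\<exists>n. cnorm C (u n \<ominus> x) < e"
proof -
  have "\<forall>\<^sub>F n in sequentially. cnorm C (u n \<ominus> x) < e"
    using order_tendstoD(2)[OF convergesD(3)[OF u] \<open>e > 0\<close>] .
  then show ?thesis using eventually_happens'[OF sequentially_bot] by blast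
qed

lemma rat_complex_seq: "\<exists>r s. (\<lambda>n::nat. Complex (of_rat (r n)) (of_rat (s n))) \<longlonglongrightarrow> a"
proof -
  have "\<exists>r. (\<lambda>n::nat. real_of_rat (r n)) \<longlonglongrightarrow> x" for x
  proof -
    have "\<exists>q. x < real_of_rat q \<and> real_of_rat q < x + 1 / real (Suc n)" for n
      by (rule of_rat_dense) simp
    then obtain r where r: "\<And>n. x < real_of_rat (r n)" "\<And>n. real_of_rat (r n) < x + 1 / real (Suc n)"
      by metis
    have "(\<lambda>n. x + 1 / real (Suc n)) \<longlonglongrightarrow> x + 0"
      by (intro tendsto_intros LIMSEQ_Suc[OF lim_1_over_n])
    then have lim: "(\<lambda>n. x + 1 / real (Suc n)) \<longlonglongrightarrow> x" by simp
    have "(\<lambda>n. real_of_rat (r n)) \<longlonglongrightarrow> x"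
    proof (rule tendsto_sandwich[OF _ _ tendsto_const lim])
      show "\<forall>\<^sub>F n in sequentially. x \<le> real_of_rat (r n)"
        by (rule always_eventually) (blast intro: less_imp_le r(1))
      show "\<forall>\<^sub>F n in sequentially. real_of_rat (r n) \<le> x + 1 / real (Suc n)"
        by (rule always_eventually) (blast intro: less_imp_le r(2))
    qed
    then show ?thesis by (rule exI[of _ r])
  qed
  then obtain r s where "(\<lambda>n::nat. real_of_rat (r n)) \<longlonglongrightarrow> Re a" "(\<lambda>n::nat. real_of_rat (s n)) \<longlonglongrightarrow> Im a"
    by metis
  then have "(\<lambda>n. Complex (of_rat (r n)) (of_rat (s n))) \<longlonglongrightarrow> Complex (Re a) (Im a)"
    by (rule tendsto_Complex)
  then show ?thesis unfolding complex_surj by (intro exI)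
qed

lemma star_eval_dense:
  assumes x: "\<And>n. x n \<in> carrier C" and y: "y \<in> cstar_generated C (range x)" and e: "e > 0"
  shows "\<exists>t. cnorm C (star_eval C x t \<ominus> y) < e"
proof -
  define K where "K = {y. \<exists>t. converges (\<lambda>n::nat. star_eval C x (t n)) y}"
  have KI: "converges (\<lambda>n. star_eval C x (t n)) y \<Longrightarrow> y \<in> K" for t y
    unfolding K_def by blast
  have KE: "\<exists>t. converges (\<lambda>n. star_eval C x (t n)) y" if "y \<in> K" for y
    using that unfolding K_def by blast
  note ev = star_eval_closed[of x, OF x]
  have "closed_star_subalgebra K C"
    unfolding closed_star_subalgebra_def
  proof (intro conjI ballI allI impI)
    show "K \<subseteq> carrier C" using KE convergesD(1) by blast
    show "\<zero> \<in> K" using KI[of "\<lambda>_. STZero"] converges_const by simp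
  next
    fix y z assume "y \<in> K" "z \<in> K"
    then obtain s t where *: "converges (\<lambda>n. star_eval C x (s n)) y"
        "converges (\<lambda>n. star_eval C x (t n)) z"
      using KE by metis
    show "y \<oplus> z \<in> K" using converges_add[OF *] KI[of "\<lambda>n. STAdd (s n) (t n)"] by simp
    show "y \<otimes> z \<in> K" using converges_mult[OF *] KI[of "\<lambda>n. STMult (s n) (t n)"] by simp
  next
    fix y a assume "y \<in> K"
    then obtain t where t: "converges (\<lambda>n. star_eval C x (t n)) y" using KE by metis
    show "adj C y \<in> K" using converges_adj[OF t] KI[of "\<lambda>n. STAdj (t n)"] by simp
    obtain r s where "(\<lambda>n::nat. Complex (of_rat (r n)) (of_rat (s n))) \<longlonglongrightarrow> a"
      using rat_complex_seq by metis
    from converges_smult[OF t this] show "a \<odot> y \<in> K"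
      using KI[of "\<lambda>n. STScale (r n) (s n) (t n)"] by simp
  next
    fix f y assume y: "y \<in> carrier C"
      and f: "(\<forall>n. f n \<in> K) \<and> (\<lambda>n. cnorm C (f n \<ominus> y)) \<longlonglongrightarrow> 0"
    have fC: "f n \<in> carrier C" for n using f KE convergesD(1) by metis
    have "\<exists>t. cnorm C (star_eval C x t \<ominus> f n) < 1 / real (Suc n)" for n
    proof -
      obtain t where t: "converges (\<lambda>n. star_eval C x (t n)) (f n)" using f KE by metis
      have "0 < 1 / real (Suc n)" by simp
      from converges_ex_close[OF t this] show ?thesis by blast
    qed
    then obtain t where t: "\<And>n. cnorm C (star_eval C x (t n) \<ominus> f n) < 1 / real (Suc n)" by metis
    have "converges (\<lambda>n. star_eval C x (t n)) y"
    proof (rule convergesI[OF y ev])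
      show "cnorm C (star_eval C x (t n) \<ominus> y) \<le> 1 / real (Suc n) + cnorm C (f n \<ominus> y)" for n
        using cnorm_dist_triangle[OF ev fC y, of "t n" n] t[of n] by linarith
      show "(\<lambda>n. 1 / real (Suc n) + cnorm C (f n \<ominus> y)) \<longlonglongrightarrow> 0"
        using tendsto_add[OF LIMSEQ_Suc[OF lim_1_over_n] conjunct2[OF f]] by simp
    qed
    then show "y \<in> K" by (rule KI)
  qed
  moreover have "range x \<subseteq> K"
  proof
    fix y assume "y \<in> range x"
    then obtain n where "y = x n" by blast
    then show "y \<in> K" using converges_const[OF x] KI[of "\<lambda>_. STGen n"] by simp
  qed
  ultimately have "y \<in> K" using y cstar_generated_least by blast
  then obtain t where "converges (\<lambda>n. star_eval C x (t n)) y" using KE by metis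
  from converges_ex_close[OF this e] show ?thesis by blast
qed

lemma cstar_generated_label:
  assumes X: "countable X" "X \<subseteq> carrier C"
  obtains \<iota> :: "'c \<Rightarrow> label" where "inj_on \<iota> (cstar_generated C X)"
proof -
  have "countable (insert \<zero> X)" using X by simp
  then obtain x :: "nat \<Rightarrow> 'c" where x: "range x = insert \<zero> X"
    using range_from_nat_into by (metis insert_not_empty)
  have xC: "x n \<in> carrier C" for n
    using x X(2) by (metis insert_subset rangeI subsetD zero_closed)
  note ev = star_eval_closed[of x, OF xC]
  have sub: "cstar_generated C X \<subseteq> cstar_generated C (range x)"
    unfolding cstar_generated_def x by blast
  have gC: "y \<in> carrier C" if "y \<in> cstar_generated C X" for y
    using closed_star_subalgebraD(1)[OF cstar_generated_closed[OF X(2)]] that by blast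
  have "\<exists>k. cnorm C (star_eval C x (from_nat k) \<ominus> y) < 1 / real (Suc n)"
    if "y \<in> cstar_generated C X" for y n
  proof -
    have "0 < 1 / real (Suc n)" by simp
    from star_eval_dense[OF xC subsetD[OF sub that] this]
    show ?thesis by (metis from_nat_to_nat)
  qed
  then obtain \<iota> where \<iota>: "cnorm C (star_eval C x (from_nat (\<iota> y n)) \<ominus> y) < 1 / real (Suc n)"
    if "y \<in> cstar_generated C X" for y n
    by metis
  have "inj_on \<iota> (cstar_generated C X)"
  proof (rule inj_onI)
    fix y z assume y: "y \<in> cstar_generated C X" and z: "z \<in> cstar_generated C X" and "\<iota> y = \<iota> z"
    have "cnorm C (y \<ominus> z) \<le> 1 / real (Suc n) + 1 / real (Suc n)" for n
      using cnorm_dist_triangle[OF gC[OF y] ev gC[OF z], of "from_nat (\<iota> y n)"]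
        \<iota>[OF y, of n] \<iota>[OF z, of n] cnorm_minus_commute[OF gC[OF y] ev] \<open>\<iota> y = \<iota> z\<close>
      by fastforce
    moreover have "(\<lambda>n. 1 / real (Suc n) + 1 / real (Suc n)) \<longlonglongrightarrow> 0 + 0"
      by (intro tendsto_add LIMSEQ_Suc[OF lim_1_over_n])
    ultimately have "cnorm C (y \<ominus> z) \<le> 0"
      by (intro LIMSEQ_le_const) auto
    then have "cnorm C (y \<ominus> z) = 0"
      using cnorm_nonneg[OF minus_closed'[OF gC[OF y] gC[OF z]]] by simp
    then show "y = z"
      using gC[OF y] gC[OF z] by (simp add: cnorm_eq_0_iff minus_closed' minus_eq_0_iff)
  qed
  then show thesis by (rule that)
qed

end

theorem graph_cstar_universal:
  fixes G :: "('v, 'e) pre_digraph" and D :: "'d cstar"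
  assumes G: "wf_digraph G" "row_finite G" "countable (verts G)" "countable (arcs G)"
    and D: "cstar_algebra D" and fam: "ck_family G D q T"
  shows "\<exists>\<pi>\<in>star_hom (graph_cstar G) D.
      (\<forall>v\<in>verts G. \<pi> (graph_proj G v) = q v) \<and> (\<forall>e\<in>arcs G. \<pi> (graph_isom G e) = T e)"
proof -
  interpret D: cstar_algebra D by fact
  define X where "X = q ` verts G \<union> T ` arcs G"
  define B where "B = cstar_generated D X"
  have X: "X \<subseteq> carrier D" using fam by (auto simp: X_def ck_family_def)
  have "countable X" using G by (simp add: X_def)
  then obtain \<iota> :: "'d \<Rightarrow> label" where inj: "inj_on \<iota> B"
    using D.cstar_generated_label X unfolding B_def by blast
  have B: "closed_star_subalgebra B D" unfolding B_def by (rule D.cstar_generated_closed[OF X])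
  note BD = closed_star_subalgebraD[OF B]
  have qB: "q v \<in> B" if "v \<in> verts G" for v
    using that cstar_generated_superset[of X D] unfolding B_def X_def by blast
  have TB: "T e \<in> B" if "e \<in> arcs G" for e
    using that cstar_generated_superset[of X D] unfolding B_def X_def by blast
  define \<kappa> where "\<kappa> = inv_into B \<iota>"
  have k [simp]: "\<kappa> (\<iota> x) = x" if "x \<in> B" for x using inj that by (simp add: \<kappa>_def)
  define D' :: "label cstar" where "D' = \<lparr>carrier = \<iota> ` B,
    mult = (\<lambda>x y. \<iota> (\<kappa> x \<otimes>\<^bsub>D\<^esub> \<kappa> y)), one = undefined, zero = \<iota> \<zero>\<^bsub>D\<^esub>,
    add = (\<lambda>x y. \<iota> (\<kappa> x \<oplus>\<^bsub>D\<^esub> \<kappa> y)), smult = (\<lambda>a x. \<iota> (a \<odot>\<^bsub>D\<^esub> \<kappa> x)),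
    adj = (\<lambda>x. \<iota> (adj D (\<kappa> x))), cnorm = (\<lambda>x. cnorm D (\<kappa> x))\<rparr>"
  have D'_simps: "carrier D' = \<iota> ` B" "x \<otimes>\<^bsub>D'\<^esub> y = \<iota> (\<kappa> x \<otimes>\<^bsub>D\<^esub> \<kappa> y)" "\<zero>\<^bsub>D'\<^esub> = \<iota> \<zero>\<^bsub>D\<^esub>"
    "x \<oplus>\<^bsub>D'\<^esub> y = \<iota> (\<kappa> x \<oplus>\<^bsub>D\<^esub> \<kappa> y)" "a \<odot>\<^bsub>D'\<^esub> x = \<iota> (a \<odot>\<^bsub>D\<^esub> \<kappa> x)" "adj D' x = \<iota> (adj D (\<kappa> x))"
    "cnorm D' x = cnorm D (\<kappa> x)" for x y a
    by (simp_all add: D'_def)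
  have kB: "\<kappa> x \<in> B" if "x \<in> \<iota> ` B" for x using that by auto
  have im: "\<kappa> ` carrier D' = B" by (simp add: D'_simps image_image)
  have inj': "inj_on \<kappa> (carrier D')" by (auto simp: D'_simps intro: inj_onI)
  have D': "cstar_algebra D'"
    by (rule cstar_algebra_embed[OF D inj']) (simp_all add: im B, simp_all add: D'_simps kB BD)
  have \<kappa>: "\<kappa> \<in> star_hom D' D"
    by (auto simp: star_hom_def D'_simps BD(2-6) intro: subsetD[OF BD(1)])
  have "ck_family G D' (\<lambda>v. \<iota> (q v)) (\<lambda>e. \<iota> (T e))"
    by (rule ck_family_separating[where I = "{()}" and D = "\<lambda>_. D" and f = "\<lambda>_. \<kappa>"
          and q = "\<lambda>_. q" and T = "\<lambda>_. T"])
      (use inj' in \<open>auto simp: D' D G \<kappa> fam qB TB D'_simps(1) inj_on_def\<close>)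
  then have i: "(D', \<lambda>v. \<iota> (q v), \<lambda>e. \<iota> (T e)) \<in> ck_indices G" (is "?i \<in> _")
    using D' by (simp add: ck_indices_def)
  show ?thesis
  proof (intro bexI conjI ballI)
    show "(\<lambda>f. \<kappa> (f ?i)) \<in> star_hom (graph_cstar G) D"
      using star_homD[OF graph_cstar_eval(1)[OF G(1) i]] star_homD[OF \<kappa>]
      by (simp add: star_hom_def)
  qed (use i in \<open>simp_all add: graph_proj_def graph_isom_def qB TB\<close>)
qed


section \<open>Facts on automorphism groups and on \<open>Gamma\<close>\<close>

theorem group_StarAutoGroup:
  assumes "cstar_algebra C"
  shows "group (StarAutoGroup C)"
proof -
  interpret C: cstar_algebra C by fact
  interpret B: group "BijGroup (carrier C)" by (rule group_BijGroup)
  have carr: "carrier (BijGroup (carrier C)) = Bij (carrier C)" by (simp add: BijGroup_def)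
  have "subgroup (star_auto C) (BijGroup (carrier C))"
  proof (rule B.subgroupI)
    show "star_auto C \<subseteq> carrier (BijGroup (carrier C))" by (auto simp: star_auto_def carr)
    have "(\<lambda>x\<in>carrier C. x) \<in> star_auto C"
      by (simp add: star_auto_def star_hom_def id_Bij C.mult_closed C.a_smult_closed C.adj_closed)
    then show "star_auto C \<noteq> {}" by blast
  next
    fix f assume f: "f \<in> star_auto C"
    then have fB: "f \<in> Bij (carrier C)" and fh: "f \<in> star_hom C C" by (auto simp: star_auto_def)
    define g where "g = (\<lambda>x\<in>carrier C. inv_into (carrier C) f x)"
    have g: "g x \<in> carrier C" "f (g x) = x" if "x \<in> carrier C" for x
      using fB that Bij_inv_into_mem[OF fB]
      by (auto simp: g_def Bij_def bij_betw_def f_inv_into_f)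
    have inj: "x = y" if "x \<in> carrier C" "y \<in> carrier C" "f x = f y" for x y
      using fB that by (auto simp: Bij_def bij_betw_def dest: inj_onD)
    note cl = g C.mult_closed C.a_smult_closed C.adj_closed star_homD[OF fh]
    have "g \<in> star_hom C C"
      unfolding star_hom_def
    proof (intro CollectI conjI ballI allI)
      fix x y a assume x: "x \<in> carrier C" 
      show "g x \<in> carrier C" using x by (rule g)
      show "g (a \<odot>\<^bsub>C\<^esub> x) = a \<odot>\<^bsub>C\<^esub> g x" by (rule inj) (simp_all add: x cl)
      show "g (adj C x) = adj C (g x)" by (rule inj) (simp_all add: x cl)
      assume y: "y \<in> carrier C"
      show "g (x \<oplus>\<^bsub>C\<^esub> y) = g x \<oplus>\<^bsub>C\<^esub> g y" by (rule inj) (simp_all add: x y cl)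
      show "g (x \<otimes>\<^bsub>C\<^esub> y) = g x \<otimes>\<^bsub>C\<^esub> g y" by (rule inj) (simp_all add: x y cl)
    qed
    then show "inv\<^bsub>BijGroup (carrier C)\<^esub> f \<in> star_auto C"
      using restrict_inv_into_Bij[OF fB] by (simp add: star_auto_def inv_BijGroup[OF fB] g_def)
  next
    fix f g assume "f \<in> star_auto C" "g \<in> star_auto C"
    then have fg: "f \<in> Bij (carrier C)" "g \<in> Bij (carrier C)" and h: "f \<in> star_hom C C" "g \<in> star_hom C C"
      by (auto simp: star_auto_def)
    have "compose (carrier C) f g \<in> star_hom C C"
      by (simp add: star_hom_def compose_def star_homD[OF h(1)] star_homD[OF h(2)]
          C.mult_closed C.a_smult_closed C.adj_closed)
    then show "f \<otimes>\<^bsub>BijGroup (carrier C)\<^esub> g \<in> star_auto C"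
      using fg compose_Bij[OF fg] by (simp add: star_auto_def BijGroup_def)
  qed
  then show ?thesis unfolding StarAutoGroup_def by (rule B.subgroup_imp_group)
qed

theorem wf_digraph_Gamma:
  assumes "comm_group A"
  shows "wf_digraph (Gamma A)"
proof -
  interpret comm_group A by fact
  show ?thesis by unfold_locales (auto simp: Gamma_def)
qed

theorem row_finite_Gamma: "row_finite (Gamma A)"
proof -
  have "finite {e \<in> arcs (Gamma A). grange e = v}" for v
  proof -
    have "{e. grange e = v} \<subseteq> (case v of
        Vtx_v c \<Rightarrow> {}
      | Vtx_u c \<Rightarrow> {VtoU c, LoopU False c, LoopU True c}
      | Vtx_w1 a b \<Rightarrow> {VtoW1 a b}
      | Vtx_w2 a b \<Rightarrow> {VtoW2 a b}
      | Vtx_uu a b \<Rightarrow> {W1toUU a b, W2toUU a b, UtoUU a b}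
      | Vtx_un a b n \<Rightarrow> {UUtoUN a b, UNtoUN a b n, LoopUN a b n})" (is "_ \<subseteq> ?F")
    proof
      fix e assume "e \<in> {e. grange e = v}"
      then show "e \<in> ?F" by (cases e) auto
    qed
    moreover have "finite ?F" by (simp split: gvert.splits)
    ultimately show ?thesis by (metis (no_types, lifting) Collect_mono_iff finite_subset)
  qed
  then show ?thesis by (simp add: row_finite_def Gamma_def)
qed

theorem countable_Gamma:
  assumes "countable (carrier A)"
  shows "countable (verts (Gamma A))" "countable (arcs (Gamma A))"
  using assms by (auto simp: Gamma_def setcompr_eq_image intro!: countable_UN)

end

theory Submission
  imports "Graph_Theory.Arc_Walk" "HOL-Analysis.Infinite_Sum" "HOL-Analysis.Bounded_Linear_Function" Defs
begin

text \<open>An automorphism \<open>\<alpha>\<close> of \<open>A\<close> relabels the graph \<open>Gamma A\<close> and so, by universality, induces an automorphism of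
  its C*-algebra, which sends the projection of \<open>Vtx_v a\<close> to that of \<open>Vtx_v (\<alpha> a)\<close>. This is functorial in \<open>\<alpha>\<close>
  (\<open>induced_auto_comp\<close>), and composing with the quotient map gives a homomorphism to the K-outer automorphism group.
  It has to be shown that \<open>\<alpha>\<close> is the identity if the induced automorphism is approximately inner.

  That these automorphisms act faithfully on \<open>K\<^sub>0\<close> would settle this, but ideals already suffice. An approximately inner
  automorphism preserves every closed ideal, in particular the kernel of every representation. The vertices
  \<open>Vtx_v a\<close> receive no edges. For such a vertex \<open>w\<close>, the graph is represented on the square-summable functions on the
  finite paths that start at \<open>w\<close>, every edge acting by prolongation of paths (\<open>path_representation\<close>). The
  projection of a vertex acts as zero exactly if no path leads there from \<open>w\<close>. With \<open>w = Vtx_v (\<alpha> a)\<close>, the projection of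
  \<open>w\<close> survives, while that of \<open>Vtx_v a\<close> vanishes unless \<open>\<alpha> a = a\<close>; so if \<open>\<alpha> a \<noteq> a\<close>, the one cannot be
  approximated by unitary conjugates of the other (\<open>approx_Inn_source_reachable\<close>).

  The analytic input is that *-homomorphisms are contractive (\<open>star_hom_contractive\<close>). It makes a homomorphism on the graph
  C*-algebra determined by the generators, it makes the approximately inner automorphisms a normal subgroup
  (\<open>normal_approx_Inn\<close>), and it turns the ideal argument into a norm estimate. It is proved by writing an element of
  norm less than one as the cosine part of a unitary. The operators on the Hilbert space of square-summable families
  form a C*-algebra (\<open>cstar_algebra_operator_algebra\<close>), in which the path representation takes its values.\<close>


section \<open>The unitization and contractivity of *-homomorphisms\<close>

context cstar_algebra
begin

lemma converges_unique:
  assumes "converges u x" "converges u y" shows "x = y"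
proof -
  note c = convergesD(1,2)[OF assms(1)] convergesD(1)[OF assms(2)]
  have "(\<lambda>n. cnorm C (u n \<ominus> x) + cnorm C (u n \<ominus> y)) \<longlonglongrightarrow> 0 + 0"
    by (intro tendsto_add convergesD(3) assms)
  moreover have "cnorm C (x \<ominus> y) \<le> cnorm C (u n \<ominus> x) + cnorm C (u n \<ominus> y)" for n
    using cnorm_dist_triangle[of x "u n" y] cnorm_minus_commute[of x "u n"] c by simp
  ultimately have "cnorm C (x \<ominus> y) \<le> 0" by (intro LIMSEQ_le_const) auto
  then have "cnorm C (x \<ominus> y) = 0" using cnorm_nonneg[OF minus_closed'[OF c(1,3)]] by simp
  then show ?thesis using c by (simp add: cnorm_eq_0_iff minus_closed' minus_eq_0_iff)
qed

lemma smult_zero: "a \<odot> \<zero> = \<zero>"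
  using smult_r_null by simp

lemmas alg_simps = mult_closed a_smult_closed adj_closed mult_assoc mult_distl mult_distr smult_mult mult_smult
  smult_add_r smult_0 smult_1 adj_adj adj_add adj_smult adj_mult adj_0 smult_zero

lemma mult_zero: "x \<in> carrier C \<Longrightarrow> x \<otimes> \<zero> = \<zero>" "x \<in> carrier C \<Longrightarrow> \<zero> \<otimes> x = \<zero>"
  using mult_smult[of x \<zero> 0] smult_mult[of \<zero> x 0] by (simp_all add: smult_0 mult_closed)

lemma smult_smult': "x \<in> carrier C \<Longrightarrow> a \<odot> (b \<odot> x) = (a * b) \<odot> x"
  by (simp add: smult_smult)

lemma unitization_simps:
  "(x, l) \<otimes>\<^bsub>unitization C\<^esub> (y, m) = (x \<otimes> y \<oplus> l \<odot> y \<oplus> m \<odot> x, l * m)"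
  "\<one>\<^bsub>unitization C\<^esub> = (\<zero>, 1)"
  "carrier (unitization C) = carrier C \<times> UNIV"
  "uadj C (x, l) = (adj C x, cnj l)"
  by (simp_all add: unitization_def uadj_def)

lemma monoid_unitization: "monoid (unitization C)"
proof (rule monoidI)
  fix u v w
  assume "u \<in> carrier (unitization C)" "v \<in> carrier (unitization C)" "w \<in> carrier (unitization C)"
  then show "u \<otimes>\<^bsub>unitization C\<^esub> v \<otimes>\<^bsub>unitization C\<^esub> w
      = u \<otimes>\<^bsub>unitization C\<^esub> (v \<otimes>\<^bsub>unitization C\<^esub> w)"
    by (auto simp: unitization_simps alg_simps smult_smult' a_ac mult.commute)
qed (auto simp: unitization_simps alg_simps mult_zero)

lemma uadj_closed: "u \<in> carrier (unitization C) \<Longrightarrow> uadj C u \<in> carrier (unitization C)"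
  by (auto simp: unitization_simps adj_closed)

lemma uadj_uadj: "u \<in> carrier (unitization C) \<Longrightarrow> uadj C (uadj C u) = u"
  by (auto simp: unitization_simps adj_adj)

lemma uadj_mult:
  "\<lbrakk>u \<in> carrier (unitization C); v \<in> carrier (unitization C)\<rbrakk>
    \<Longrightarrow> uadj C (u \<otimes>\<^bsub>unitization C\<^esub> v) = uadj C v \<otimes>\<^bsub>unitization C\<^esub> uadj C u"
  by (auto simp: unitization_simps alg_simps a_ac)

lemma unitariesD:
  assumes "u \<in> unitaries C"
  shows "u \<in> carrier (unitization C)" "uadj C u \<in> carrier (unitization C)"
    "uadj C u \<otimes>\<^bsub>unitization C\<^esub> u = \<one>\<^bsub>unitization C\<^esub>"
    "u \<otimes>\<^bsub>unitization C\<^esub> uadj C u = \<one>\<^bsub>unitization C\<^esub>"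
  using assms uadj_closed by (auto simp: unitaries_def)

lemma uadj_unitary: "u \<in> unitaries C \<Longrightarrow> uadj C u \<in> unitaries C"
  using uadj_closed uadj_uadj by (auto simp: unitaries_def)

lemma one_unitary: "\<one>\<^bsub>unitization C\<^esub> \<in> unitaries C"
  by (simp add: unitaries_def unitization_simps alg_simps mult_zero)

lemma mult_unitary:
  assumes u: "u \<in> unitaries C" and v: "v \<in> unitaries C"
  shows "u \<otimes>\<^bsub>unitization C\<^esub> v \<in> unitaries C"
proof -
  interpret U: monoid "unitization C" by (rule monoid_unitization)
  note cl = unitariesD(1,2)[OF u] unitariesD(1,2)[OF v]
  let ?w = "u \<otimes>\<^bsub>unitization C\<^esub> v"
  have "uadj C ?w \<otimes>\<^bsub>unitization C\<^esub> ?w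
      = uadj C v \<otimes>\<^bsub>unitization C\<^esub> (uadj C u \<otimes>\<^bsub>unitization C\<^esub> u) \<otimes>\<^bsub>unitization C\<^esub> v"
    using cl by (simp add: uadj_mult U.m_assoc)
  moreover have "?w \<otimes>\<^bsub>unitization C\<^esub> uadj C ?w
      = u \<otimes>\<^bsub>unitization C\<^esub> (v \<otimes>\<^bsub>unitization C\<^esub> uadj C v) \<otimes>\<^bsub>unitization C\<^esub> uadj C u"
    using cl by (simp add: uadj_mult U.m_assoc)
  ultimately show ?thesis using cl unitariesD(3,4)[OF u] unitariesD(3,4)[OF v]
    by (simp add: unitaries_def)
qed

text \<open>For a unitary \<open>u = x + l1\<close> one has \<open>(u z)\<^sup>* (u z) = z\<^sup>* z\<close>, so the C*-identity makes multiplication by \<open>u\<close>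
  isometric on \<open>C\<close>. Restricting to multiplication of elements of \<open>C\<close> keeps the argument free of a norm on the
  unitization.\<close>

lemma cnorm_unitary_mult:
  assumes "(x, l) \<in> unitaries C" and z: "z \<in> carrier C"
  shows "cnorm C (x \<otimes> z \<oplus> l \<odot> z) = cnorm C z"
proof -
  interpret U: monoid "unitization C" by (rule monoid_unitization)
  let ?u = "(x, l)" and ?z = "(z, 0)"
  let ?w = "x \<otimes> z \<oplus> l \<odot> z"
  note u = unitariesD[OF assms(1)]
  have x: "x \<in> carrier C" using u(1) by (simp add: unitization_simps)
  have w: "?w \<in> carrier C" using x z by (simp add: alg_simps)
  have zU: "?z \<in> carrier (unitization C)" "uadj C ?z \<in> carrier (unitization C)"
    using z by (simp_all add: unitization_simps alg_simps)
  have uz: "?u \<otimes>\<^bsub>unitization C\<^esub> ?z = (?w, 0)"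
    using x z by (simp add: unitization_simps alg_simps)
  have "(adj C ?w \<otimes> ?w, 0)
      = uadj C (?u \<otimes>\<^bsub>unitization C\<^esub> ?z) \<otimes>\<^bsub>unitization C\<^esub> (?u \<otimes>\<^bsub>unitization C\<^esub> ?z)"
    unfolding uz using w by (simp add: unitization_simps smult_0 adj_closed mult_closed)
  also have "\<dots> = uadj C ?z \<otimes>\<^bsub>unitization C\<^esub> (uadj C ?u \<otimes>\<^bsub>unitization C\<^esub> ?u) \<otimes>\<^bsub>unitization C\<^esub> ?z"
    using u(1,2) zU by (simp add: uadj_mult U.m_assoc)
  also have "\<dots> = (adj C z \<otimes> z, 0)"
    unfolding u(3) using zU z by (simp add: unitization_simps alg_simps mult_zero)
  finally have "(cnorm C ?w)\<^sup>2 = (cnorm C z)\<^sup>2"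
    using cnorm_cstar[OF w] cnorm_cstar[OF z] by simp
  then show ?thesis using cnorm_nonneg w z by simp
qed

text \<open>The hypothesis on \<open>y\<close> reads \<open>c\<^sup>2 + (1 - y)\<^sup>2 = 1\<close>: the commuting self-adjoint elements \<open>c\<close> and \<open>1 - y\<close>
  are a cosine and a sine. Hence \<open>w = c + \<i> (1 - y)\<close>, which is the pair \<open>(c - \<i> y, \<i>)\<close> of the unitization, is
  unitary, and \<open>c = (w + w\<^sup>*) / 2\<close> is an average of two unitaries. Applied to \<open>c\<close> itself, this yields
  \<open>\<parallel>c\<parallel>\<^sup>2 = \<parallel>c\<^sup>2\<parallel> \<le> \<parallel>c\<parallel>\<close>.\<close>

lemma cnorm_le_1_if_square_complement:
  assumes c: "c \<in> carrier C" "adj C c = c" and y: "y \<in> carrier C" "adj C y = y"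
    and comm: "c \<otimes> y = y \<otimes> c" and eq: "y \<oplus> y = c \<otimes> c \<oplus> y \<otimes> y"
  shows "cnorm C c \<le> 1"
proof -
  let ?w = "c \<oplus> (- \<i>) \<odot> y" and ?w' = "c \<oplus> \<i> \<odot> y"
  let ?s = "c \<otimes> c \<oplus> y \<otimes> y"
  note cl = c y mult_closed a_smult_closed
  have cancel: "\<i> \<odot> z \<oplus> (- \<i>) \<odot> z = \<zero>" "(- \<i>) \<odot> z \<oplus> \<i> \<odot> z = \<zero>" if "z \<in> carrier C" for z
    using smult_add_l[of z "\<i>" "- \<i>"] smult_add_l[of z "- \<i>" "\<i>"] that by (simp_all add: smult_0)
  have swap: "(p \<oplus> q) \<oplus> (r \<oplus> s) = (q \<oplus> r) \<oplus> (p \<oplus> s)"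
    if "p \<in> carrier C" "q \<in> carrier C" "r \<in> carrier C" "s \<in> carrier C" for p q r s
    using that by (simp add: a_ac)
  have ww': "?w \<otimes> ?w' = ?s"
  proof -
    have "?w \<otimes> ?w' = (c \<otimes> c \<oplus> (- \<i>) \<odot> (c \<otimes> y)) \<oplus> (\<i> \<odot> (c \<otimes> y) \<oplus> y \<otimes> y)"
      by (simp add: cl mult_distl mult_distr smult_mult mult_smult smult_smult' smult_1 smult_add_r flip: comm)
    then show ?thesis
      using swap[of "c \<otimes> c" "(- \<i>) \<odot> (c \<otimes> y)" "\<i> \<odot> (c \<otimes> y)" "y \<otimes> y"]
      by (simp add: cl cancel)
  qed
  have w'w: "?w' \<otimes> ?w = ?s"
  proof -
    have "?w' \<otimes> ?w = (c \<otimes> c \<oplus> \<i> \<odot> (c \<otimes> y)) \<oplus> ((- \<i>) \<odot> (c \<otimes> y) \<oplus> y \<otimes> y)"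
      by (simp add: cl mult_distl mult_distr smult_mult mult_smult smult_smult' smult_1 smult_add_r flip: comm)
    then show ?thesis
      using swap[of "c \<otimes> c" "\<i> \<odot> (c \<otimes> y)" "(- \<i>) \<odot> (c \<otimes> y)" "y \<otimes> y"]
      by (simp add: cl cancel)
  qed
  have lin: "(- \<i>) \<odot> ?w \<oplus> \<i> \<odot> ?w' = (-1) \<odot> ?s"
  proof -
    have "(- \<i>) \<odot> ?w \<oplus> \<i> \<odot> ?w' = ((-1) \<odot> y \<oplus> (- \<i>) \<odot> c) \<oplus> (\<i> \<odot> c \<oplus> (-1) \<odot> y)"
      by (simp add: cl smult_smult' smult_add_r a_comm)
    then show ?thesis
      using swap[of "(-1) \<odot> y" "(- \<i>) \<odot> c" "\<i> \<odot> c" "(-1) \<odot> y"]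
      by (simp add: cl cancel smult_add_r flip: eq)
  qed
  have s: "?s \<oplus> (-1) \<odot> ?s = \<zero>"
    using neg_smult[of ?s] by (simp add: cl a_comm)
  have "?w' \<otimes> ?w \<oplus> (- \<i>) \<odot> ?w \<oplus> \<i> \<odot> ?w' = \<zero>"
    using s lin by (simp add: w'w cl a_assoc)
  moreover have "?w \<otimes> ?w' \<oplus> \<i> \<odot> ?w' \<oplus> (- \<i>) \<odot> ?w = \<zero>"
    using s lin by (simp add: ww' cl a_assoc a_comm[of "\<i> \<odot> ?w'"])
  ultimately have u: "(?w, \<i>) \<in> unitaries C"
    using c y by (simp add: unitaries_def unitization_simps adj_add adj_smult a_smult_closed)
  have u': "(?w', - \<i>) \<in> unitaries C"
    using uadj_unitary[OF u] c y by (simp add: unitization_simps adj_add adj_smult a_smult_closed)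
  have "(?w \<oplus> ?w') = c \<oplus> c"
    using swap[of "(- \<i>) \<odot> y" c c "\<i> \<odot> y"] by (simp add: cl cancel a_comm)
  have two: "(?w \<otimes> c \<oplus> \<i> \<odot> c) \<oplus> (?w' \<otimes> c \<oplus> (- \<i>) \<odot> c) = 2 \<odot> (c \<otimes> c)"
  proof -
    have "(?w \<otimes> c \<oplus> \<i> \<odot> c) \<oplus> ((- \<i>) \<odot> c \<oplus> ?w' \<otimes> c) = (?w \<oplus> ?w') \<otimes> c"
      using swap[of "?w \<otimes> c" "\<i> \<odot> c" "(- \<i>) \<odot> c" "?w' \<otimes> c"]
      by (simp add: cl cancel mult_distl del: mult_distr)
    also have "\<dots> = 2 \<odot> (c \<otimes> c)"
      using smult_add_l[of "c \<otimes> c" 1 1] by (simp add: \<open>?w \<oplus> ?w' = c \<oplus> c\<close> cl mult_distl smult_1)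
    finally show ?thesis by (simp add: cl a_comm)
  qed
  have "2 * cnorm C (c \<otimes> c) \<le> cnorm C (?w \<otimes> c \<oplus> \<i> \<odot> c) + cnorm C (?w' \<otimes> c \<oplus> (- \<i>) \<odot> c)"
    using cnorm_triangle[of "?w \<otimes> c \<oplus> \<i> \<odot> c" "?w' \<otimes> c \<oplus> (- \<i>) \<odot> c"] c y
    unfolding two by (simp add: cnorm_smult mult_closed a_smult_closed)
  also have "\<dots> = 2 * cnorm C c"
    using cnorm_unitary_mult[OF u c(1)] cnorm_unitary_mult[OF u' c(1)] by simp
  finally have "cnorm C c * cnorm C c \<le> 1 * cnorm C c"
    using cnorm_cstar[OF c(1)] c by (simp add: power2_eq_square)
  then show ?thesis using cnorm_nonneg[OF c(1)] by (cases "cnorm C c = 0") simp_all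
qed

text \<open>The element sought is \<open>1 - sqrt (1 - a\<^sup>2)\<close>, which lies in \<open>C\<close> even if \<open>C\<close> has no unit. It is obtained as
  the fixed point of \<open>y \<mapsto> (a\<^sup>2 + y\<^sup>2) / 2\<close>, a contraction of a ball of radius less than \<open>1\<close>. Self-adjointness and
  commutation with \<open>a\<close> hold for all iterates and pass to the limit.\<close>

lemma ex_one_minus_sqrt:
  assumes a: "a \<in> carrier C" "adj C a = a" and less: "cnorm C a < 1"
  obtains y where "y \<in> carrier C" "adj C y = y" "a \<otimes> y = y \<otimes> a" "y \<oplus> y = a \<otimes> a \<oplus> y \<otimes> y"
proof -
  define F where "F y = (1/2) \<odot> (a \<otimes> a \<oplus> y \<otimes> y)" for y
  \<comment> \<open>the scalar fixed point with \<open>\<parallel>a\<parallel>\<close> in place of \<open>a\<close>: radius of an invariant ball and contraction constant\<close>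
  define r where "r = 1 - sqrt (1 - (cnorm C a)\<^sup>2)"
  have a2: "(cnorm C a)\<^sup>2 < 1"
    using less cnorm_nonneg[OF a(1)] by (simp add: power_less_one_iff abs_square_less_1)
  then have "(1 - r)\<^sup>2 = 1 - (cnorm C a)\<^sup>2" by (simp add: r_def)
  then have rr: "(cnorm C a)\<^sup>2 + r\<^sup>2 = 2 * r" by (simp add: power2_eq_square algebra_simps)
  have r: "0 \<le> r" "r < 1" using a2 by (simp_all add: r_def)
  have FC: "F y \<in> carrier C" if "y \<in> carrier C" for y
    using that a by (simp add: F_def alg_simps)
  define u where "u n = (F ^^ n) \<zero>" for n
  have u_Suc: "u (Suc n) = F (u n)" and u_0: "u 0 = \<zero>" for n by (simp_all add: u_def)
  have uC: "u n \<in> carrier C" for n by (induction n) (simp_all add: u_Suc u_0 FC)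
  have Fle: "cnorm C (F y) \<le> r" if "y \<in> carrier C" "cnorm C y \<le> r" for y
  proof -
    have "cnorm C (a \<otimes> a \<oplus> y \<otimes> y) \<le> cnorm C a * cnorm C a + cnorm C y * cnorm C y"
      using that(1) a by (intro order.trans[OF cnorm_triangle] add_mono cnorm_mult) (simp_all add: mult_closed)
    also have "cnorm C y * cnorm C y \<le> r * r"
      using that cnorm_nonneg r by (intro mult_mono) auto
    finally show ?thesis
      using that(1) a rr by (simp add: F_def cnorm_smult mult_closed power2_eq_square)
  qed
  have ule: "cnorm C (u n) \<le> r" for n
    by (induction n) (simp_all add: u_Suc u_0 cnorm_0 r Fle uC)
  have Fcontr: "cnorm C (F y \<ominus> F z) \<le> r * cnorm C (y \<ominus> z)"
    if y: "y \<in> carrier C" "cnorm C y \<le> r" and z: "z \<in> carrier C" "cnorm C z \<le> r" for y z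
  proof -
    have "F y \<ominus> F z = (1/2) \<odot> ((y \<ominus> z) \<otimes> y \<oplus> z \<otimes> (y \<ominus> z))"
      using a y z minus_eq_0_iff[of "a \<otimes> a" "a \<otimes> a"]
      by (simp add: F_def minus_smult_distr minus_add_swap minus_mult_split mult_closed minus_closed')
    moreover have "cnorm C ((y \<ominus> z) \<otimes> y \<oplus> z \<otimes> (y \<ominus> z))
        \<le> cnorm C (y \<ominus> z) * cnorm C y + cnorm C z * cnorm C (y \<ominus> z)"
      using y z by (intro order.trans[OF cnorm_triangle] add_mono cnorm_mult)
        (simp_all add: mult_closed minus_closed')
    moreover have "\<dots> \<le> cnorm C (y \<ominus> z) * r + r * cnorm C (y \<ominus> z)"
      using y z by (intro add_mono mult_mono order.refl cnorm_nonneg r) (simp_all add: minus_closed')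
    ultimately show ?thesis using y z
      by (simp add: cnorm_smult mult_closed minus_closed')
  qed
  have dist: "cnorm C (u (n + k) \<ominus> u n) \<le> r ^ n" for n k
  proof (induction n)
    case 0
    then show ?case using ule[of k] r minus_smult[OF uC[of k] zero_closed]
      by (simp add: u_0 smult_zero uC)
  next
    case (Suc n)
    have "cnorm C (u (Suc n + k) \<ominus> u (Suc n)) \<le> r * cnorm C (u (n + k) \<ominus> u n)"
      by (simp add: u_Suc Fcontr uC ule)
    also have "\<dots> \<le> r * r ^ n" using Suc r(1) by (rule mult_left_mono)
    finally show ?case by simp
  qed
  have "\<exists>N. \<forall>m\<ge>N. \<forall>n\<ge>N. cnorm C (u m \<ominus> u n) < e" if e: "e > 0" for e
  proof -
    obtain N where N: "r ^ N < e" using real_arch_pow_inv[OF e r(2)] by blast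
    have le: "cnorm C (u m \<ominus> u n) \<le> r ^ N" if "N \<le> n" "n \<le> m" for m n
      using dist[of n "m - n"] power_decreasing[OF that(1) r(1)] that r by simp
    have "cnorm C (u m \<ominus> u n) < e" if "N \<le> m" "N \<le> n" for m n
    proof (cases "n \<le> m")
      case True
      then show ?thesis using le[of n m] that N by simp
    next
      case False
      then show ?thesis using le[of m n] that N cnorm_minus_commute[OF uC uC, of m n] by simp
    qed
    then show ?thesis by blast
  qed
  from complete[of u, OF uC this]
  obtain y where y: "y \<in> carrier C" and "(\<lambda>n. cnorm C (u n \<ominus> y)) \<longlonglongrightarrow> 0" by blast
  then have lim: "converges u y" using uC by (simp add: converges_def)
  have "converges (\<lambda>n. F (u n)) (F y)"
    unfolding F_def using a
    by (intro converges_smult converges_add converges_mult converges_const lim tendsto_const mult_closed) 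
  moreover have "converges (\<lambda>n. F (u n)) y"
    using lim LIMSEQ_Suc[of "\<lambda>n. cnorm C (u n \<ominus> y)"] FC uC by (simp add: converges_def flip: u_Suc)
  ultimately have Fy: "F y = y" by (rule converges_unique)
  show thesis
  proof (rule that[OF y])
    have "adj C (u n) = u n" for n
      by (induction n) (simp_all add: u_0 adj_0 u_Suc F_def uC a alg_simps)
    then show "adj C y = y" using converges_adj[OF lim] by (intro converges_unique[OF _ lim]) simp
    have "a \<otimes> u n = u n \<otimes> a" for n
    proof (induction n)
      case (Suc n)
      have "a \<otimes> (u n \<otimes> u n) = (u n \<otimes> u n) \<otimes> a"
        using a uC Suc by (metis mult_assoc)
      then show ?case using a uC by (simp add: u_Suc F_def alg_simps)
    qed (simp add: u_0 a mult_zero)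
    then have "converges (\<lambda>n. a \<otimes> u n) (y \<otimes> a)"
      using converges_mult[OF lim converges_const[OF a(1)]] by simp
    with converges_mult[OF converges_const[OF a(1)] lim] show "a \<otimes> y = y \<otimes> a"
      by (rule converges_unique)
    have "2 \<odot> F y = a \<otimes> a \<oplus> y \<otimes> y" using a y by (simp add: F_def smult_smult' mult_closed smult_1)
    then show "y \<oplus> y = a \<otimes> a \<oplus> y \<otimes> y"
      using smult_add_l[OF y, of 1 1] y by (simp add: Fy smult_1)
  qed
qed

end

text \<open>The relation \<open>2 y - y\<^sup>2 = a\<^sup>2\<close> of the preceding lemmas is algebraic, so a *-homomorphism carries the solution
  \<open>y\<close> for a self-adjoint \<open>a\<close> of norm less than \<open>1\<close> to a solution for \<open>f a\<close>, which forces \<open>\<parallel>f a\<parallel> \<le> 1\<close>. This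
  replaces the usual comparison of spectra. The general case follows by scaling and the C*-identity.\<close>

theorem star_hom_contractive:
  assumes "cstar_algebra C" "cstar_algebra D" and f: "f \<in> star_hom C D" and x: "x \<in> carrier C"
  shows "cnorm D (f x) \<le> cnorm C x"
proof -
  interpret C: cstar_algebra C by fact
  interpret D: cstar_algebra D by fact
  note h = star_homD[OF f]
  have 1: "cnorm D (f a) \<le> 1" if a: "a \<in> carrier C" "adj C a = a" "cnorm C a < 1" for a
  proof -
    obtain y where y: "y \<in> carrier C" "adj C y = y" "a \<otimes>\<^bsub>C\<^esub> y = y \<otimes>\<^bsub>C\<^esub> a"
        "y \<oplus>\<^bsub>C\<^esub> y = a \<otimes>\<^bsub>C\<^esub> a \<oplus>\<^bsub>C\<^esub> y \<otimes>\<^bsub>C\<^esub> y"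
      using C.ex_one_minus_sqrt[OF a] by blast
    have "f (y \<oplus>\<^bsub>C\<^esub> y) = f (a \<otimes>\<^bsub>C\<^esub> a \<oplus>\<^bsub>C\<^esub> y \<otimes>\<^bsub>C\<^esub> y)" "f (a \<otimes>\<^bsub>C\<^esub> y) = f (y \<otimes>\<^bsub>C\<^esub> a)"
        "f (adj C a) = f a" "f (adj C y) = f y"
      using y(2-4) a(2) by simp_all
    then show ?thesis
      using a(1) y(1) by (intro D.cnorm_le_1_if_square_complement[of "f a" "f y"]) (simp_all add: h C.mult_closed)
  qed
  have sa: "cnorm D (f a) \<le> cnorm C a" if a: "a \<in> carrier C" "adj C a = a" for a
  proof (rule dense_le)
    fix s assume "s < cnorm D (f a)"
    show "s \<le> cnorm C a"
    proof (rule ccontr)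
      assume "\<not> s \<le> cnorm C a"
      then have s: "cnorm C a < s" "0 < s" using C.cnorm_nonneg[OF a(1)] by auto
      let ?b = "complex_of_real (1 / s) \<odot>\<^bsub>C\<^esub> a"
      have "cnorm D (f ?b) \<le> 1"
        using a s by (intro 1) (simp_all add: C.a_smult_closed C.adj_smult C.cnorm_smult norm_divide)
      then have "cnorm D (f a) \<le> s"
        using a s by (simp add: h D.cnorm_smult norm_divide)
      with \<open>s < cnorm D (f a)\<close> show False by simp
    qed
  qed
  have "(cnorm D (f x))\<^sup>2 = cnorm D (f (adj C x \<otimes>\<^bsub>C\<^esub> x))"
    using x by (simp add: h C.adj_closed D.cnorm_cstar)
  also have "\<dots> \<le> (cnorm C x)\<^sup>2"
    using sa[of "adj C x \<otimes>\<^bsub>C\<^esub> x"] x C.cnorm_cstar[OF x]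
    by (simp add: C.adj_closed C.mult_closed C.adj_mult C.adj_adj)
  finally show ?thesis using C.cnorm_nonneg[OF x] by (rule power2_le_imp_le)
qed


section \<open>Approximately inner automorphisms\<close>

lemma star_hom_minus:
  assumes "cstar_algebra C" "cstar_algebra D" and f: "f \<in> star_hom C D"
    and x: "x \<in> carrier C" "y \<in> carrier C"
  shows "f (x \<ominus>\<^bsub>C\<^esub> y) = f x \<ominus>\<^bsub>D\<^esub> f y"
proof -
  interpret C: cstar_algebra C by fact
  interpret D: cstar_algebra D by fact
  show ?thesis using x by (simp add: C.minus_smult D.minus_smult C.a_smult_closed star_homD[OF f])
qed

context cstar_algebra
begin

text \<open>\<open>C\<close> sits in its unitization as the ideal of the pairs \<open>(c, 0)\<close>. Written there, inner automorphisms are honest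
  conjugations, and their composition laws follow from the monoid laws.\<close>

lemma inner_auto_conj:
  assumes u: "u \<in> unitaries C" and c: "c \<in> carrier C"
  shows "(inner_auto C u c, 0) = u \<otimes>\<^bsub>unitization C\<^esub> (c, 0) \<otimes>\<^bsub>unitization C\<^esub> uadj C u"
  using c by (cases u) (simp add: inner_auto_def unitization_simps)

lemma unitization_ideal_closed:
  assumes "u \<in> carrier (unitization C)" "v \<in> carrier (unitization C)" "c \<in> carrier C"
  shows "fst (u \<otimes>\<^bsub>unitization C\<^esub> (c, 0) \<otimes>\<^bsub>unitization C\<^esub> v) \<in> carrier C"
  using assms by (auto simp: unitization_simps alg_simps)

lemma inner_auto_closed:
  assumes "u \<in> unitaries C" "c \<in> carrier C" shows "inner_auto C u c \<in> carrier C"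
  using assms unitization_ideal_closed unitariesD(1,2)[OF assms(1)] by (simp add: inner_auto_def)

lemma inner_auto_star_hom:
  assumes u: "u \<in> unitaries C" shows "inner_auto C u \<in> star_hom C C"
proof -
  interpret U: monoid "unitization C" by (rule monoid_unitization)
  note uU = unitariesD[OF u]
  obtain x l where ul: "u = (x, l)" by (cases u)
  have x: "x \<in> carrier C" using uU(1) by (simp add: ul unitization_simps)
  have cU: "(c, 0) \<in> carrier (unitization C)" if "c \<in> carrier C" for c
    using that by (simp add: unitization_simps)
  have ex: "inner_auto C u c = (x \<otimes> c \<oplus> l \<odot> c) \<otimes> adj C x \<oplus> cnj l \<odot> (x \<otimes> c \<oplus> l \<odot> c)"
    if "c \<in> carrier C" for c
    using that x by (simp add: inner_auto_def ul unitization_simps mult_closed a_smult_closed adj_closed smult_0)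
  show ?thesis
    unfolding star_hom_def
  proof (intro CollectI conjI ballI allI)
    fix c d a assume c: "c \<in> carrier C"
    show "inner_auto C u c \<in> carrier C" by (rule inner_auto_closed[OF u c])
    show "inner_auto C u (a \<odot> c) = a \<odot> inner_auto C u c"
      using c x by (simp add: ex a_smult_closed mult_closed adj_closed smult_mult mult_smult
          smult_add_r smult_smult' mult_distl mult_ac)
    have "(inner_auto C u (adj C c), 0) = uadj C (inner_auto C u c, 0)"
      using c uU(1,2) by (simp add: inner_auto_conj u adj_closed uadj_mult uadj_uadj cU U.m_assoc
          unitization_simps(4)[of c 0, simplified, symmetric])
    then show "inner_auto C u (adj C c) = adj C (inner_auto C u c)" by (simp add: unitization_simps)
    assume d: "d \<in> carrier C"
    show "inner_auto C u (c \<oplus> d) = inner_auto C u c \<oplus> inner_auto C u d"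
    proof -
      define T where "T z = x \<otimes> z \<oplus> l \<odot> z" for z
      have T: "T z \<in> carrier C" if "z \<in> carrier C" for z
        using that x by (simp add: T_def a_smult_closed mult_closed)
      have "T (c \<oplus> d) = T c \<oplus> T d"
        using c d x by (simp add: T_def a_smult_closed mult_closed smult_add_r mult_distr a_ac)
      then show ?thesis
        using c d x by (simp add: ex[folded T_def] a_smult_closed mult_closed adj_closed smult_add_r
            mult_distl a_ac T)
    qed
    have "(inner_auto C u c, 0) \<otimes>\<^bsub>unitization C\<^esub> (inner_auto C u d, 0)
        = u \<otimes>\<^bsub>unitization C\<^esub> ((c, 0) \<otimes>\<^bsub>unitization C\<^esub> (uadj C u \<otimes>\<^bsub>unitization C\<^esub> u)
          \<otimes>\<^bsub>unitization C\<^esub> (d, 0)) \<otimes>\<^bsub>unitization C\<^esub> uadj C u"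
      using c d uU(1,2) by (simp add: inner_auto_conj u cU U.m_assoc)
    also have "\<dots> = (inner_auto C u (c \<otimes> d), 0)"
      using c d by (simp add: uU(3) cU inner_auto_conj u mult_closed)
        (simp add: unitization_simps smult_0 mult_closed)
    finally show "inner_auto C u (c \<otimes> d) = inner_auto C u c \<otimes> inner_auto C u d"
      using c d inner_auto_closed[OF u] by (simp add: unitization_simps smult_0 mult_closed)
  qed
qed

lemma inner_auto_comp:
  assumes u: "u \<in> unitaries C" and v: "v \<in> unitaries C" and c: "c \<in> carrier C"
  shows "inner_auto C u (inner_auto C v c) = inner_auto C (u \<otimes>\<^bsub>unitization C\<^esub> v) c"
proof -
  interpret U: monoid "unitization C" by (rule monoid_unitization)
  have "(c, 0) \<in> carrier (unitization C)" using c by (simp add: unitization_simps)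
  then have "(inner_auto C u (inner_auto C v c), 0) = (inner_auto C (u \<otimes>\<^bsub>unitization C\<^esub> v) c, 0 :: complex)"
    using c unitariesD(1,2)[OF u] unitariesD(1,2)[OF v]
    by (simp add: inner_auto_conj u v mult_unitary inner_auto_closed uadj_mult U.m_assoc)
  then show ?thesis by simp
qed

lemma inner_auto_one:
  assumes c: "c \<in> carrier C" shows "inner_auto C \<one>\<^bsub>unitization C\<^esub> c = c"
proof -
  have "(inner_auto C \<one>\<^bsub>unitization C\<^esub> c, 0 :: complex) = (c, 0)"
    using c by (simp add: inner_auto_conj one_unitary) (simp add: unitization_simps alg_simps mult_zero)
  then show ?thesis by simp
qed

lemma inner_auto_uadj:
  assumes "u \<in> unitaries C" "c \<in> carrier C"
  shows "inner_auto C (uadj C u) (inner_auto C u c) = c" "inner_auto C u (inner_auto C (uadj C u) c) = c"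
  using assms by (simp_all add: inner_auto_comp uadj_unitary unitariesD(3,4) inner_auto_one)

lemma inner_auto_star_auto:
  assumes u: "u \<in> unitaries C" shows "inner_auto C u \<in> star_auto C"
proof -
  have "bij_betw (inner_auto C u) (carrier C) (carrier C)"
    by (rule bij_betw_byWitness[where f' = "inner_auto C (uadj C u)"])
      (auto simp: inner_auto_uadj u uadj_unitary inner_auto_closed)
  moreover have "inner_auto C u \<in> extensional (carrier C)" by (simp add: inner_auto_def)
  ultimately show ?thesis
    using inner_auto_star_hom[OF u] by (simp add: star_auto_def Bij_def)
qed

lemma approx_Inn_iff:
  "\<theta> \<in> approx_Inn C \<longleftrightarrow> \<theta> \<in> star_auto C \<and> (\<forall>F \<epsilon>. finite F \<and> F \<subseteq> carrier C \<and> \<epsilon> > 0 \<longrightarrow>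
     (\<exists>u\<in>unitaries C. \<forall>x\<in>F. cnorm C (\<theta> x \<ominus> inner_auto C u x) < \<epsilon>))"
  by (simp add: approx_Inn_def Inn_def)

lemma approx_InnD:
  assumes "\<theta> \<in> approx_Inn C" "finite F" "F \<subseteq> carrier C" "\<epsilon> > 0"
  obtains u where "u \<in> unitaries C" "\<And>x. x \<in> F \<Longrightarrow> cnorm C (\<theta> x \<ominus> inner_auto C u x) < \<epsilon>"
proof -
  have "\<exists>u\<in>unitaries C. \<forall>x\<in>F. cnorm C (\<theta> x \<ominus> inner_auto C u x) < \<epsilon>"
    using assms(1)[unfolded approx_Inn_iff, THEN conjunct2, rule_format, of F \<epsilon>] assms(2-4) by simp
  then show thesis using that by meson
qed

text \<open>A *-endomorphism \<open>f\<close> extends to the unitization by acting on the first component. So conjugating an inner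
  automorphism by a *-automorphism gives an inner automorphism again.\<close>

lemma star_auto_unitary:
  assumes f: "f \<in> star_hom C C" and u: "(x, l) \<in> unitaries C"
  shows "(f x, l) \<in> unitaries C"
    and "c \<in> carrier C \<Longrightarrow> inner_auto C (f x, l) (f c) = f (inner_auto C (x, l) c)"
proof -
  note h = star_homD[OF f]
  have x: "x \<in> carrier C" using unitariesD(1)[OF u] by (simp add: unitization_simps)
  note cl = x mult_closed a_smult_closed adj_closed
  have C: "cstar_algebra C" by (rule cstar_algebra_axioms)
  have "f (adj C x \<otimes> x \<oplus> cnj l \<odot> x \<oplus> l \<odot> adj C x) = \<zero>" "f (x \<otimes> adj C x \<oplus> l \<odot> adj C x \<oplus> cnj l \<odot> x) = \<zero>"
    using unitariesD(3,4)[OF u] star_hom_zero[OF C C f] by (simp_all add: unitization_simps)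
  then show "(f x, l) \<in> unitaries C"
    using unitariesD(3,4)[OF u] by (simp add: unitaries_def unitization_simps h cl)
  show "inner_auto C (f x, l) (f c) = f (inner_auto C (x, l) c)" if "c \<in> carrier C"
    using that by (simp add: inner_auto_def unitization_simps h cl)
qed

end

lemma StarAutoGroup_simps:
  "carrier (StarAutoGroup C) = star_auto C"
  "\<lbrakk>f \<in> star_auto C; g \<in> star_auto C\<rbrakk> \<Longrightarrow> f \<otimes>\<^bsub>StarAutoGroup C\<^esub> g = compose (carrier C) f g"
  "\<one>\<^bsub>StarAutoGroup C\<^esub> = (\<lambda>x\<in>carrier C. x)"
  by (simp_all add: StarAutoGroup_def BijGroup_def star_auto_def)

text \<open>\<open>approx_Inn C\<close> is the closure of the normal subgroup of inner automorphisms for pointwise convergence in norm.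
  By contractivity, automorphisms do not increase distances, so an approximation by an inner automorphism survives
  composition with automorphisms on either side; each of the group laws is then obtained by choosing the finite set to
  be approximated on appropriately.\<close>

theorem normal_approx_Inn:
  assumes C: "cstar_algebra C"
  shows "approx_Inn C \<lhd> StarAutoGroup C"
proof -
  interpret C: cstar_algebra C by fact
  interpret G: group "StarAutoGroup C" by (rule group_StarAutoGroup[OF C])
  let ?G = "StarAutoGroup C"
  have hom: "f \<in> star_hom C C" if "f \<in> star_auto C" for f using that by (simp add: star_auto_def)
  have cl: "f x \<in> carrier C" if "f \<in> star_auto C" "x \<in> carrier C" for f x
    using star_homD(1)[OF hom[OF that(1)] that(2)] .
  have mult: "(f \<otimes>\<^bsub>?G\<^esub> g) x = f (g x)" if "f \<in> star_auto C" "g \<in> star_auto C" "x \<in> carrier C" for f g x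
    using that by (simp add: StarAutoGroup_simps compose_eq)
  have inv_cl: "inv\<^bsub>?G\<^esub> f \<in> star_auto C" if "f \<in> star_auto C" for f
    using G.inv_closed[of f] that by (simp add: StarAutoGroup_simps)
  have inv: "f ((inv\<^bsub>?G\<^esub> f) x) = x" if "f \<in> star_auto C" "x \<in> carrier C" for f x
    using G.r_inv[of f] mult[OF that(1) inv_cl[OF that(1)] that(2)] that
    by (simp add: StarAutoGroup_simps)
  have contr: "cnorm C (f x \<ominus>\<^bsub>C\<^esub> f y) \<le> cnorm C (x \<ominus>\<^bsub>C\<^esub> y)"
    if "f \<in> star_auto C" "x \<in> carrier C" "y \<in> carrier C" for f x y
    using star_hom_contractive[OF C C hom[OF that(1)] C.minus_closed'[OF that(2,3)]]
      star_hom_minus[OF C C hom[OF that(1)] that(2,3)] by simp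
  have mem: "\<theta> \<in> star_auto C" if "\<theta> \<in> approx_Inn C" for \<theta> using that by (simp add: C.approx_Inn_iff)
  have "subgroup (approx_Inn C) ?G"
  proof (rule G.subgroupI)
    show "approx_Inn C \<subseteq> carrier ?G" using mem by (auto simp: StarAutoGroup_simps)
    have "\<one>\<^bsub>?G\<^esub> \<in> approx_Inn C"
      unfolding C.approx_Inn_iff
    proof (intro conjI allI impI bexI[OF _ C.one_unitary] ballI)
      show "\<one>\<^bsub>?G\<^esub> \<in> star_auto C" using G.one_closed by (simp add: StarAutoGroup_simps)
      fix F x and \<epsilon> :: real assume "finite F \<and> F \<subseteq> carrier C \<and> \<epsilon> > 0" "x \<in> F"
      then show "cnorm C (\<one>\<^bsub>?G\<^esub> x \<ominus>\<^bsub>C\<^esub> inner_auto C \<one>\<^bsub>unitization C\<^esub> x) < \<epsilon>"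
        using C.minus_eq_0_iff[of x x] by (auto simp: StarAutoGroup_simps C.inner_auto_one C.cnorm_0)
    qed
    then show "approx_Inn C \<noteq> {}" by blast
  next
    fix \<theta> assume \<theta>: "\<theta> \<in> approx_Inn C"
    note \<theta>A = mem[OF \<theta>]
    show "inv\<^bsub>?G\<^esub> \<theta> \<in> approx_Inn C"
      unfolding C.approx_Inn_iff
    proof (intro conjI allI impI)
      show "inv\<^bsub>?G\<^esub> \<theta> \<in> star_auto C" using inv_cl[OF \<theta>A] .
      fix F and \<epsilon> :: real assume F: "finite F \<and> F \<subseteq> carrier C \<and> \<epsilon> > 0"
      then have "finite ((inv\<^bsub>?G\<^esub> \<theta>) ` F)" "(inv\<^bsub>?G\<^esub> \<theta>) ` F \<subseteq> carrier C" "\<epsilon> > 0"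
        using cl[OF inv_cl[OF \<theta>A]] by auto
      with \<theta> obtain u where u: "u \<in> unitaries C"
        and *: "\<And>y. y \<in> (inv\<^bsub>?G\<^esub> \<theta>) ` F \<Longrightarrow> cnorm C (\<theta> y \<ominus>\<^bsub>C\<^esub> inner_auto C u y) < \<epsilon>"
        by (rule C.approx_InnD) blast
      show "\<exists>u\<in>unitaries C. \<forall>x\<in>F. cnorm C ((inv\<^bsub>?G\<^esub> \<theta>) x \<ominus>\<^bsub>C\<^esub> inner_auto C u x) < \<epsilon>"
      proof (intro bexI[OF _ C.uadj_unitary[OF u]] ballI)
        fix x assume x: "x \<in> F"
        then have xC: "x \<in> carrier C" using F by blast
        let ?y = "(inv\<^bsub>?G\<^esub> \<theta>) x"
        have y: "?y \<in> carrier C" using cl[OF inv_cl[OF \<theta>A] xC] .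
        have "cnorm C (?y \<ominus>\<^bsub>C\<^esub> inner_auto C (uadj C u) x)
            = cnorm C (inner_auto C (uadj C u) (inner_auto C u ?y) \<ominus>\<^bsub>C\<^esub> inner_auto C (uadj C u) x)"
          using C.inner_auto_uadj(1)[OF u y] by simp
        also have "\<dots> \<le> cnorm C (inner_auto C u ?y \<ominus>\<^bsub>C\<^esub> x)"
          using contr C.inner_auto_star_auto C.uadj_unitary u C.inner_auto_closed y xC by blast
        also have "\<dots> = cnorm C (\<theta> ?y \<ominus>\<^bsub>C\<^esub> inner_auto C u ?y)"
          using C.cnorm_minus_commute[OF C.inner_auto_closed[OF u y] xC] inv[OF \<theta>A xC] by simp
        also have "\<dots> < \<epsilon>" using * x by blast
        finally show "cnorm C (?y \<ominus>\<^bsub>C\<^esub> inner_auto C (uadj C u) x) < \<epsilon>" .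
      qed
    qed
  next
    fix \<theta> \<eta> assume \<theta>: "\<theta> \<in> approx_Inn C" and \<eta>: "\<eta> \<in> approx_Inn C"
    note A = mem[OF \<theta>] mem[OF \<eta>]
    show "\<theta> \<otimes>\<^bsub>?G\<^esub> \<eta> \<in> approx_Inn C"
      unfolding C.approx_Inn_iff
    proof (intro conjI allI impI)
      show "\<theta> \<otimes>\<^bsub>?G\<^esub> \<eta> \<in> star_auto C" using G.m_closed[of \<theta> \<eta>] A by (simp add: StarAutoGroup_simps(1))
      fix F and \<epsilon> :: real assume F: "finite F \<and> F \<subseteq> carrier C \<and> \<epsilon> > 0"
      then have "finite F" "F \<subseteq> carrier C" "\<epsilon> / 2 > 0" by auto
      with \<eta> obtain v where v: "v \<in> unitaries C"
        and *: "\<And>x. x \<in> F \<Longrightarrow> cnorm C (\<eta> x \<ominus>\<^bsub>C\<^esub> inner_auto C v x) < \<epsilon> / 2"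
        by (rule C.approx_InnD) blast
      have "finite (\<eta> ` F)" "\<eta> ` F \<subseteq> carrier C" "\<epsilon> / 2 > 0" using F cl[OF A(2)] by auto
      with \<theta> obtain u where u: "u \<in> unitaries C"
        and **: "\<And>y. y \<in> \<eta> ` F \<Longrightarrow> cnorm C (\<theta> y \<ominus>\<^bsub>C\<^esub> inner_auto C u y) < \<epsilon> / 2"
        by (rule C.approx_InnD) blast
      show "\<exists>u\<in>unitaries C. \<forall>x\<in>F. cnorm C ((\<theta> \<otimes>\<^bsub>?G\<^esub> \<eta>) x \<ominus>\<^bsub>C\<^esub> inner_auto C u x) < \<epsilon>"
      proof (intro bexI[OF _ C.mult_unitary[OF u v]] ballI)
        fix x assume x: "x \<in> F"
        then have xC: "x \<in> carrier C" using F by blast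
        note c = cl[OF A(2) xC] C.inner_auto_closed[OF v xC]
        have "cnorm C (inner_auto C u (\<eta> x) \<ominus>\<^bsub>C\<^esub> inner_auto C u (inner_auto C v x))
            \<le> cnorm C (\<eta> x \<ominus>\<^bsub>C\<^esub> inner_auto C v x)"
          using contr C.inner_auto_star_auto[OF u] c by blast
        moreover have "cnorm C (\<theta> (\<eta> x) \<ominus>\<^bsub>C\<^esub> inner_auto C u (inner_auto C v x))
            \<le> cnorm C (\<theta> (\<eta> x) \<ominus>\<^bsub>C\<^esub> inner_auto C u (\<eta> x))
              + cnorm C (inner_auto C u (\<eta> x) \<ominus>\<^bsub>C\<^esub> inner_auto C u (inner_auto C v x))"
          using c cl[OF A(1)] C.inner_auto_closed[OF u] by (intro C.cnorm_dist_triangle) auto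
        moreover have "cnorm C (\<theta> (\<eta> x) \<ominus>\<^bsub>C\<^esub> inner_auto C u (\<eta> x)) < \<epsilon> / 2" using ** x by blast
        ultimately show "cnorm C ((\<theta> \<otimes>\<^bsub>?G\<^esub> \<eta>) x \<ominus>\<^bsub>C\<^esub> inner_auto C (u \<otimes>\<^bsub>unitization C\<^esub> v) x) < \<epsilon>"
          using *[OF x] by (simp add: mult A xC flip: C.inner_auto_comp[OF u v xC])
      qed
    qed
  qed
  moreover have "\<phi> \<otimes>\<^bsub>?G\<^esub> \<theta> \<otimes>\<^bsub>?G\<^esub> inv\<^bsub>?G\<^esub> \<phi> \<in> approx_Inn C"
    if \<phi>: "\<phi> \<in> carrier ?G" and \<theta>: "\<theta> \<in> approx_Inn C" for \<phi> \<theta>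
    unfolding C.approx_Inn_iff
  proof (intro conjI allI impI)
    have \<phi>A: "\<phi> \<in> star_auto C" using \<phi> by (simp add: StarAutoGroup_simps)
    note A = \<phi>A mem[OF \<theta>] inv_cl[OF \<phi>A]
    have A': "\<phi> \<otimes>\<^bsub>?G\<^esub> \<theta> \<in> star_auto C"
      using G.m_closed[of \<phi> \<theta>] A by (simp add: StarAutoGroup_simps(1))
    show "\<phi> \<otimes>\<^bsub>?G\<^esub> \<theta> \<otimes>\<^bsub>?G\<^esub> inv\<^bsub>?G\<^esub> \<phi> \<in> star_auto C"
      using G.m_closed[of "\<phi> \<otimes>\<^bsub>?G\<^esub> \<theta>" "inv\<^bsub>?G\<^esub> \<phi>"] A A' by (simp add: StarAutoGroup_simps(1))
    fix F and \<epsilon> :: real assume F: "finite F \<and> F \<subseteq> carrier C \<and> \<epsilon> > 0"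
    then have "finite ((inv\<^bsub>?G\<^esub> \<phi>) ` F)" "(inv\<^bsub>?G\<^esub> \<phi>) ` F \<subseteq> carrier C" "\<epsilon> > 0"
      using cl[OF A(3)] by auto
    with \<theta> obtain u where u: "u \<in> unitaries C"
      and *: "\<And>y. y \<in> (inv\<^bsub>?G\<^esub> \<phi>) ` F \<Longrightarrow> cnorm C (\<theta> y \<ominus>\<^bsub>C\<^esub> inner_auto C u y) < \<epsilon>"
      by (rule C.approx_InnD) blast
    obtain z l where zl: "u = (z, l)" by (cases u)
    note f = C.star_auto_unitary[OF hom[OF \<phi>A] u[unfolded zl]]
    show "\<exists>u\<in>unitaries C. \<forall>x\<in>F. cnorm C ((\<phi> \<otimes>\<^bsub>?G\<^esub> \<theta> \<otimes>\<^bsub>?G\<^esub> inv\<^bsub>?G\<^esub> \<phi>) x \<ominus>\<^bsub>C\<^esub> inner_auto C u x) < \<epsilon>"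
    proof (intro bexI[OF _ f(1)] ballI)
      fix x assume x: "x \<in> F"
      then have xC: "x \<in> carrier C" using F by blast
      let ?y = "(inv\<^bsub>?G\<^esub> \<phi>) x"
      have y: "?y \<in> carrier C" using cl[OF A(3) xC] .
      have "cnorm C (\<phi> (\<theta> ?y) \<ominus>\<^bsub>C\<^esub> inner_auto C (\<phi> z, l) x)
          = cnorm C (\<phi> (\<theta> ?y) \<ominus>\<^bsub>C\<^esub> \<phi> (inner_auto C u ?y))"
        using f(2)[OF y] inv[OF \<phi>A xC] zl by simp
      also have "\<dots> \<le> cnorm C (\<theta> ?y \<ominus>\<^bsub>C\<^esub> inner_auto C u ?y)"
        using contr[OF \<phi>A cl[OF A(2) y] C.inner_auto_closed[OF u y]] .
      also have "\<dots> < \<epsilon>" using * x by blast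
      finally show "cnorm C ((\<phi> \<otimes>\<^bsub>?G\<^esub> \<theta> \<otimes>\<^bsub>?G\<^esub> inv\<^bsub>?G\<^esub> \<phi>) x \<ominus>\<^bsub>C\<^esub> inner_auto C (\<phi> z, l) x) < \<epsilon>"
        by (simp add: mult A A' xC y)
    qed
  qed
  ultimately show ?thesis by (simp add: G.normal_inv_iff)
qed


section \<open>The Hilbert space of square-summable families\<close>

text \<open>The inner product is the real one, \<open>Re \<langle>x, y\<rangle>\<close>, so that the space is an instance of the class of real inner
  product spaces. The complex structure returns below as the operators \<open>cscale\<close>.\<close>

typedef 'i ell2 = "{x :: 'i \<Rightarrow> complex. (\<lambda>i. (cmod (x i))\<^sup>2) summable_on UNIV}"
  morphisms coord Abs_ell2
  by (rule exI[of _ "\<lambda>_. 0"]) simp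

setup_lifting type_definition_ell2

lemma square_summable_iff_bounded:
  fixes x :: "'i \<Rightarrow> complex"
  shows "(\<lambda>i. (cmod (x i))\<^sup>2) summable_on UNIV \<longleftrightarrow> (\<exists>B. \<forall>F. finite F \<longrightarrow> (\<Sum>i\<in>F. (cmod (x i))\<^sup>2) \<le> B)"
proof
  assume "(\<lambda>i. (cmod (x i))\<^sup>2) summable_on UNIV"
  then show "\<exists>B. \<forall>F. finite F \<longrightarrow> (\<Sum>i\<in>F. (cmod (x i))\<^sup>2) \<le> B"
    using finite_sum_le_infsum[of "\<lambda>i. (cmod (x i))\<^sup>2" UNIV] by auto
next
  assume "\<exists>B. \<forall>F. finite F \<longrightarrow> (\<Sum>i\<in>F. (cmod (x i))\<^sup>2) \<le> B"
  then obtain B where "\<And>F. finite F \<Longrightarrow> (\<Sum>i\<in>F. (cmod (x i))\<^sup>2) \<le> B" by blast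
  then show "(\<lambda>i. (cmod (x i))\<^sup>2) summable_on UNIV"
    by (intro nonneg_bdd_above_summable_on bdd_aboveI2[where M = B]) auto
qed

lemma square_summable_add:
  fixes x y :: "'i \<Rightarrow> complex"
  assumes "(\<lambda>i. (cmod (x i))\<^sup>2) summable_on UNIV" "(\<lambda>i. (cmod (y i))\<^sup>2) summable_on UNIV"
  shows "(\<lambda>i. (cmod (x i + y i))\<^sup>2) summable_on UNIV"
proof (rule summable_on_comparison_test)
  show "(\<lambda>i. 2 * (cmod (x i))\<^sup>2 + 2 * (cmod (y i))\<^sup>2) summable_on UNIV"
    by (intro summable_on_add summable_on_cmult_right assms)
  fix i
  have "(cmod (x i + y i))\<^sup>2 \<le> (cmod (x i) + cmod (y i))\<^sup>2"
    by (simp add: norm_triangle_ineq power_mono)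
  also have "\<dots> \<le> 2 * (cmod (x i))\<^sup>2 + 2 * (cmod (y i))\<^sup>2"
    using sum_squares_bound[of "cmod (x i)" "cmod (y i)"] by (simp add: power2_sum)
  finally show "(cmod (x i + y i))\<^sup>2 \<le> 2 * (cmod (x i))\<^sup>2 + 2 * (cmod (y i))\<^sup>2" .
qed simp

lemma square_summable_mult:
  fixes x :: "'i \<Rightarrow> complex"
  assumes "(\<lambda>i. (cmod (x i))\<^sup>2) summable_on UNIV"
  shows "(\<lambda>i. (cmod (a * x i))\<^sup>2) summable_on UNIV"
  using summable_on_cmult_right[OF assms, of "(cmod a)\<^sup>2"] by (simp add: norm_mult power_mult_distrib)

instantiation ell2 :: (type) real_vector
begin

lift_definition zero_ell2 :: "'a ell2" is "\<lambda>_. 0" by simp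
lift_definition plus_ell2 :: "'a ell2 \<Rightarrow> 'a ell2 \<Rightarrow> 'a ell2" is "\<lambda>x y i. x i + y i"
  by (rule square_summable_add)
lift_definition uminus_ell2 :: "'a ell2 \<Rightarrow> 'a ell2" is "\<lambda>x i. - x i" by simp
lift_definition minus_ell2 :: "'a ell2 \<Rightarrow> 'a ell2 \<Rightarrow> 'a ell2" is "\<lambda>x y i. x i - y i"
  using square_summable_add[of _ "\<lambda>i. - _ i"] by simp
lift_definition scaleR_ell2 :: "real \<Rightarrow> 'a ell2 \<Rightarrow> 'a ell2" is "\<lambda>r x i. r *\<^sub>R x i"
  by (simp add: scaleR_conv_of_real square_summable_mult)

instance
proof
  fix x y z :: "'a ell2" and r s :: real
  show "x + y + z = x + (y + z)" by transfer (simp add: algebra_simps)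
  show "x + y = y + x" by transfer (simp add: algebra_simps)
  show "0 + x = x" by transfer simp
  show "- x + x = 0" by transfer simp
  show "x - y = x + - y" by transfer simp
  show "r *\<^sub>R (x + y) = r *\<^sub>R x + r *\<^sub>R y" by transfer (simp add: algebra_simps)
  show "(r + s) *\<^sub>R x = r *\<^sub>R x + s *\<^sub>R x" by transfer (simp add: algebra_simps)
  show "r *\<^sub>R s *\<^sub>R x = (r * s) *\<^sub>R x" by transfer simp
  show "1 *\<^sub>R x = x" by transfer simp
qed

end

instantiation ell2 :: (type) real_inner
begin

lift_definition inner_ell2 :: "'a ell2 \<Rightarrow> 'a ell2 \<Rightarrow> real" is "\<lambda>x y. \<Sum>\<^sub>\<infinity>i. x i \<bullet> y i" .
definition norm_ell2 :: "'a ell2 \<Rightarrow> real" where "norm_ell2 x = sqrt (x \<bullet> x)"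
definition sgn_ell2 :: "'a ell2 \<Rightarrow> 'a ell2" where "sgn_ell2 x = x /\<^sub>R norm x"
definition dist_ell2 :: "'a ell2 \<Rightarrow> 'a ell2 \<Rightarrow> real" where "dist_ell2 x y = norm (x - y)"
definition uniformity_ell2 :: "('a ell2 \<times> 'a ell2) filter" where
  "uniformity_ell2 = (INF e\<in>{0 <..}. principal {(x, y). dist x y < e})"
definition open_ell2 :: "'a ell2 set \<Rightarrow> bool" where
  "open_ell2 U = (\<forall>x\<in>U. \<forall>\<^sub>F (x', y) in uniformity. x' = x \<longrightarrow> y \<in> U)"

lemma summable_inner:
  fixes x y :: "'i \<Rightarrow> complex"
  assumes "(\<lambda>i. (cmod (x i))\<^sup>2) summable_on UNIV" "(\<lambda>i. (cmod (y i))\<^sup>2) summable_on UNIV"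
  shows "(\<lambda>i. x i \<bullet> y i) summable_on UNIV"
proof -
  have "(\<lambda>i. (1/2) * ((cmod (x i + y i))\<^sup>2) + (- 1/2) * (cmod (x i))\<^sup>2 + (- 1/2) * (cmod (y i))\<^sup>2) summable_on UNIV"
    by (intro summable_on_add summable_on_cmult_right square_summable_add assms)
  moreover have "(1/2) * ((cmod (a + b))\<^sup>2) + (- 1/2) * (cmod a)\<^sup>2 + (- 1/2) * (cmod b)\<^sup>2 = a \<bullet> b" for a b :: complex
    by (simp add: power2_norm_eq_inner inner_add inner_commute[of b a] field_simps)
  ultimately show ?thesis by simp
qed

instance
proof
  fix x y z :: "'a ell2" and r s :: real
  show "x \<bullet> y = y \<bullet> x" by transfer (simp add: inner_commute)
  show "(x + y) \<bullet> z = x \<bullet> z + y \<bullet> z"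
    by transfer (simp add: inner_add_left infsum_add summable_inner)
  show "(r *\<^sub>R x) \<bullet> y = r * (x \<bullet> y)"
    by transfer (simp add: infsum_cmult_right')
  show "0 \<le> x \<bullet> x" by transfer (simp add: infsum_nonneg)
  show "x \<bullet> x = 0 \<longleftrightarrow> x = 0"
  proof
    assume "x \<bullet> x = 0"
    then show "x = 0"
    proof transfer
      fix x :: "'a \<Rightarrow> complex"
      assume x: "(\<lambda>i. (cmod (x i))\<^sup>2) summable_on UNIV" and 0: "(\<Sum>\<^sub>\<infinity>i. x i \<bullet> x i) = 0"
      have "x i \<bullet> x i = 0" for i
        using nonneg_infsum_le_0D[of "\<lambda>i. x i \<bullet> x i" UNIV i] summable_inner[OF x x] 0 by simp
      then show "x = (\<lambda>_. 0)" by auto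
    qed
  qed (transfer, simp)
qed (rule sgn_ell2_def dist_ell2_def uniformity_ell2_def open_ell2_def norm_ell2_def)+

end

lemma coord_simps [simp]:
  "coord (x + y) i = coord x i + coord y i" "coord (x - y) i = coord x i - coord y i"
  "coord (r *\<^sub>R x) i = r *\<^sub>R coord x i" "coord 0 i = 0" "coord (- x) i = - coord x i"
  by (transfer, simp)+

lemma ell2_eqI: "(\<And>i. coord x i = coord y i) \<Longrightarrow> x = y"
  by transfer auto

lemma sum_coord_le_norm:
  assumes "finite F" shows "(\<Sum>i\<in>F. (cmod (coord x i))\<^sup>2) \<le> (norm x)\<^sup>2"
  unfolding power2_norm_eq_inner using assms
proof transfer
  fix F :: "'a set" and x :: "'a \<Rightarrow> complex"
  assume x: "(\<lambda>i. (cmod (x i))\<^sup>2) summable_on UNIV" and F: "finite F"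
  show "(\<Sum>i\<in>F. x i \<bullet> x i) \<le> (\<Sum>\<^sub>\<infinity>i. x i \<bullet> x i)"
    using summable_inner[OF x x] F by (intro finite_sum_le_infsum) auto
qed

lemma norm_ell2_le:
  assumes "\<And>F. finite F \<Longrightarrow> (\<Sum>i\<in>F. (cmod (coord x i))\<^sup>2) \<le> B\<^sup>2" and "0 \<le> B"
  shows "norm x \<le> B"
proof -
  have "x \<bullet> x \<le> B\<^sup>2"
    using assms(1)
  proof transfer
    fix x :: "'a \<Rightarrow> complex" and B :: real
    assume x: "(\<lambda>i. (cmod (x i))\<^sup>2) summable_on UNIV"
      and le: "\<And>F. finite F \<Longrightarrow> (\<Sum>i\<in>F. (cmod (x i))\<^sup>2) \<le> B\<^sup>2"
    show "(\<Sum>\<^sub>\<infinity>i. x i \<bullet> x i) \<le> B\<^sup>2"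
      using summable_inner[OF x x] le by (intro infsum_le_finite_sums) (auto simp: power2_norm_eq_inner)
  qed
  then show ?thesis unfolding norm_eq_sqrt_inner using assms(2) by (intro real_le_lsqrt) auto
qed

lemma cmod_coord_le: "cmod (coord x i) \<le> norm x"
  using sum_coord_le_norm[of "{i}" x] by (simp add: power2_le_imp_le[OF _ norm_ge_zero])

text \<open>A Cauchy sequence converges in each coordinate, and the Cauchy estimate, which bounds every finite partial sum of
  squares, passes to the coordinatewise limit.\<close>

instance ell2 :: (type) banach
proof
  fix X :: "nat \<Rightarrow> 'a ell2" assume X: "Cauchy X"
  have "Cauchy (\<lambda>n. coord (X n) i)" for i
  proof (rule CauchyI)
    fix e :: real assume "e > 0"
    then obtain M where M: "\<forall>m\<ge>M. \<forall>n\<ge>M. norm (X m - X n) < e" using CauchyD[OF X] by blast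
    have "norm (coord (X m) i - coord (X n) i) < e" if "m \<ge> M" "n \<ge> M" for m n
      using le_less_trans[OF cmod_coord_le[of "X m - X n" i]] M that by auto
    then show "\<exists>M. \<forall>m\<ge>M. \<forall>n\<ge>M. norm (coord (X m) i - coord (X n) i) < e" by blast
  qed
  then have "\<forall>i. \<exists>l. (\<lambda>n. coord (X n) i) \<longlonglongrightarrow> l"
    using Cauchy_convergent convergent_def by blast
  then obtain l where l: "\<And>i. (\<lambda>n. coord (X n) i) \<longlonglongrightarrow> l i" by metis
  have le: "(\<Sum>i\<in>F. (cmod (coord (X n) i - l i))\<^sup>2) \<le> e\<^sup>2"
    if e: "\<And>m. m \<ge> M \<Longrightarrow> norm (X n - X m) \<le> e" and "finite F" for F n M e
  proof (rule LIMSEQ_le_const2)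
    show "(\<lambda>m. \<Sum>i\<in>F. (cmod (coord (X n) i - coord (X m) i))\<^sup>2)
        \<longlonglongrightarrow> (\<Sum>i\<in>F. (cmod (coord (X n) i - l i))\<^sup>2)"
      by (intro tendsto_intros l)
    have "(\<Sum>i\<in>F. (cmod (coord (X n) i - coord (X m) i))\<^sup>2) \<le> e\<^sup>2" if "m \<ge> M" for m
    proof -
      have "(\<Sum>i\<in>F. (cmod (coord (X n) i - coord (X m) i))\<^sup>2) \<le> (norm (X n - X m))\<^sup>2"
        using sum_coord_le_norm[OF \<open>finite F\<close>, of "X n - X m"] by simp
      also have "\<dots> \<le> e\<^sup>2" using e[OF that] by (simp add: power_mono)
      finally show ?thesis .
    qed
    then show "\<exists>M. \<forall>m\<ge>M. (\<Sum>i\<in>F. (cmod (coord (X n) i - coord (X m) i))\<^sup>2) \<le> e\<^sup>2" by blast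
  qed
  obtain M where M: "\<And>m. m \<ge> M \<Longrightarrow> norm (X M - X m) \<le> 1"
    using CauchyD[OF X, of 1] by (auto intro: less_imp_le)
  have "(\<lambda>i. (cmod (coord (X M) i - l i))\<^sup>2) summable_on UNIV"
    using le[OF M] square_summable_iff_bounded[of "\<lambda>i. coord (X M) i - l i"] by blast
  moreover have "(\<lambda>i. (cmod (coord (X M) i))\<^sup>2) summable_on UNIV" using coord by auto
  ultimately have "(\<lambda>i. (cmod (coord (X M) i + (- 1) * (coord (X M) i - l i)))\<^sup>2) summable_on UNIV"
    by (intro square_summable_add square_summable_mult)
  then have L: "coord (Abs_ell2 l) = l" by (intro Abs_ell2_inverse) simp
  have "X \<longlonglongrightarrow> Abs_ell2 l"
  proof (rule LIMSEQ_I)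
    fix r :: real assume r: "0 < r"
    then obtain M where M: "\<forall>m\<ge>M. \<forall>n\<ge>M. norm (X m - X n) < r / 2" using CauchyD[OF X, of "r / 2"] by auto
    have "norm (X n - Abs_ell2 l) \<le> r / 2" if "n \<ge> M" for n
      using le[of M n "r / 2"] M that r by (intro norm_ell2_le) (auto simp: L intro: less_imp_le)
    then show "\<exists>no. \<forall>n\<ge>no. norm (X n - Abs_ell2 l) < r" using r by force
  qed
  then show "convergent X" by (auto simp: convergent_def)
qed

section \<open>The C*-algebra of bounded operators\<close>

lift_definition cscale :: "complex \<Rightarrow> 'i ell2 \<Rightarrow> 'i ell2" is "\<lambda>a x i. a * x i"
  by (rule square_summable_mult)

lemma coord_cscale [simp]: "coord (cscale a x) i = a * coord x i"
  by transfer simp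

lemma inner_cscale: "cscale a x \<bullet> y = x \<bullet> cscale (cnj a) y"
  by transfer (simp add: inner_complex_def algebra_simps)

lemma norm_cscale: "norm (cscale a x) = cmod a * norm x"
proof -
  have "cscale (cnj a) (cscale a x) = (cmod a)\<^sup>2 *\<^sub>R x"
    by (rule ell2_eqI) (simp add: scaleR_conv_of_real complex_norm_square mult_ac del: of_real_power)
  then have "(norm (cscale a x))\<^sup>2 = (cmod a * norm x)\<^sup>2"
    by (simp add: power2_norm_eq_inner inner_cscale power_mult_distrib)
  then show ?thesis by simp
qed

lift_definition scalar :: "complex \<Rightarrow> 'i ell2 \<Rightarrow>\<^sub>L 'i ell2" is cscale
proof (rule bounded_linear_intro)
  fix a :: complex and x y :: "'i ell2" and r
  show "cscale a (x + y) = cscale a x + cscale a y" by (rule ell2_eqI) (simp add: algebra_simps)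
  show "cscale a (r *\<^sub>R x) = r *\<^sub>R cscale a x" by (rule ell2_eqI) simp
  show "norm (cscale a x) \<le> norm x * cmod a" by (simp add: norm_cscale)
qed

declare scalar.rep_eq [simp]

lemma scalar_simps:
  "scalar (a + b) = scalar a + scalar b" "scalar (a * b) = scalar a o\<^sub>L scalar b"
  "scalar (- 1) o\<^sub>L T = - T" "scalar 1 o\<^sub>L T = T"
  by (rule blinfun_eqI, rule ell2_eqI, simp add: blinfun.bilinear_simps algebra_simps)+

definition is_adjoint :: "('h::real_inner \<Rightarrow>\<^sub>L 'h) \<Rightarrow> ('h \<Rightarrow>\<^sub>L 'h) \<Rightarrow> bool" where
  "is_adjoint T T' \<longleftrightarrow> (\<forall>x y. T x \<bullet> y = x \<bullet> T' y)"

lemma is_adjoint_unique: "\<lbrakk>is_adjoint T S; is_adjoint T S'\<rbrakk> \<Longrightarrow> S = S'"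
  by (rule blinfun_eqI) (metis is_adjoint_def vector_eq_ldot)

lemma is_adjoint_sym: "is_adjoint T T' \<Longrightarrow> is_adjoint T' T"
  by (metis is_adjoint_def inner_commute)

lemma is_adjoint_0: "is_adjoint 0 0"
  by (simp add: is_adjoint_def)

lemma is_adjoint_add: "\<lbrakk>is_adjoint T T'; is_adjoint S S'\<rbrakk> \<Longrightarrow> is_adjoint (T + S) (T' + S')"
  by (simp add: is_adjoint_def blinfun.bilinear_simps inner_add)

lemma is_adjoint_diff: "\<lbrakk>is_adjoint T T'; is_adjoint S S'\<rbrakk> \<Longrightarrow> is_adjoint (T - S) (T' - S')"
  by (simp add: is_adjoint_def blinfun.bilinear_simps inner_diff)

lemma is_adjoint_comp: "\<lbrakk>is_adjoint T T'; is_adjoint S S'\<rbrakk> \<Longrightarrow> is_adjoint (T o\<^sub>L S) (S' o\<^sub>L T')"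
  by (simp add: is_adjoint_def)

lemma is_adjoint_scalar: "is_adjoint (scalar a) (scalar (cnj a))"
  by (simp add: is_adjoint_def inner_cscale)

lemma norm_adjoint_le: assumes "is_adjoint T T'" shows "norm T' \<le> norm T"
proof (rule norm_blinfun_bound)
  fix y
  have "(norm (T' y))\<^sup>2 = T (T' y) \<bullet> y"
    using assms by (simp add: is_adjoint_def power2_norm_eq_inner)
  also have "\<dots> \<le> norm (T (T' y)) * norm y" by (rule norm_cauchy_schwarz)
  also have "\<dots> \<le> norm T * norm (T' y) * norm y"
    by (intro mult_right_mono norm_blinfun) simp
  finally have "norm (T' y) * norm (T' y) \<le> (norm T * norm y) * norm (T' y)"
    by (simp add: power2_eq_square mult_ac)
  then show "norm (T' y) \<le> norm T * norm y"
    by (cases "norm (T' y) = 0") (simp_all add: mult_le_cancel_right)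
qed simp

lemma norm_adjoint: "is_adjoint T T' \<Longrightarrow> norm T' = norm T"
  using norm_adjoint_le is_adjoint_sym by (metis order.antisym)

lemma norm_adjoint_comp: assumes "is_adjoint T T'" shows "norm (T' o\<^sub>L T) = (norm T)\<^sup>2"
proof (rule antisym)
  show "norm (T' o\<^sub>L T) \<le> (norm T)\<^sup>2"
    using norm_blinfun_compose[of T' T] norm_adjoint[OF assms] by (simp add: power2_eq_square)
  have "norm T \<le> sqrt (norm (T' o\<^sub>L T))"
  proof (rule norm_blinfun_bound)
    fix x
    have "(norm (T x))\<^sup>2 = x \<bullet> (T' o\<^sub>L T) x"
      using assms by (simp add: is_adjoint_def power2_norm_eq_inner)
    also have "\<dots> \<le> norm x * norm ((T' o\<^sub>L T) x)" by (rule norm_cauchy_schwarz)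
    also have "\<dots> \<le> norm x * (norm (T' o\<^sub>L T) * norm x)"
      by (intro mult_left_mono norm_blinfun) simp
    also have "\<dots> = (sqrt (norm (T' o\<^sub>L T)) * norm x)\<^sup>2"
      by (simp add: power_mult_distrib) (simp add: power2_eq_square)
    finally show "norm (T x) \<le> sqrt (norm (T' o\<^sub>L T)) * norm x"
      by (rule power2_le_imp_le) simp
  qed simp
  then show "(norm T)\<^sup>2 \<le> norm (T' o\<^sub>L T)"
    using power_mono[of "norm T" "sqrt (norm (T' o\<^sub>L T))" 2] by simp
qed

definition adjoint_of :: "('h::real_inner \<Rightarrow>\<^sub>L 'h) \<Rightarrow> ('h \<Rightarrow>\<^sub>L 'h)" where
  "adjoint_of T = (THE T'. is_adjoint T T')"

lemma adjoint_of_eq: "is_adjoint T T' \<Longrightarrow> adjoint_of T = T'"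
  unfolding adjoint_of_def by (blast intro: is_adjoint_unique)

text \<open>Bounded operators over the reals are complex linear when they commute with the scalars; their adjoints with respect
  to \<open>Re \<langle>x, y\<rangle>\<close> are then the usual ones. Asking for an adjoint in the carrier takes the place of the
  Riesz representation theorem.\<close>

definition operator_algebra :: "('i ell2 \<Rightarrow>\<^sub>L 'i ell2) cstar" where
  "operator_algebra = \<lparr>
     carrier = {T. (\<forall>a. T o\<^sub>L scalar a = scalar a o\<^sub>L T) \<and> (\<exists>T'. is_adjoint T T')},
     mult = (o\<^sub>L), one = undefined, zero = 0, add = (+), smult = (\<lambda>a T. scalar a o\<^sub>L T),
     adj = adjoint_of, cnorm = norm\<rparr>"

lemma operator_algebra_simps:
  "T \<in> carrier operator_algebra \<longleftrightarrow> (\<forall>a. T o\<^sub>L scalar a = scalar a o\<^sub>L T) \<and> (\<exists>T'. is_adjoint T T')"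
  "S \<otimes>\<^bsub>operator_algebra\<^esub> T = S o\<^sub>L T" "\<zero>\<^bsub>operator_algebra\<^esub> = 0"
  "S \<oplus>\<^bsub>operator_algebra\<^esub> T = S + T" "a \<odot>\<^bsub>operator_algebra\<^esub> T = scalar a o\<^sub>L T"
  "adj operator_algebra T = adjoint_of T" "cnorm operator_algebra T = norm T"
  by (simp_all add: operator_algebra_def)

lemma operator_algebraI:
  assumes "\<And>a. T o\<^sub>L scalar a = scalar a o\<^sub>L T" "is_adjoint T T'"
  shows "T \<in> carrier operator_algebra"
  using assms by (auto simp: operator_algebra_simps)

lemma operator_algebraD:
  assumes "T \<in> carrier operator_algebra"
  shows "T o\<^sub>L scalar a = scalar a o\<^sub>L T" "is_adjoint T (adjoint_of T)"
  using assms adjoint_of_eq by (fastforce simp: operator_algebra_simps)+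

lemma comp_assoc_blinfun: "(R o\<^sub>L S) o\<^sub>L T = R o\<^sub>L (S o\<^sub>L T)"
  by (rule blinfun_eqI) simp

theorem cstar_algebra_operator_algebra: "cstar_algebra operator_algebra"
proof (rule cstar_algebraI)
  let ?C = "operator_algebra :: ('i ell2 \<Rightarrow>\<^sub>L 'i ell2) cstar"
  note S = operator_algebra_simps(2-)
  note bil = bounded_bilinear.add_left[OF bounded_bilinear_blinfun_compose]
    bounded_bilinear.add_right[OF bounded_bilinear_blinfun_compose]
  fix R T U :: "'i ell2 \<Rightarrow>\<^sub>L 'i ell2" and a b
  assume R: "R \<in> carrier ?C"
  note Rc = operator_algebraD(1)[OF R] and Ra = operator_algebraD(2)[OF R]
  show "a \<odot>\<^bsub>?C\<^esub> R \<in> carrier ?C"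
    unfolding S
  proof (rule operator_algebraI[OF _ is_adjoint_comp[OF is_adjoint_scalar Ra]])
    show "scalar a o\<^sub>L R o\<^sub>L scalar c = scalar c o\<^sub>L (scalar a o\<^sub>L R)" for c
      by (metis Rc comp_assoc_blinfun mult.commute scalar_simps(2))
  qed
  show "adj ?C R \<in> carrier ?C"
    unfolding S
  proof (rule operator_algebraI[OF _ is_adjoint_sym[OF Ra]])
    show "adjoint_of R o\<^sub>L scalar c = scalar c o\<^sub>L adjoint_of R" for c
      using is_adjoint_unique[OF is_adjoint_comp[OF Ra is_adjoint_scalar[of "cnj c"]]]
        is_adjoint_comp[OF is_adjoint_scalar[of "cnj c"] Ra] by (simp add: Rc)
  qed
  show "adj ?C (adj ?C R) = R" unfolding S by (rule adjoint_of_eq[OF is_adjoint_sym[OF Ra]])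
  show "adj ?C (a \<odot>\<^bsub>?C\<^esub> R) = cnj a \<odot>\<^bsub>?C\<^esub> adj ?C R"
    unfolding S
    by (rule adjoint_of_eq) (use is_adjoint_comp[OF Ra is_adjoint_scalar[of a]] in \<open>simp add: Rc\<close>)
  show "cnorm ?C (a \<odot>\<^bsub>?C\<^esub> R) = cmod a * cnorm ?C R"
  proof -
    have "norm (scalar b o\<^sub>L T) \<le> cmod b * norm T" for b and T :: "'i ell2 \<Rightarrow>\<^sub>L 'i ell2"
      using norm_blinfun[of T]
      by (intro norm_blinfun_bound) (simp_all add: norm_cscale mult.assoc mult_left_mono)
    from this[of a R] this[of "inverse a" "scalar a o\<^sub>L R"] show ?thesis
      unfolding S by (cases "a = 0")
        (simp_all add: scalar_simps field_simps norm_divide flip: comp_assoc_blinfun scalar_simps(2))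
  qed
  show "cnorm ?C (adj ?C R \<otimes>\<^bsub>?C\<^esub> R) = (cnorm ?C R)\<^sup>2"
    unfolding S by (rule norm_adjoint_comp[OF Ra])
  show "(-1) \<odot>\<^bsub>?C\<^esub> R \<oplus>\<^bsub>?C\<^esub> R = \<zero>\<^bsub>?C\<^esub>" "(a + b) \<odot>\<^bsub>?C\<^esub> R = a \<odot>\<^bsub>?C\<^esub> R \<oplus>\<^bsub>?C\<^esub> b \<odot>\<^bsub>?C\<^esub> R"
    "(a * b) \<odot>\<^bsub>?C\<^esub> R = a \<odot>\<^bsub>?C\<^esub> (b \<odot>\<^bsub>?C\<^esub> R)" "1 \<odot>\<^bsub>?C\<^esub> R = R"
    by (simp_all add: S scalar_simps bil comp_assoc_blinfun)
  assume T: "T \<in> carrier ?C"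
  note Tc = operator_algebraD(1)[OF T] and Ta = operator_algebraD(2)[OF T]
  show "R \<oplus>\<^bsub>?C\<^esub> T \<in> carrier ?C"
    unfolding S by (rule operator_algebraI[OF _ is_adjoint_add[OF Ra Ta]]) (simp add: bil Rc Tc)
  show "R \<otimes>\<^bsub>?C\<^esub> T \<in> carrier ?C"
    unfolding S by (rule operator_algebraI[OF _ is_adjoint_comp[OF Ra Ta]]) (metis Rc Tc comp_assoc_blinfun)
  show "adj ?C (R \<oplus>\<^bsub>?C\<^esub> T) = adj ?C R \<oplus>\<^bsub>?C\<^esub> adj ?C T"
    unfolding S by (rule adjoint_of_eq[OF is_adjoint_add[OF Ra Ta]])
  show "adj ?C (R \<otimes>\<^bsub>?C\<^esub> T) = adj ?C T \<otimes>\<^bsub>?C\<^esub> adj ?C R"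
    unfolding S by (rule adjoint_of_eq[OF is_adjoint_comp[OF Ra Ta]])
  show "R \<otimes>\<^bsub>?C\<^esub> (a \<odot>\<^bsub>?C\<^esub> T) = a \<odot>\<^bsub>?C\<^esub> (R \<otimes>\<^bsub>?C\<^esub> T)"
    unfolding S by (metis Rc comp_assoc_blinfun)
  show "cnorm ?C (R \<oplus>\<^bsub>?C\<^esub> T) \<le> cnorm ?C R + cnorm ?C T" unfolding S by (rule norm_triangle_ineq)
  show "cnorm ?C (R \<otimes>\<^bsub>?C\<^esub> T) \<le> cnorm ?C R * cnorm ?C T" unfolding S by (rule norm_blinfun_compose)
next
  let ?C = "operator_algebra :: ('i ell2 \<Rightarrow>\<^sub>L 'i ell2) cstar"
  fix f :: "nat \<Rightarrow> 'i ell2 \<Rightarrow>\<^sub>L 'i ell2"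
  assume f: "\<And>n. f n \<in> carrier ?C"
    and cau: "\<And>\<epsilon>. \<epsilon> > 0 \<Longrightarrow> \<exists>N. \<forall>m\<ge>N. \<forall>n\<ge>N. cnorm ?C (f m \<oplus>\<^bsub>?C\<^esub> (-1) \<odot>\<^bsub>?C\<^esub> f n) < \<epsilon>"
  note fa = operator_algebraD(2)[OF f]
  have "Cauchy f"
    using cau by (intro CauchyI) (simp add: operator_algebra_simps scalar_simps)
  then obtain T where T: "f \<longlonglongrightarrow> T" using Cauchy_convergent convergent_def by blast
  have "Cauchy (\<lambda>n. adjoint_of (f n))"
    using cau norm_adjoint[OF is_adjoint_diff[OF fa fa]]
    by (intro CauchyI) (simp add: operator_algebra_simps scalar_simps)
  then obtain T' where T': "(\<lambda>n. adjoint_of (f n)) \<longlonglongrightarrow> T'" using Cauchy_convergent convergent_def by blast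
  have "is_adjoint T T'"
    unfolding is_adjoint_def
  proof (intro allI)
    fix x y
    have "(\<lambda>n. f n x \<bullet> y) \<longlonglongrightarrow> T x \<bullet> y" by (intro tendsto_intros T)
    moreover have "(\<lambda>n. x \<bullet> adjoint_of (f n) y) \<longlonglongrightarrow> x \<bullet> T' y" by (intro tendsto_intros T')
    ultimately show "T x \<bullet> y = x \<bullet> T' y" using fa LIMSEQ_unique by (simp add: is_adjoint_def)
  qed
  moreover have "T o\<^sub>L scalar a = scalar a o\<^sub>L T" for a
  proof (rule LIMSEQ_unique)
    show "(\<lambda>n. f n o\<^sub>L scalar a) \<longlonglongrightarrow> (T o\<^sub>L scalar a)"
      by (intro bounded_bilinear.tendsto[OF bounded_bilinear_blinfun_compose] T tendsto_const)
    show "(\<lambda>n. f n o\<^sub>L scalar a) \<longlonglongrightarrow> (scalar a o\<^sub>L T)"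
      unfolding operator_algebraD(1)[OF f]
      by (intro bounded_bilinear.tendsto[OF bounded_bilinear_blinfun_compose] T tendsto_const)
  qed
  ultimately have "T \<in> carrier ?C" by (rule operator_algebraI[rotated])
  moreover have "(\<lambda>n. cnorm ?C (f n \<oplus>\<^bsub>?C\<^esub> (-1) \<odot>\<^bsub>?C\<^esub> T)) \<longlonglongrightarrow> 0"
    using T by (simp add: operator_algebra_simps scalar_simps LIM_zero_iff tendsto_norm_zero_iff)
  ultimately show "\<exists>x\<in>carrier ?C. (\<lambda>n. cnorm ?C (f n \<oplus>\<^bsub>?C\<^esub> (-1) \<odot>\<^bsub>?C\<^esub> x)) \<longlonglongrightarrow> 0" by blast
qed (auto simp: operator_algebra_simps comp_assoc_blinfun is_adjoint_0 bounded_bilinear.add_left[OF bounded_bilinear_blinfun_compose]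
    bounded_bilinear.add_right[OF bounded_bilinear_blinfun_compose] algebra_simps intro: is_adjoint_0)


section \<open>Operators of partial injections\<close>

lemma sum_partial_injection:
  assumes h: "inj_on h (dom h)" and "finite F"
  obtains H where "finite H"
    "(\<Sum>i\<in>F. (cmod (case h i of None \<Rightarrow> 0 | Some j \<Rightarrow> x j))\<^sup>2) = (\<Sum>j\<in>H. (cmod (x j))\<^sup>2)"
proof (rule that)
  let ?g = "\<lambda>i. the (h i)"
  show "finite (?g ` (F \<inter> dom h))" using \<open>finite F\<close> by simp
  have "inj_on ?g (F \<inter> dom h)" 
    by (rule inj_onI) (metis IntD2 domD h inj_onD option.sel)
  then have "(\<Sum>j\<in>?g ` (F \<inter> dom h). (cmod (x j))\<^sup>2) = (\<Sum>i\<in>F \<inter> dom h. (cmod (x (?g i)))\<^sup>2)"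
    by (simp add: sum.reindex)
  also have "\<dots> = (\<Sum>i\<in>F. (cmod (case h i of None \<Rightarrow> 0 | Some j \<Rightarrow> x j))\<^sup>2)"
    using \<open>finite F\<close> by (intro sum.mono_neutral_cong_left) (auto split: option.splits)
  finally show "(\<Sum>i\<in>F. (cmod (case h i of None \<Rightarrow> 0 | Some j \<Rightarrow> x j))\<^sup>2)
      = (\<Sum>j\<in>?g ` (F \<inter> dom h). (cmod (x j))\<^sup>2)" by simp
qed

text \<open>Composition with a partial map \<open>h\<close>, which is a partial isometry of the Hilbert space if \<open>h\<close> is injective. For
  other \<open>h\<close> the formula may leave the space, and the value \<open>0\<close> is used.\<close>

lift_definition pull_vec :: "('i \<Rightarrow> 'i option) \<Rightarrow> 'i ell2 \<Rightarrow> 'i ell2" is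
  "\<lambda>h x i. if inj_on h (dom h) then (case h i of None \<Rightarrow> 0 | Some j \<Rightarrow> x j) else 0"
  subgoal for h x
    by (cases "inj_on h (dom h)") (simp_all add: square_summable_iff_bounded, metis sum_partial_injection)
  done

lemma coord_pull_vec:
  "inj_on h (dom h) \<Longrightarrow> coord (pull_vec h x) i = (case h i of None \<Rightarrow> 0 | Some j \<Rightarrow> coord x j)"
  by transfer simp

lift_definition pull :: "('i \<Rightarrow> 'i option) \<Rightarrow> 'i ell2 \<Rightarrow>\<^sub>L 'i ell2" is pull_vec
proof (rule bounded_linear_intro[where K = 1])
  fix h :: "'i \<Rightarrow> 'i option" and x y :: "'i ell2" and r
  have *: "pull_vec h x = 0" if "\<not> inj_on h (dom h)" for x
    using that by transfer simp
  show "pull_vec h (x + y) = pull_vec h x + pull_vec h y"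
    by (cases "inj_on h (dom h)") (auto simp: * coord_pull_vec intro!: ell2_eqI split: option.splits)
  show "pull_vec h (r *\<^sub>R x) = r *\<^sub>R pull_vec h x"
    by (cases "inj_on h (dom h)") (auto simp: * coord_pull_vec intro!: ell2_eqI split: option.splits)
  show "norm (pull_vec h x) \<le> norm x * 1"
  proof (cases "inj_on h (dom h)")
    case True
    have "(\<Sum>i\<in>F. (cmod (coord (pull_vec h x) i))\<^sup>2) \<le> (norm x)\<^sup>2" if F: "finite F" for F
      using sum_partial_injection[OF True F, of "coord x"] sum_coord_le_norm[of _ x]
      by (metis (no_types, lifting) True coord_pull_vec sum.cong)
    then show ?thesis by (simp add: norm_ell2_le)
  qed (simp add: *)
qed

lemma coord_pull:
  "inj_on h (dom h) \<Longrightarrow> coord (pull h x) i = (case h i of None \<Rightarrow> 0 | Some j \<Rightarrow> coord x j)"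
  by (simp add: pull.rep_eq coord_pull_vec)

lemma inj_on_map_comp:
  assumes "inj_on h (dom h)" "inj_on k (dom k)" shows "inj_on (k \<circ>\<^sub>m h) (dom (k \<circ>\<^sub>m h))"
proof (rule inj_onI)
  fix i j assume i: "i \<in> dom (k \<circ>\<^sub>m h)" and "j \<in> dom (k \<circ>\<^sub>m h)" and eq: "(k \<circ>\<^sub>m h) i = (k \<circ>\<^sub>m h) j"
  then obtain m n where m: "h i = Some m" "h j = Some n" "k m \<noteq> None" "k m = k n"
    by (auto simp: map_comp_def split: option.splits)
  then have "m = n" using assms(2) by (auto dest: inj_onD)
  then have "h i = h j" "i \<in> dom h" "j \<in> dom h" using m by auto
  then show "i = j" using assms(1) by (auto dest: inj_onD)
qed

lemma pull_comp:
  assumes "inj_on h (dom h)" "inj_on k (dom k)"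
  shows "pull h o\<^sub>L pull k = pull (k \<circ>\<^sub>m h)"
  by (rule blinfun_eqI, rule ell2_eqI)
    (simp add: coord_pull assms inj_on_map_comp, simp add: map_comp_def coord_pull assms split: option.splits)

lemma pull_scalar: 
  assumes "inj_on h (dom h)" shows "pull h o\<^sub>L scalar a = scalar a o\<^sub>L pull h"
  by (rule blinfun_eqI, rule ell2_eqI) (simp add: coord_pull assms split: option.splits)

text \<open>Substitution in the sum that defines the inner product: the adjoint of composition with a partial bijection is
  composition with its inverse.\<close>

lemma is_adjoint_pull:
  assumes hk: "\<And>i j. h i = Some j \<longleftrightarrow> k j = Some i"
  shows "is_adjoint (pull h) (pull k)" "inj_on h (dom h)" "inj_on k (dom k)"
proof -
  show h: "inj_on h (dom h)" by (rule inj_onI) (metis domD hk option.inject)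
  show k: "inj_on k (dom k)" by (rule inj_onI) (metis domD hk option.inject)
  have hk': "h i = Some j \<Longrightarrow> k j = Some i" "k j = Some i \<Longrightarrow> h i = Some j" for i j
    by (simp_all add: hk)
  have bij: "bij_betw (\<lambda>i. the (h i)) (dom h) (dom k)"
  proof (rule bij_betw_byWitness[where f' = "\<lambda>j. the (k j)"])
    show "\<forall>i\<in>dom h. the (k (the (h i))) = i" "(\<lambda>i. the (h i)) ` dom h \<subseteq> dom k"
      using hk'(1) by fastforce+
    show "\<forall>j\<in>dom k. the (h (the (k j))) = j" "(\<lambda>j. the (k j)) ` dom k \<subseteq> dom h"
      using hk'(2) by fastforce+
  qed
  show "is_adjoint (pull h) (pull k)"
    unfolding is_adjoint_def
  proof (intro allI)
    fix x y
    have "pull h x \<bullet> y = (\<Sum>\<^sub>\<infinity>i. coord (pull h x) i \<bullet> coord y i)" by (simp add: inner_ell2.rep_eq)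
    also have "\<dots> = (\<Sum>\<^sub>\<infinity>i\<in>dom h. coord x (the (h i)) \<bullet> coord y (the (k (the (h i)))))"
    proof (rule infsum_cong_neutral)
      fix i assume "i \<in> UNIV \<inter> dom h"
      then obtain j where "h i = Some j" by auto
      then show "coord (pull h x) i \<bullet> coord y i = coord x (the (h i)) \<bullet> coord y (the (k (the (h i))))"
        using hk'(1)[of i j] by (simp add: coord_pull[OF h])
    qed (auto simp: coord_pull[OF h] split: option.splits)
    also have "\<dots> = (\<Sum>\<^sub>\<infinity>j\<in>dom k. coord x j \<bullet> coord y (the (k j)))"
      by (rule infsum_reindex_bij_betw[OF bij])
    also have "\<dots> = (\<Sum>\<^sub>\<infinity>j. coord x j \<bullet> coord (pull k y) j)"
      by (rule infsum_cong_neutral) (auto simp: coord_pull[OF k] split: option.splits)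
    also have "\<dots> = x \<bullet> pull k y" by (simp add: inner_ell2.rep_eq)
    finally show "pull h x \<bullet> y = x \<bullet> pull k y" .
  qed
qed

lemma finsum_operator_algebra:
  assumes "finite F" "\<And>e. e \<in> F \<Longrightarrow> g e \<in> carrier operator_algebra"
  shows "finsum operator_algebra g F = sum g F"
proof -
  interpret C: cstar_algebra operator_algebra by (rule cstar_algebra_operator_algebra)
  show ?thesis
    using assms
  proof (induction F rule: finite_induct)
    case (insert e F)
    then have "g \<in> F \<rightarrow> carrier operator_algebra" "g e \<in> carrier operator_algebra" by auto
    with insert show ?case by (simp add: operator_algebra_simps(4))
  qed (simp add: operator_algebra_simps(3))
qed

section \<open>The path representation\<close>

context wf_digraph
begin

lemma awalk_snoc_iff: "awalk w (p @ [e]) v \<longleftrightarrow> awalk w p (tail G e) \<and> e \<in> arcs G \<and> v = head G e"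
  by (auto simp: awalk_simps)

text \<open>On the Hilbert space with the paths starting at \<open>w\<close> as orthonormal basis, the projection of a vertex \<open>v\<close> is onto
  the paths that end at \<open>v\<close>, and the partial isometry of an edge \<open>e\<close> appends \<open>e\<close> to a path. As the operators are given
  by composition of coordinate functions with partial maps, it is the map dropping the last edge \<open>e\<close> that describes
  this isometry, and appending \<open>e\<close> that describes its adjoint.\<close>

definition path_proj :: "'a \<Rightarrow> 'a \<Rightarrow> 'b list \<Rightarrow> 'b list option" where
  "path_proj w v p = (if awalk w p v then Some p else None)"

definition path_drop :: "'a \<Rightarrow> 'b \<Rightarrow> 'b list \<Rightarrow> 'b list option" where
  "path_drop w e q = (if q \<noteq> [] \<and> last q = e \<and> awalk w q (head G e) then Some (butlast q) else None)"

definition path_snoc :: "'a \<Rightarrow> 'b \<Rightarrow> 'b list \<Rightarrow> 'b list option" where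
  "path_snoc w e p = (if awalk w (p @ [e]) (head G e) then Some (p @ [e]) else None)"

lemma path_drop_snoc: "path_drop w e q = Some p \<longleftrightarrow> path_snoc w e p = Some q"
  by (cases q rule: rev_cases) (auto simp: path_drop_def path_snoc_def)

lemma path_proj_sym: "path_proj w v q = Some p \<longleftrightarrow> path_proj w v p = Some q"
  by (auto simp: path_proj_def)

text \<open>A nonempty path has exactly one last edge, so for \<open>v \<noteq> w\<close> the paths from \<open>w\<close> to \<open>v\<close> are the disjoint union, over
  the edges \<open>e\<close> with range \<open>v\<close>, of the paths ending with \<open>e\<close>. This is the summation relation at \<open>v\<close>. The empty path
  violates it only at \<open>w\<close>, where no relation is imposed because \<open>w\<close> receives no edge.\<close>

theorem path_representation:
  assumes rf: "row_finite G" and w: "w \<in> verts G" "\<And>e. e \<in> arcs G \<Longrightarrow> head G e \<noteq> w"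
  obtains q T where "ck_family G (operator_algebra :: ('b list ell2 \<Rightarrow>\<^sub>L 'b list ell2) cstar) q T"
    "q w \<noteq> 0" "\<And>v. \<not> w \<rightarrow>\<^sup>* v \<Longrightarrow> q v = 0"
proof -
  let ?C = "operator_algebra :: ('b list ell2 \<Rightarrow>\<^sub>L 'b list ell2) cstar"
  define q where "q v = pull (path_proj w v)" for v
  define T where "T e = pull (path_drop w e)" for e
  define T' where "T' e = pull (path_snoc w e)" for e
  have P: "is_adjoint (q v) (q v)" "inj_on (path_proj w v) (dom (path_proj w v))" for v
    unfolding q_def by (rule is_adjoint_pull[OF path_proj_sym])+
  have S: "is_adjoint (T e) (T' e)" "inj_on (path_drop w e) (dom (path_drop w e))"
    "inj_on (path_snoc w e) (dom (path_snoc w e))" for e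
    unfolding T_def T'_def by (rule is_adjoint_pull[OF path_drop_snoc])+
  note eqs = adjoint_of_eq[OF P(1)] adjoint_of_eq[OF S(1)]
  have qC: "q v \<in> carrier ?C" for v
    using pull_scalar[OF P(2)] by (intro operator_algebraI[OF _ P(1)]) (simp add: q_def)
  have TC: "T e \<in> carrier ?C" for e
    using pull_scalar[OF S(2)] by (intro operator_algebraI[OF _ S(1)]) (simp add: T_def)
  have T'C: "T' e \<in> carrier ?C" for e
    using pull_scalar[OF S(3)] by (intro operator_algebraI[OF _ is_adjoint_sym[OF S(1)]]) (simp add: T'_def)
  interpret C: cstar_algebra ?C by (rule cstar_algebra_operator_algebra)
  have qq: "q u o\<^sub>L q v = (if u = v then q v else 0)" for u v
  proof (rule blinfun_eqI, rule ell2_eqI)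
    fix x p
    have "\<not> (awalk w p u \<and> awalk w p v)" if "u \<noteq> v" using that awalk_ends by blast
    then show "coord ((q u o\<^sub>L q v) x) p = coord ((if u = v then q v else 0) x) p"
      by (auto simp: q_def coord_pull[OF P(2)] path_proj_def)
  qed
  have T'T: "T' e o\<^sub>L T e = q (tail G e)" if "e \<in> arcs G" for e
    using that unfolding T_def T'_def q_def pull_comp[OF S(3,2)]
    by (intro arg_cong[where f = pull] ext)
      (auto simp: map_comp_def path_snoc_def path_drop_def path_proj_def awalk_snoc_iff simp del: awalk_append_iff)
  have TT': "coord ((T e o\<^sub>L T' e) x) p = (if p \<noteq> [] \<and> last p = e \<and> awalk w p (head G e) then coord x p else 0)"
    for e x p
    by (cases p rule: rev_cases)
      (auto simp: T_def T'_def coord_pull[OF S(2)] coord_pull[OF S(3)] path_snoc_def path_drop_def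
        simp del: awalk_append_iff split: if_splits)
  have "T e o\<^sub>L q (tail G e) = T e" if "e \<in> arcs G" for e
  proof (rule blinfun_eqI, rule ell2_eqI)
    fix x p show "coord ((T e o\<^sub>L q (tail G e)) x) p = coord (T e x) p"
      by (cases p rule: rev_cases)
        (auto simp: T_def q_def coord_pull[OF S(2)] coord_pull[OF P(2)] path_drop_def path_proj_def
          awalk_snoc_iff simp del: awalk_append_iff)
  qed
  then have TT'T: "T e o\<^sub>L T' e o\<^sub>L T e = T e" if "e \<in> arcs G" for e
    using that T'T by (simp add: comp_assoc_blinfun)
  have sum: "(\<Sum>e\<in>{e \<in> arcs G. head G e = v}. T e o\<^sub>L T' e) = q v"
    if v: "v \<in> verts G" "{e \<in> arcs G. head G e = v} \<noteq> {}" for v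
  proof (rule blinfun_eqI, rule ell2_eqI)
    fix x p
    let ?F = "{e \<in> arcs G. head G e = v}"
    have fin: "finite ?F" using rf v(1) by (simp add: row_finite_def)
    have "v \<noteq> w" using v(2) w(2) by auto
    have coord_sum: "coord (sum f F) p = (\<Sum>e\<in>F. coord (f e) p)" if "finite F" for f :: "'b \<Rightarrow> 'b list ell2" and F
      using that by (induction F rule: finite_induct) auto
    have "coord ((\<Sum>e\<in>?F. T e o\<^sub>L T' e) x) p = (\<Sum>e\<in>?F. coord ((T e o\<^sub>L T' e) x) p)"
      by (simp add: blinfun.sum_left coord_sum fin)
    also have "\<dots> = (\<Sum>e\<in>?F. if last p = e then (if p \<noteq> [] \<and> awalk w p v then coord x p else 0) else 0)"
      unfolding TT' by (intro sum.cong) auto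
    also have "\<dots> = (if last p \<in> ?F \<and> p \<noteq> [] \<and> awalk w p v then coord x p else 0)"
      using fin by simp
    also have "last p \<in> ?F \<and> p \<noteq> [] \<and> awalk w p v \<longleftrightarrow> awalk w p v"
      using \<open>v \<noteq> w\<close>
      by (cases p rule: rev_cases) (auto simp: awalk_snoc_iff awalk_Nil_iff simp del: awalk_append_iff)
    finally show "coord ((\<Sum>e\<in>?F. T e o\<^sub>L T' e) x) p = coord (q v x) p"
      by (simp add: q_def coord_pull[OF P(2)] path_proj_def)
  qed
  have "ck_family G ?C q T"
    unfolding ck_family_def
  proof (intro conjI ballI impI)
    fix v assume v: "v \<in> verts G" "{e \<in> arcs G. head G e = v} \<noteq> {}"
    have "finite {e \<in> arcs G. head G e = v}" using rf v(1) by (simp add: row_finite_def)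
    moreover have "T e o\<^sub>L T' e \<in> carrier ?C" for e
      using C.mult_closed[OF TC T'C] by (simp add: operator_algebra_simps(2))
    ultimately show "(\<Oplus>\<^bsub>?C\<^esub>e\<in>{e \<in> arcs G. head G e = v}. T e \<otimes>\<^bsub>?C\<^esub> adj ?C (T e)) = q v"
      using sum[OF v] by (simp add: finsum_operator_algebra operator_algebra_simps(2-) eqs)
  qed (use T'T TT'T in \<open>simp_all add: qC TC operator_algebra_simps(2-) eqs qq\<close>)
  moreover have "q w \<noteq> 0"
  proof
    assume 0: "q w = 0"
    have "(\<lambda>p. (cmod (if p = [] then 1 else 0))\<^sup>2) summable_on (UNIV :: 'b list set)"
      by (rule finite_nonzero_values_imp_summable_on) (rule finite_subset[of _ "{[]}"], auto)
    then have "coord (Abs_ell2 (\<lambda>p. if p = ([] :: 'b list) then 1 else 0)) [] = 1"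
      by (subst Abs_ell2_inverse) simp_all
    moreover have "awalk w [] w" using w(1) by (simp add: awalk_Nil_iff)
    then have "coord (q w x) [] = coord x []" for x
      by (simp add: q_def coord_pull[OF P(2)] path_proj_def)
    ultimately show False using 0 by (metis blinfun.zero_left coord_simps(4) zero_neq_one)
  qed
  moreover have "q v = 0" if "\<not> w \<rightarrow>\<^sup>* v" for v
    using that
    by (intro blinfun_eqI ell2_eqI) (auto simp: q_def coord_pull[OF P(2)] path_proj_def reachable_awalk)
  ultimately show thesis by (rule that)
qed

end


section \<open>Automorphisms of a graph and of its C*-algebra\<close>

text \<open>By contractivity, the set on which two *-homomorphisms agree is closed.\<close>

lemma star_hom_eq_on_generated:
  assumes C: "cstar_algebra C" and D: "cstar_algebra D" and f: "f \<in> star_hom C D" and g: "g \<in> star_hom C D"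
    and X: "X \<subseteq> carrier C" "\<And>x. x \<in> X \<Longrightarrow> f x = g x" and x: "x \<in> cstar_generated C X"
  shows "f x = g x"
proof -
  interpret C: cstar_algebra C by fact
  interpret D: cstar_algebra D by fact
  let ?K = "{x \<in> carrier C. f x = g x}"
  note hf = star_homD[OF f] and hg = star_homD[OF g]
  have conv: "D.converges (\<lambda>n. h (u n)) (h y)"
    if h: "h \<in> star_hom C D" and u: "\<And>n. u n \<in> carrier C" and y: "y \<in> carrier C"
      and lim: "(\<lambda>n. cnorm C (u n \<ominus>\<^bsub>C\<^esub> y)) \<longlonglongrightarrow> 0" for h u y
  proof (rule D.convergesI[OF _ _ _ lim])
    show "cnorm D (h (u n) \<ominus>\<^bsub>D\<^esub> h y) \<le> cnorm C (u n \<ominus>\<^bsub>C\<^esub> y)" for n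
      using star_hom_contractive[OF C D h C.minus_closed'[OF u y]] star_hom_minus[OF C D h u y] by simp
  qed (simp_all add: star_homD(1)[OF h] u y)
  have "closed_star_subalgebra ?K C"
    unfolding closed_star_subalgebra_def
  proof (intro conjI ballI allI impI)
    fix u y assume y: "y \<in> carrier C"
      and u: "(\<forall>n. u n \<in> ?K) \<and> (\<lambda>n. cnorm C (u n \<ominus>\<^bsub>C\<^esub> y)) \<longlonglongrightarrow> 0"
    have "D.converges (\<lambda>n. f (u n)) (f y)" using u y by (intro conv[OF f]) auto
    moreover have "D.converges (\<lambda>n. f (u n)) (g y)" using u conv[OF g, of u y] y by simp
    ultimately have "f y = g y" by (rule D.converges_unique)
    then show "y \<in> ?K" using y by simp
  qed (auto simp: hf hg C.mult_closed C.a_smult_closed C.adj_closed star_hom_zero[OF C D f] star_hom_zero[OF C D g])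
  then have "cstar_generated C X \<subseteq> ?K" using X by (intro cstar_generated_least) auto
  then show ?thesis using x by blast
qed

definition graph_auto :: "('v, 'e) pre_digraph \<Rightarrow> ('v \<Rightarrow> 'v) \<Rightarrow> ('e \<Rightarrow> 'e) \<Rightarrow> bool" where
  "graph_auto G f g \<longleftrightarrow> bij_betw f (verts G) (verts G) \<and> bij_betw g (arcs G) (arcs G) \<and>
     (\<forall>e\<in>arcs G. tail G (g e) = f (tail G e) \<and> head G (g e) = f (head G e))"

lemma ck_familyD:
  assumes "ck_family G C p S"
  shows "v \<in> verts G \<Longrightarrow> p v \<in> carrier C" "v \<in> verts G \<Longrightarrow> p v \<otimes>\<^bsub>C\<^esub> p v = p v"
    "v \<in> verts G \<Longrightarrow> adj C (p v) = p v"
    "\<lbrakk>v \<in> verts G; w \<in> verts G; v \<noteq> w\<rbrakk> \<Longrightarrow> p v \<otimes>\<^bsub>C\<^esub> p w = \<zero>\<^bsub>C\<^esub>"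
    "e \<in> arcs G \<Longrightarrow> S e \<in> carrier C" "e \<in> arcs G \<Longrightarrow> S e \<otimes>\<^bsub>C\<^esub> adj C (S e) \<otimes>\<^bsub>C\<^esub> S e = S e"
    "e \<in> arcs G \<Longrightarrow> adj C (S e) \<otimes>\<^bsub>C\<^esub> S e = p (tail G e)"
    "\<lbrakk>v \<in> verts G; {e \<in> arcs G. head G e = v} \<noteq> {}\<rbrakk>
      \<Longrightarrow> (\<Oplus>\<^bsub>C\<^esub>e\<in>{e \<in> arcs G. head G e = v}. S e \<otimes>\<^bsub>C\<^esub> adj C (S e)) = p v"
proof -
  note D = assms[unfolded ck_family_def]
  note D1 = D[THEN conjunct1, rule_format] and D2 = D[THEN conjunct2, THEN conjunct1, rule_format]
    and D3 = D[THEN conjunct2, THEN conjunct2, THEN conjunct1, rule_format]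
    and D4 = D[THEN conjunct2, THEN conjunct2, THEN conjunct2, THEN conjunct1, rule_format]
    and D5 = D[THEN conjunct2, THEN conjunct2, THEN conjunct2, THEN conjunct2, rule_format]
  show "v \<in> verts G \<Longrightarrow> p v \<in> carrier C" by (rule D1[THEN conjunct1])
  show "v \<in> verts G \<Longrightarrow> p v \<otimes>\<^bsub>C\<^esub> p v = p v" by (rule D1[THEN conjunct2, THEN conjunct1])
  show "v \<in> verts G \<Longrightarrow> adj C (p v) = p v" by (rule D1[THEN conjunct2, THEN conjunct2])
  show "\<lbrakk>v \<in> verts G; w \<in> verts G; v \<noteq> w\<rbrakk> \<Longrightarrow> p v \<otimes>\<^bsub>C\<^esub> p w = \<zero>\<^bsub>C\<^esub>" by (rule D2)
  show "e \<in> arcs G \<Longrightarrow> S e \<in> carrier C" by (rule D3[THEN conjunct1])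
  show "e \<in> arcs G \<Longrightarrow> S e \<otimes>\<^bsub>C\<^esub> adj C (S e) \<otimes>\<^bsub>C\<^esub> S e = S e" by (rule D3[THEN conjunct2])
  show "e \<in> arcs G \<Longrightarrow> adj C (S e) \<otimes>\<^bsub>C\<^esub> S e = p (tail G e)" by (rule D4)
  show "\<lbrakk>v \<in> verts G; {e \<in> arcs G. head G e = v} \<noteq> {}\<rbrakk>
      \<Longrightarrow> (\<Oplus>\<^bsub>C\<^esub>e\<in>{e \<in> arcs G. head G e = v}. S e \<otimes>\<^bsub>C\<^esub> adj C (S e)) = p v" by (rule D5)
qed

lemma ck_family_graph_auto:
  assumes "wf_digraph G" and C: "cstar_algebra C" and fam: "ck_family G C p S" and fg: "graph_auto G f g"
  shows "ck_family G C (p \<circ> f) (S \<circ> g)"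
proof -
  interpret wf_digraph G by fact
  interpret C: cstar_algebra C by fact
  have f_bij: "bij_betw f (verts G) (verts G)"
    and g_bij: "bij_betw g (arcs G) (arcs G)" using fg by (simp_all add: graph_auto_def)
  have f: "f v \<in> verts G" "f v = f w \<longleftrightarrow> v = w" if "v \<in> verts G" "w \<in> verts G" for v w
    using bij_betwE[OF f_bij] inj_on_eq_iff[OF bij_betw_imp_inj_on[OF f_bij]] that by auto
  have g: "g e \<in> arcs G" "tail G (g e) = f (tail G e)" "head G (g e) = f (head G e)" if "e \<in> arcs G" for e
    using fg that bij_betwE[of g] by (auto simp: graph_auto_def)
  have inj: "inj_on g (arcs G)" and surj: "g ` arcs G = arcs G"
    using bij_betw_imp_inj_on[OF g_bij] bij_betw_imp_surj_on[OF g_bij] .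
  have img: "g ` {e \<in> arcs G. head G e = v} = {e \<in> arcs G. head G e = f v}" if v: "v \<in> verts G" for v
  proof (intro equalityI subsetI)
    fix e assume e: "e \<in> {e \<in> arcs G. head G e = f v}"
    then have "e \<in> g ` arcs G" unfolding surj by simp
    then obtain e' where e': "e' \<in> arcs G" "e = g e'" by (rule imageE)
    then have "f (head G e') = f v" using e g(3)[OF e'(1)] by simp
    then have "head G e' = v" using f(2)[OF head_in_verts[OF e'(1)] v] by simp
    with e' show "e \<in> g ` {e \<in> arcs G. head G e = v}" by blast
  qed (auto simp: g)
  note S = ck_familyD(5)[OF fam]
  show ?thesis
    unfolding ck_family_def o_def
  proof (intro conjI ballI impI)
    fix v assume v: "v \<in> verts G"
    show "p (f v) \<in> carrier C" "p (f v) \<otimes>\<^bsub>C\<^esub> p (f v) = p (f v)" "adj C (p (f v)) = p (f v)"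
      using f(1)[OF v v] by (rule ck_familyD[OF fam])+
    show "p (f v) \<otimes>\<^bsub>C\<^esub> p (f w) = \<zero>\<^bsub>C\<^esub>" if "w \<in> verts G" "v \<noteq> w" for w
      using that v f by (intro ck_familyD(4)[OF fam]) auto
    assume ne: "{e \<in> arcs G. head G e = v} \<noteq> {}"
    let ?h = "\<lambda>e. S e \<otimes>\<^bsub>C\<^esub> adj C (S e)"
    have "{e \<in> arcs G. head G e = f v} \<noteq> {}" using ne unfolding img[OF v, symmetric] by simp
    from ck_familyD(8)[OF fam f(1)[OF v v] this]
    have "(\<Oplus>\<^bsub>C\<^esub>e\<in>g ` {e \<in> arcs G. head G e = v}. ?h e) = p (f v)" unfolding img[OF v] .
    moreover have "(\<Oplus>\<^bsub>C\<^esub>e\<in>g ` {e \<in> arcs G. head G e = v}. ?h e)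
        = (\<Oplus>\<^bsub>C\<^esub>e\<in>{e \<in> arcs G. head G e = v}. ?h (g e))"
      by (rule C.finsum_reindex) (auto simp: S g C.mult_closed C.adj_closed intro: inj_on_subset[OF inj])
    ultimately show "(\<Oplus>\<^bsub>C\<^esub>e\<in>{e \<in> arcs G. head G e = v}. ?h (g e)) = p (f v)" by simp
  next
    fix e assume e: "e \<in> arcs G"
    show "S (g e) \<in> carrier C" "S (g e) \<otimes>\<^bsub>C\<^esub> adj C (S (g e)) \<otimes>\<^bsub>C\<^esub> S (g e) = S (g e)"
      using g(1)[OF e] by (rule ck_familyD[OF fam])+
    show "adj C (S (g e)) \<otimes>\<^bsub>C\<^esub> S (g e) = p (f (tail G e))"
      using ck_familyD(7)[OF fam g(1)[OF e]] g(2)[OF e] by simp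
  qed
qed

lemma graph_auto_inv:
  assumes "wf_digraph G" and fg: "graph_auto G f g"
  shows "graph_auto G (inv_into (verts G) f) (inv_into (arcs G) g)"
proof -
  interpret wf_digraph G by fact
  let ?f = "inv_into (verts G) f" and ?g = "inv_into (arcs G) g"
  have f: "bij_betw f (verts G) (verts G)" and g: "bij_betw g (arcs G) (arcs G)"
    using fg by (auto simp: graph_auto_def)
  have "tail G (?g e) = ?f (tail G e) \<and> head G (?g e) = ?f (head G e)" if e: "e \<in> arcs G" for e
  proof -
    obtain e' where e': "e' \<in> arcs G" "e = g e'"
      using bij_betw_imp_surj_on[OF g] e by blast
    then have "tail G e = f (tail G e')" "head G e = f (head G e')" "?g e = e'"
      using fg bij_betw_inv_into_left[OF g] by (simp_all add: graph_auto_def)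
    then show ?thesis using bij_betw_inv_into_left[OF f] e'(1) by simp
  qed
  then show ?thesis using f g by (simp add: graph_auto_def bij_betw_inv_into)
qed

text \<open>The hypotheses under which the graph C*-algebra has its universal property.\<close>

locale row_finite_graph = wf_digraph G for G :: "('v, 'e) pre_digraph" (structure) +
  assumes row_finite: "row_finite G" and countable: "countable (verts G)" "countable (arcs G)"
begin

sublocale C: cstar_algebra "graph_cstar G"
  by (rule cstar_algebra_graph_cstar) unfold_locales

lemma wf: "wf_digraph G" ..

lemmas C_alg = C.cstar_algebra_axioms

lemma family: "ck_family G (graph_cstar G) (graph_proj G) (graph_isom G)"
  by (rule ck_family_graph_cstar[OF wf row_finite])

lemma proj_closed: "v \<in> verts G \<Longrightarrow> graph_proj G v \<in> carrier (graph_cstar G)"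
  and isom_closed: "e \<in> arcs G \<Longrightarrow> graph_isom G e \<in> carrier (graph_cstar G)"
  by (rule ck_familyD[OF family], assumption)+

lemma hom_eqI:
  assumes "cstar_algebra D" "\<phi> \<in> star_hom (graph_cstar G) D" "\<psi> \<in> star_hom (graph_cstar G) D"
    and "\<And>v. v \<in> verts G \<Longrightarrow> \<phi> (graph_proj G v) = \<psi> (graph_proj G v)"
    and "\<And>e. e \<in> arcs G \<Longrightarrow> \<phi> (graph_isom G e) = \<psi> (graph_isom G e)"
    and "x \<in> carrier (graph_cstar G)"
  shows "\<phi> x = \<psi> x"
  by (rule star_hom_eq_on_generated[OF C_alg assms(1-3), where X = "ck_generators G"])
    (use assms(4-6) in \<open>auto simp: graph_cstar_generated[OF wf] proj_closed isom_closed\<close>)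

text \<open>Among the *-homomorphisms that permute the generators, one is chosen; \<open>hom_eqI\<close> shows that they coincide on
  the carrier. Elements of \<open>star_auto\<close> are extensional, hence the restriction.\<close>

definition induced_auto :: "('v \<Rightarrow> 'v) \<Rightarrow> ('e \<Rightarrow> 'e) \<Rightarrow> (('v, 'e) ck_index \<Rightarrow> label) \<Rightarrow> (('v, 'e) ck_index \<Rightarrow> label)" where
  "induced_auto f g = restrict (SOME \<phi>. \<phi> \<in> star_hom (graph_cstar G) (graph_cstar G) \<and>
     (\<forall>v\<in>verts G. \<phi> (graph_proj G v) = graph_proj G (f v)) \<and>
     (\<forall>e\<in>arcs G. \<phi> (graph_isom G e) = graph_isom G (g e))) (carrier (graph_cstar G))"

lemma induced_auto:
  assumes "graph_auto G f g"
  shows "induced_auto f g \<in> star_hom (graph_cstar G) (graph_cstar G)"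
    and "v \<in> verts G \<Longrightarrow> induced_auto f g (graph_proj G v) = graph_proj G (f v)"
    and "e \<in> arcs G \<Longrightarrow> induced_auto f g (graph_isom G e) = graph_isom G (g e)"
proof -
  define P where "P \<phi> \<longleftrightarrow> \<phi> \<in> star_hom (graph_cstar G) (graph_cstar G) \<and>
     (\<forall>v\<in>verts G. \<phi> (graph_proj G v) = graph_proj G (f v)) \<and>
     (\<forall>e\<in>arcs G. \<phi> (graph_isom G e) = graph_isom G (g e))" for \<phi>
  have "ck_family G (graph_cstar G) (graph_proj G \<circ> f) (graph_isom G \<circ> g)"
    by (rule ck_family_graph_auto[OF wf C_alg family assms])
  from graph_cstar_universal[OF wf row_finite countable C_alg this]
  have "\<exists>\<phi>. P \<phi>" by (auto simp: P_def)
  then have "P (SOME \<phi>. P \<phi>)" by (rule someI_ex)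
  moreover define \<psi> where "\<psi> = (SOME \<phi>. P \<phi>)"
  ultimately have "P \<psi>" by simp
  then have h: "\<psi> \<in> star_hom (graph_cstar G) (graph_cstar G)"
    and gen: "v \<in> verts G \<Longrightarrow> \<psi> (graph_proj G v) = graph_proj G (f v)"
      "e \<in> arcs G \<Longrightarrow> \<psi> (graph_isom G e) = graph_isom G (g e)" for v e
    by (simp_all add: P_def)
  have eq: "induced_auto f g = restrict \<psi> (carrier (graph_cstar G))"
    by (simp add: induced_auto_def \<psi>_def P_def)
  show "induced_auto f g \<in> star_hom (graph_cstar G) (graph_cstar G)"
    using star_homD[OF h] unfolding eq
    by (simp add: star_hom_def C.mult_closed C.a_smult_closed C.adj_closed)
  show "v \<in> verts G \<Longrightarrow> induced_auto f g (graph_proj G v) = graph_proj G (f v)"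
    and "e \<in> arcs G \<Longrightarrow> induced_auto f g (graph_isom G e) = graph_isom G (g e)"
    unfolding eq by (simp_all add: gen proj_closed isom_closed)
qed

lemma induced_auto_comp:
  assumes fg: "graph_auto G f g" and fg': "graph_auto G f' g'" and fg'': "graph_auto G f'' g''"
    and f: "\<And>v. v \<in> verts G \<Longrightarrow> f'' v = f (f' v)" and g: "\<And>e. e \<in> arcs G \<Longrightarrow> g'' e = g (g' e)"
    and x: "x \<in> carrier (graph_cstar G)"
  shows "induced_auto f'' g'' x = induced_auto f g (induced_auto f' g' x)"
proof (rule hom_eqI[OF C_alg induced_auto(1)[OF fg''] _ _ _ x])
  have in_G: "v \<in> verts G \<Longrightarrow> f' v \<in> verts G" "e \<in> arcs G \<Longrightarrow> g' e \<in> arcs G" for v e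
    using fg' by (auto simp: graph_auto_def dest: bij_betwE)
  show "(\<lambda>x. induced_auto f g (induced_auto f' g' x)) \<in> star_hom (graph_cstar G) (graph_cstar G)"
    using star_homD[OF induced_auto(1)[OF fg]] star_homD[OF induced_auto(1)[OF fg']] by (simp add: star_hom_def)
  show "induced_auto f'' g'' (graph_proj G v) = induced_auto f g (induced_auto f' g' (graph_proj G v))" if "v \<in> verts G" for v
    using that by (simp add: induced_auto(2)[OF fg] induced_auto(2)[OF fg'] induced_auto(2)[OF fg''] f in_G)
  show "induced_auto f'' g'' (graph_isom G e) = induced_auto f g (induced_auto f' g' (graph_isom G e))" if "e \<in> arcs G" for e
    using that by (simp add: induced_auto(3)[OF fg] induced_auto(3)[OF fg'] induced_auto(3)[OF fg''] g in_G)
qed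

lemma graph_auto_id: "graph_auto G (\<lambda>v. v) (\<lambda>e. e)"
  by (simp add: graph_auto_def bij_betw_def)

lemma induced_auto_id: "x \<in> carrier (graph_cstar G) \<Longrightarrow> induced_auto (\<lambda>v. v) (\<lambda>e. e) x = x"
  by (rule hom_eqI[OF C_alg induced_auto(1)[OF graph_auto_id], where \<psi> = "\<lambda>x. x"])
    (simp_all add: induced_auto[OF graph_auto_id] star_hom_def)

lemma induced_auto_star_auto:
  assumes fg: "graph_auto G f g" shows "induced_auto f g \<in> star_auto (graph_cstar G)"
proof -
  let ?f = "inv_into (verts G) f" and ?g = "inv_into (arcs G) g"
  note fg' = graph_auto_inv[OF wf fg]
  have b: "bij_betw f (verts G) (verts G)" "bij_betw g (arcs G) (arcs G)" using fg by (auto simp: graph_auto_def)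
  have "bij_betw (induced_auto f g) (carrier (graph_cstar G)) (carrier (graph_cstar G))"
  proof (rule bij_betw_byWitness[where f' = "induced_auto ?f ?g"])
    show "\<forall>x\<in>carrier (graph_cstar G). induced_auto ?f ?g (induced_auto f g x) = x"
      using induced_auto_comp[OF fg' fg graph_auto_id] b
      by (simp add: bij_betw_inv_into_left induced_auto_id)
    show "\<forall>x\<in>carrier (graph_cstar G). induced_auto f g (induced_auto ?f ?g x) = x"
      using induced_auto_comp[OF fg fg' graph_auto_id] b
      by (simp add: bij_betw_inv_into_right induced_auto_id)
  qed (use star_homD(1)[OF induced_auto(1)] fg fg' in auto)
  moreover have "induced_auto f g \<in> extensional (carrier (graph_cstar G))" by (simp add: induced_auto_def)
  ultimately show ?thesis using induced_auto(1)[OF fg] by (simp add: star_auto_def Bij_def)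
qed

text \<open>The obstruction to being approximately inner. The path representation from \<open>w\<close> would annihilate the
  projection of an unreachable vertex \<open>v\<close>, and with it every conjugate \<open>u p\<^sub>v u\<^sup>*\<close>, but not \<open>p\<^sub>w\<close>. Its values on
  \<open>p\<^sub>w\<close> and \<open>u p\<^sub>v u\<^sup>*\<close> thus have distance \<open>\<parallel>\<pi> p\<^sub>w\<parallel> = 1\<close>, while an approximately inner automorphism taking \<open>p\<^sub>v\<close> to
  \<open>p\<^sub>w\<close> would bring \<open>u p\<^sub>v u\<^sup>*\<close> closer to \<open>p\<^sub>w\<close> than that.\<close>

theorem approx_Inn_source_reachable:
  assumes \<theta>: "\<theta> \<in> approx_Inn (graph_cstar G)" and v: "v \<in> verts G"
    and w: "w \<in> verts G" "\<And>e. e \<in> arcs G \<Longrightarrow> head G e \<noteq> w"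
    and eq: "\<theta> (graph_proj G v) = graph_proj G w"
  shows "w \<rightarrow>\<^sup>* v"
proof (rule ccontr)
  assume nr: "\<not> w \<rightarrow>\<^sup>* v"
  let ?B = "operator_algebra :: ('e list ell2 \<Rightarrow>\<^sub>L 'e list ell2) cstar" and ?C = "graph_cstar G"
  have B: "cstar_algebra ?B" by (rule cstar_algebra_operator_algebra)
  interpret B: cstar_algebra ?B by (rule B)
  obtain q T where fam: "ck_family G ?B q T" and qw: "q w \<noteq> 0" and qv: "q v = 0"
    using path_representation[OF row_finite w] nr by metis
  obtain \<pi> where h: "\<pi> \<in> star_hom ?C ?B" and p: "\<And>v. v \<in> verts G \<Longrightarrow> \<pi> (graph_proj G v) = q v"
    using graph_cstar_universal[OF wf row_finite countable B fam] by blast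
  note hD = star_homD[OF h]
  let ?p = "graph_proj G v"
  have pC: "?p \<in> carrier ?C" "graph_proj G w \<in> carrier ?C" using proj_closed v w by blast+
  from \<theta> obtain u where u: "u \<in> unitaries ?C"
    and near: "\<And>x. x \<in> {?p} \<Longrightarrow> cnorm ?C (\<theta> x \<ominus>\<^bsub>?C\<^esub> inner_auto ?C u x) < 1"
    by (rule C.approx_InnD[where F = "{?p}" and \<epsilon> = 1]) (use pC in auto)
  obtain x l where ul: "u = (x, l)" by (cases u)
  have x: "x \<in> carrier ?C" using C.unitariesD(1)[OF u] by (simp add: ul C.unitization_simps)
  have "\<pi> (inner_auto ?C u ?p) = \<zero>\<^bsub>?B\<^esub>"
    using p[OF v] qv x pC
    by (simp add: ul inner_auto_def C.unitization_simps hD C.mult_closed C.a_smult_closed C.adj_closed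
        flip: operator_algebra_simps(3))
      (simp add: B.mult_zero B.smult_zero B.smult_0 hD B.adj_closed)
  moreover have inC: "inner_auto ?C u ?p \<in> carrier ?C" by (rule C.inner_auto_closed[OF u pC(1)])
  ultimately have "\<pi> (graph_proj G w \<ominus>\<^bsub>?C\<^esub> inner_auto ?C u ?p) = q w \<ominus>\<^bsub>?B\<^esub> \<zero>\<^bsub>?B\<^esub>"
    using star_hom_minus[OF C_alg B h pC(2) inC] p[OF w(1)] by simp
  also have "\<dots> = q w"
    using ck_familyD(1)[OF fam w(1)] B.minus_smult[of "q w" "\<zero>\<^bsub>?B\<^esub>"] by (simp add: B.smult_zero)
  finally have "cnorm ?B (q w) < 1"
    using star_hom_contractive[OF C_alg B h, of "graph_proj G w \<ominus>\<^bsub>?C\<^esub> inner_auto ?C u ?p"]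
      near[of ?p] C.minus_closed'[OF pC(2) inC] eq by simp
  moreover have "cnorm ?B (q w) = (cnorm ?B (q w))\<^sup>2"
    using ck_familyD(1-3)[OF fam w(1)] B.cnorm_cstar[of "q w"] by simp
  ultimately have "cnorm ?B (q w) = 0" by (simp add: power2_eq_square)
  then show False using qw by (simp add: operator_algebra_simps)
qed

end

section \<open>The graph of an abelian group\<close>

lemma verts_Gamma_iff:
  "v \<in> verts (Gamma A) \<longleftrightarrow> set_gvert v \<subseteq> carrier A \<and> (\<forall>a b n. v = Vtx_un a b n \<longrightarrow> n \<ge> 1)"
  by (cases v) (auto simp: Gamma_def)

lemma arcs_Gamma_iff:
  "e \<in> arcs (Gamma A) \<longleftrightarrow> set_gedge e \<subseteq> carrier A \<and>
     (\<forall>a b n. (e = UNtoUN a b n \<longrightarrow> n \<ge> 2) \<and> (e = LoopUN a b n \<longrightarrow> n \<ge> 1))"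
  by (cases e) (auto simp: Gamma_def)

lemma map_gvert_Gamma:
  assumes "\<alpha> \<in> carrier A \<rightarrow> carrier A" "v \<in> verts (Gamma A)" shows "map_gvert \<alpha> v \<in> verts (Gamma A)"
  using assms by (cases v) (auto simp: verts_Gamma_iff)

lemma map_gedge_Gamma:
  assumes "\<alpha> \<in> carrier A \<rightarrow> carrier A" "e \<in> arcs (Gamma A)" shows "map_gedge \<alpha> e \<in> arcs (Gamma A)"
  using assms by (cases e) (auto simp: arcs_Gamma_iff)

lemma map_gvert_comp:
  assumes "v \<in> verts (Gamma A)" "\<And>a. a \<in> carrier A \<Longrightarrow> \<gamma> a = \<alpha> (\<beta> a)"
  shows "map_gvert \<gamma> v = map_gvert \<alpha> (map_gvert \<beta> v)"
  using assms by (cases v) (auto simp: verts_Gamma_iff)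

lemma map_gedge_comp:
  assumes "e \<in> arcs (Gamma A)" "\<And>a. a \<in> carrier A \<Longrightarrow> \<gamma> a = \<alpha> (\<beta> a)"
  shows "map_gedge \<gamma> e = map_gedge \<alpha> (map_gedge \<beta> e)"
  using assms by (cases e) (auto simp: arcs_Gamma_iff)

text \<open>Relabelling vertices and edges by \<open>\<alpha>\<close> respects the sources of the edges \<open>UtoUU a b\<close> precisely because
  \<open>\<alpha>\<close> is multiplicative.\<close>

lemma graph_auto_Gamma:
  assumes \<alpha>: "\<alpha> \<in> auto A" shows "graph_auto (Gamma A) (map_gvert \<alpha>) (map_gedge \<alpha>)"
proof -
  have bij: "bij_betw \<alpha> (carrier A) (carrier A)" and hom: "\<alpha> \<in> hom A A"
    using \<alpha> by (auto simp: auto_def Bij_def)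
  let ?\<beta> = "inv_into (carrier A) \<alpha>"
  have \<alpha>f: "\<alpha> \<in> carrier A \<rightarrow> carrier A" and \<beta>f: "?\<beta> \<in> carrier A \<rightarrow> carrier A"
    using bij bij_betw_inv_into[OF bij] by (auto dest: bij_betwE)
  have inv: "?\<beta> (\<alpha> a) = a" "\<alpha> (?\<beta> a) = a" if "a \<in> carrier A" for a
    using that bij by (simp_all add: bij_betw_inv_into_left bij_betw_inv_into_right)
  have "bij_betw (map_gvert \<alpha>) (verts (Gamma A)) (verts (Gamma A))"
  proof (rule bij_betw_byWitness[where f' = "map_gvert ?\<beta>"])
    show "\<forall>v\<in>verts (Gamma A). map_gvert ?\<beta> (map_gvert \<alpha> v) = v"
      using map_gvert_comp[of _ A "\<lambda>a. a" ?\<beta> \<alpha>] inv by (simp add: gvert.map_ident)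
    show "\<forall>v\<in>verts (Gamma A). map_gvert \<alpha> (map_gvert ?\<beta> v) = v"
      using map_gvert_comp[of _ A "\<lambda>a. a" \<alpha> ?\<beta>] inv by (simp add: gvert.map_ident)
  qed (use map_gvert_Gamma \<alpha>f \<beta>f in blast)+
  moreover have "bij_betw (map_gedge \<alpha>) (arcs (Gamma A)) (arcs (Gamma A))"
  proof (rule bij_betw_byWitness[where f' = "map_gedge ?\<beta>"])
    show "\<forall>e\<in>arcs (Gamma A). map_gedge ?\<beta> (map_gedge \<alpha> e) = e"
      using map_gedge_comp[of _ A "\<lambda>a. a" ?\<beta> \<alpha>] inv by (simp add: gedge.map_ident)
    show "\<forall>e\<in>arcs (Gamma A). map_gedge \<alpha> (map_gedge ?\<beta> e) = e"
      using map_gedge_comp[of _ A "\<lambda>a. a" \<alpha> ?\<beta>] inv by (simp add: gedge.map_ident)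
  qed (use map_gedge_Gamma \<alpha>f \<beta>f in blast)+
  moreover have tail_head: "tail (Gamma A) = gsource A" "head (Gamma A) = grange"
    by (simp_all add: Gamma_def)
  have "tail (Gamma A) (map_gedge \<alpha> e) = map_gvert \<alpha> (tail (Gamma A) e)"
    "head (Gamma A) (map_gedge \<alpha> e) = map_gvert \<alpha> (head (Gamma A) e)" if "e \<in> arcs (Gamma A)" for e
    using that hom_mult[OF hom] tail_head by (cases e; auto simp: arcs_Gamma_iff)+
  ultimately show ?thesis by (simp add: graph_auto_def)
qed

theorem corollary3p4:
  fixes A :: "('a, 'm) monoid_scheme"
  assumes "comm_group A" and "countable (carrier A)"
  shows "\<exists>h. h \<in> mon (AutoGroup A) (Kout (graph_cstar (Gamma A)))"
proof -
  interpret A: comm_group A by fact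
  interpret row_finite_graph "Gamma A"
    using wf_digraph_Gamma[OF assms(1)] row_finite_Gamma countable_Gamma[OF assms(2)]
    by (intro row_finite_graph.intro row_finite_graph_axioms.intro)
  let ?C = "graph_cstar (Gamma A)" and ?N = "approx_Inn (graph_cstar (Gamma A))"
  let ?S = "StarAutoGroup ?C"
  define t where "t \<alpha> = induced_auto (map_gvert \<alpha>) (map_gedge \<alpha>)" for \<alpha> :: "'a \<Rightarrow> 'a"
  interpret N: normal ?N ?S by (rule normal_approx_Inn[OF C_alg])
  have carr: "carrier (AutoGroup A) = auto A" by (simp add: AutoGroup_def)
  have one: "\<one>\<^bsub>AutoGroup A\<^esub> = (\<lambda>a\<in>carrier A. a)" by (simp add: AutoGroup_def BijGroup_def)
  have mult: "\<alpha> \<otimes>\<^bsub>AutoGroup A\<^esub> \<beta> = compose (carrier A) \<alpha> \<beta>" if "\<alpha> \<in> auto A" "\<beta> \<in> auto A" for \<alpha> \<beta>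
    using that by (simp add: AutoGroup_def BijGroup_def auto_def)
  interpret G: group "AutoGroup A" by (rule A.AutoGroup)
  have tS: "t \<alpha> \<in> star_auto ?C" if "\<alpha> \<in> auto A" for \<alpha>
    unfolding t_def by (rule induced_auto_star_auto[OF graph_auto_Gamma[OF that]])
  have "t \<in> hom (AutoGroup A) ?S"
  proof (rule homI)
    fix \<alpha> \<beta> assume "\<alpha> \<in> carrier (AutoGroup A)" "\<beta> \<in> carrier (AutoGroup A)"
    then have a: "\<alpha> \<in> auto A" "\<beta> \<in> auto A" and ab: "compose (carrier A) \<alpha> \<beta> \<in> auto A"
      using G.m_closed[of \<alpha> \<beta>] by (simp_all add: carr mult)
    have "t (compose (carrier A) \<alpha> \<beta>) = compose (carrier ?C) (t \<alpha>) (t \<beta>)"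
    proof (rule extensionalityI[where A = "carrier ?C"])
      show "t (compose (carrier A) \<alpha> \<beta>) \<in> extensional (carrier ?C)"
        using tS[OF ab] by (simp add: star_auto_def Bij_def)
      fix x assume x: "x \<in> carrier ?C"
      have "t (compose (carrier A) \<alpha> \<beta>) x = t \<alpha> (t \<beta> x)"
        unfolding t_def
        by (rule induced_auto_comp[OF graph_auto_Gamma[OF a(1)] graph_auto_Gamma[OF a(2)] graph_auto_Gamma[OF ab] _ _ x])
          (auto intro!: map_gvert_comp map_gedge_comp simp: compose_eq)
      then show "t (compose (carrier A) \<alpha> \<beta>) x = compose (carrier ?C) (t \<alpha>) (t \<beta>) x"
        using x by (simp add: compose_eq)
    qed (simp add: compose_extensional)
    then show "t (\<alpha> \<otimes>\<^bsub>AutoGroup A\<^esub> \<beta>) = t \<alpha> \<otimes>\<^bsub>?S\<^esub> t \<beta>"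
      using a tS by (simp add: mult StarAutoGroup_simps)
  qed (use tS in \<open>simp add: carr StarAutoGroup_simps\<close>)
  then have hom: "(\<lambda>\<alpha>. ?N #>\<^bsub>?S\<^esub> t \<alpha>) \<in> hom (AutoGroup A) (Kout ?C)"
    using hom_compose[OF _ N.r_coset_hom_Mod] by (simp add: Kout_def o_def)
  have "\<alpha> = \<one>\<^bsub>AutoGroup A\<^esub>" if \<alpha>: "\<alpha> \<in> auto A" and "?N #>\<^bsub>?S\<^esub> t \<alpha> = ?N" for \<alpha>
  proof -
    have tN: "t \<alpha> \<in> ?N"
      using N.coset_join1[OF that(2)] tS[OF \<alpha>] N.subgroup_axioms by (simp add: StarAutoGroup_simps)
    have "\<alpha> a = a" if a: "a \<in> carrier A" for a
    proof -
      \<comment> \<open>no edge enters \<open>Vtx_v b\<close>, so it is reachable only from itself\<close>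
      have source: "head (Gamma A) e \<noteq> Vtx_v b" for e b
        by (cases e) (simp_all add: Gamma_def)
      have \<alpha>a: "\<alpha> a \<in> carrier A" using \<alpha> a by (auto simp: auto_def Bij_def dest: bij_betwE)
      have "Vtx_v (\<alpha> a) \<rightarrow>\<^sup>*\<^bsub>Gamma A\<^esub> Vtx_v a"
      proof (rule approx_Inn_source_reachable[OF tN])
        show "t \<alpha> (graph_proj (Gamma A) (Vtx_v a)) = graph_proj (Gamma A) (Vtx_v (\<alpha> a))"
          using a by (simp add: t_def induced_auto(2)[OF graph_auto_Gamma[OF \<alpha>]] verts_Gamma_iff)
      qed (use a \<alpha>a source in \<open>simp_all add: verts_Gamma_iff\<close>)
      then obtain p where "awalk (Vtx_v (\<alpha> a)) p (Vtx_v a)" by (auto simp: reachable_awalk)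
      then show "\<alpha> a = a"
        by (cases p rule: rev_cases)
          (auto simp: awalk_Nil_iff awalk_snoc_iff not_sym[OF source] simp del: awalk_append_iff)
    qed
    then show ?thesis
      using \<alpha> by (auto simp: one auto_def Bij_def intro: extensionalityI[where A = "carrier A"])
  qed
  then have "(\<lambda>\<alpha>. ?N #>\<^bsub>?S\<^esub> t \<alpha>) \<in> mon (AutoGroup A) (Kout ?C)"
    using hom N.factorgroup_is_group by (auto simp: mon_iff_hom_one G.group_axioms Kout_def carr)
  then show ?thesis by blast
qed

end
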